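(* Let $i\colon N\to M$ be a subdivision of a finite simplicial complex $N$. If the number of $(k+1)$-simplices has changed due to the subdivision (i.e. $M$ and $N$ have different numbers of $(k+1)$-simplices), then $C_k=\langle\operatorname{im} i_*,\partial V_{k+1}\rangle\in(0,1)$. In particular, for non-trivial subdivisions of pure simplicial complexes, $C_k\in(0,1)$ in all positive codimensions, i.e. for all $0\le k<\dim N$.
   Context: Chains are simplicial chains with real coefficients, and the standard inner product on the chains of $M$ is the one for which the simplices are orthonormal. A subdivision $i\colon N\to M$ induces the injective chain map $i_*$ sending an oriented simplex of $N$ to the sum of the compatibly oriented simplices of $M$ of the same dimension subdividing it. Subspaces $V_k$ of the $k$-chains of $M$ are defined by downward recursion: $V_{top}=(\operatorname{im} i_* )^\perp$ in the top dimension and $V_k=(\operatorname{im} i_*\oplus\partial V_{k+1})^\perp$, complements taken in degree $k$ in the standard inner product. For subspaces $X,Y$ of an inner product space, $\langle X,Y\rangle=\max\{(x,y):x\in X,\ y\in Y,\ |x|=|y|=1\}$. The number $C_k$ is $\langle\operatorname{im} i_*,\partial V_{k+1}\rangle$ in degree $k$, with respect to the standard inner product. *)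

theory Defs
  imports
    "HOL-Analysis.Analysis"
    "HOL-Analysis.Finite_Function_Topology"
    "HOL-Library.Set_Algebras"
    "HOL-Combinatorics.Permutations"
    "Jordan_Normal_Form.Determinant"
begin

text \<open>
  Finite simplicial complexes are the geometric ones of the library, \<^const>\<open>simplicial_complex\<close>.
  In the library's convention a complex also contains the empty set, as a simplex of
  dimension \<open>-1\<close>; it never enters the chain groups below, which are indexed by \<^typ>\<open>nat\<close>.
\<close>

definition simplices_of :: "'a::euclidean_space set set \<Rightarrow> nat \<Rightarrow> 'a set set" where
  "simplices_of K k = {S \<in> K. int k simplex S}"

text \<open>The inserted \<open>-1\<close> only matters for the complex without any member.\<close>

definition complex_dim :: "'a::euclidean_space set set \<Rightarrow> int" where
  "complex_dim K = Max (insert (-1) (aff_dim ` K))"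

definition pure_complex :: "'a::euclidean_space set set \<Rightarrow> bool" where
  "pure_complex K \<longleftrightarrow>
     (\<forall>S\<in>K. (\<forall>T\<in>K. S \<subseteq> T \<longrightarrow> T = S) \<longrightarrow> aff_dim S = complex_dim K)"

text \<open>\<open>subdivision N M\<close>: \<open>M\<close> is a subdivision of \<open>N\<close>, the map \<open>i\<close> being the identity of the
  common underlying polyhedron.\<close>

definition subdivision :: "'a::euclidean_space set set \<Rightarrow> 'a set set \<Rightarrow> bool" where
  "subdivision N M \<longleftrightarrow>
     simplicial_complex N \<and> simplicial_complex M \<and>
     \<Union>M = \<Union>N \<and> (\<forall>T\<in>M. \<exists>S\<in>N. T \<subseteq> S)"

text \<open>
  A choice of orientation for the simplices of a complex: every simplex is given an ordering
  of its vertices.  A chain is a finitely supported function on simplices, the basis element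
  \<^term>\<open>Poly_Mapping.single S 1\<close> standing for \<open>S\<close> with its chosen orientation.
\<close>

definition orientation_choice :: "'a::euclidean_space set set \<Rightarrow> ('a set \<Rightarrow> 'a list) \<Rightarrow> bool" where
  "orientation_choice K ori \<longleftrightarrow>
     (\<forall>S\<in>K. distinct (ori S) \<and> set (ori S) = {v. v extreme_point_of S})"

type_synonym 'a chain = "'a set \<Rightarrow>\<^sub>0 real"

definition chains :: "'a::euclidean_space set set \<Rightarrow> nat \<Rightarrow> 'a chain set" where
  "chains K k = {c. Poly_Mapping.keys c \<subseteq> simplices_of K k}"

definition linear_extension :: "('a set \<Rightarrow> 'a chain) \<Rightarrow> 'a chain \<Rightarrow> 'a chain" where
  "linear_extension f c = (\<Sum>S\<in>Poly_Mapping.keys c. Poly_Mapping.lookup c S *\<^sub>R f S)"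

text \<open>The norm that the library puts on \<^typ>\<open>'a set \<Rightarrow>\<^sub>0 real\<close> is the \<open>l\<^sup>1\<close> norm, so the
  Euclidean structure in which the simplices are orthonormal is introduced separately.\<close>

definition chain_inner :: "'a chain \<Rightarrow> 'a chain \<Rightarrow> real" where
  "chain_inner c d =
     (\<Sum>S\<in>Poly_Mapping.keys c. Poly_Mapping.lookup c S * Poly_Mapping.lookup d S)"

definition chain_norm :: "'a chain \<Rightarrow> real" where
  "chain_norm c = sqrt (chain_inner c c)"

definition even_rearrangement :: "'a list \<Rightarrow> 'a list \<Rightarrow> bool" where
  "even_rearrangement xs ys \<longleftrightarrow>
     (\<exists>p. p permutes {..<length xs} \<and> evenperm p \<and> ys = permute_list p xs)"

text \<open>The oriented simplex \<open>[v\<^sub>0, \<dots>, v\<^sub>k]\<close> as a chain.\<close>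

definition oriented_simplex :: "('a::euclidean_space set \<Rightarrow> 'a list) \<Rightarrow> 'a list \<Rightarrow> 'a chain" where
  "oriented_simplex ori vs =
     (let S = convex hull (set vs) in
      if even_rearrangement (ori S) vs then Poly_Mapping.single S 1
      else - Poly_Mapping.single S 1)"

text \<open>The boundary is the usual alternating sum over the faces opposite to the vertices.
  In degree 0 it is zero (there is no augmentation).\<close>

definition chain_bd :: "('a::euclidean_space set \<Rightarrow> 'a list) \<Rightarrow> 'a chain \<Rightarrow> 'a chain" where
  "chain_bd ori =
     linear_extension (\<lambda>S. let vs = ori S in
       if length vs \<le> 1 then 0
       else (\<Sum>i<length vs. (-1) ^ i *\<^sub>R oriented_simplex ori (take i vs @ drop (Suc i) vs)))"

text \<open>
  Two ordered simplices \<open>[x\<^sub>0, \<dots>, x\<^sub>k]\<close> and \<open>[y\<^sub>0, \<dots>, y\<^sub>k]\<close> spanning the same affine space are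
  compatibly oriented if the matrix expressing the frame \<open>y\<^sub>i - y\<^sub>0\<close> in the frame \<open>x\<^sub>j - x\<^sub>0\<close> has
  positive determinant.  For \<open>k = 0\<close> the determinant is \<open>1\<close>.
\<close>

definition compatibly_oriented :: "'a::euclidean_space list \<Rightarrow> 'a list \<Rightarrow> bool" where
  "compatibly_oriented xs ys \<longleftrightarrow>
     length ys = length xs \<and>
     (\<exists>A \<in> carrier_mat (length xs - 1) (length xs - 1).
        (\<forall>i < length xs - 1.
           ys ! Suc i - ys ! 0 =
             (\<Sum>j < length xs - 1. (A $$ (i, j)) *\<^sub>R (xs ! Suc j - xs ! 0))) \<and>
        Determinant.det A > (0::real))"

text \<open>The chain map \<open>i\<^sub>*\<close> of a subdivision \<open>M\<close>.\<close>

definition subdiv_map ::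
  "('a::euclidean_space set \<Rightarrow> 'a list) \<Rightarrow> 'a set set \<Rightarrow> 'a chain \<Rightarrow> 'a chain" where
  "subdiv_map ori M =
     linear_extension (\<lambda>S. \<Sum>T | T \<in> M \<and> T \<subseteq> S \<and> aff_dim T = aff_dim S.
       if compatibly_oriented (ori S) (ori T) then Poly_Mapping.single T 1
       else - Poly_Mapping.single T 1)"

definition im_subdiv ::
  "('a::euclidean_space set \<Rightarrow> 'a list) \<Rightarrow> 'a set set \<Rightarrow> 'a set set \<Rightarrow> nat \<Rightarrow> 'a chain set" where
  "im_subdiv ori N M k = subdiv_map ori M ` chains N k"

definition perp :: "'a::euclidean_space set set \<Rightarrow> nat \<Rightarrow> 'a chain set \<Rightarrow> 'a chain set" where
  "perp M k X = {c \<in> chains M k. \<forall>x\<in>X. chain_inner x c = 0}"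

text \<open>The subspaces \<open>V\<^sub>k\<close>; the sum of subspaces is the elementwise \<open>+\<close> of sets.\<close>

function subspace_V ::
  "('a::euclidean_space set \<Rightarrow> 'a list) \<Rightarrow> 'a set set \<Rightarrow> 'a set set \<Rightarrow> nat \<Rightarrow> 'a chain set" where
  "subspace_V ori N M k =
     (if int k < complex_dim M
      then perp M k (im_subdiv ori N M k + chain_bd ori ` subspace_V ori N M (Suc k))
      else perp M k (im_subdiv ori N M k))"
  by auto
termination
  by (relation "Wellfounded.measure (\<lambda>(ori, N, M, k). nat (complex_dim M) - k)") auto

declare subspace_V.simps [simp del]

text \<open>\<open>\<langle>X, Y\<rangle>\<close> is a maximum, hence \<open>GREATEST\<close> rather than a supremum.\<close>

definition max_cos :: "'a chain set \<Rightarrow> 'a chain set \<Rightarrow> real" where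
  "max_cos X Y =
     (GREATEST r. \<exists>x\<in>X. \<exists>y\<in>Y. chain_norm x = 1 \<and> chain_norm y = 1 \<and> r = chain_inner x y)"

definition const_C ::
  "('a::euclidean_space set \<Rightarrow> 'a list) \<Rightarrow> 'a set set \<Rightarrow> 'a set set \<Rightarrow> nat \<Rightarrow> real" where
  "const_C ori N M k = max_cos (im_subdiv ori N M k) (chain_bd ori ` subspace_V ori N M (Suc k))"

end

theory Submission
  imports Defs
begin

text \<open>
  \<open>C\<^sub>k < 1\<close>: by compactness it suffices that \<open>im i\<^sub>*\<close> and \<open>\<partial>V\<close> meet trivially. This follows from
  the vanishing of the homology of \<open>C(M) / i\<^sub>* C(N)\<close>: if \<open>\<partial>v = i\<^sub>* x\<close> then \<open>v\<close> is in
  \<open>im i\<^sub>* + \<partial>V\<close>, to which it is orthogonal. The vanishing comes from a Sperner labelling, which gives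
  a left inverse of \<open>i\<^sub>*\<close>, and from acyclic carriers; that triangulations of convex sets are acyclic is
  seen by passing to ordered tuples of nearby points, which can be contracted along segments and
  mapped back to the triangulation by a labelling with close star vertices.

  \<open>C\<^sub>k > 0\<close>: if \<open>im i\<^sub>*\<close> were orthogonal to \<open>\<partial>V\<close>, then the up-Laplacian \<open>\<partial>\<partial>\<^sup>T\<close> would preserve
  \<open>im i\<^sub>*\<close> in degree \<open>k\<close>. Apply it to the faces of a minimal subdivided simplex \<open>S\<close> of dimension at
  least \<open>k + 1\<close>. If \<open>dim S > k + 1\<close>, the image is nonzero on a simplex with an interior vertex. If
  \<open>dim S = k + 1\<close>, the part of \<open>\<partial>\<^sup>T i\<^sub>* G\<close> inside \<open>S\<close> is a nonzero multiple of \<open>i\<^sub>* S\<close>, so that every top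
  simplex in \<open>S\<close> has a facet in every facet of \<open>S\<close> and hence is \<open>S\<close>.
\<close>

text \<open>Both halves of the theorem reduce to one statement: if some simplex of \<open>N\<close>
  with at least k + 2 vertices is missing from \<open>M\<close>, then C_k lies in (0,1). Two
  obstacles shape the proof. Every simplex has an arbitrary vertex order, so the constructions that
  carry signs are written as alternating functions of vertex lists, and identities are checked for
  one order of each vertex set. And ordinary chains of a convex set are not acyclic in degree 0; so
  the empty simplex is kept, boundaries are augmented and degrees count vertices, and carrier
  arguments start from the empty simplex without exceptions. The case split for C_k > 0 comes from
  minimality, which only controls faces of dimension at least k + 1: if dim S > k + 1, all proper
  faces of S are simplices of \<open>M\<close>, while for dim S = k + 1 the facets may be subdivided
  too. In the second case the Laplacian also sees simplices outside S; within S, cutting these off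
  changes coefficients only on the chosen facet, where they can be computed directly.\<close>

section \<open>Linear extensions from basis elements\<close>

abbreviation bas :: "'b \<Rightarrow> 'b \<Rightarrow>\<^sub>0 real" where
  "bas x \<equiv> Poly_Mapping.single x 1"

text \<open>\<open>linear_extension\<close> for arbitrary index types and targets: it also acts on
  chains of vertex lists and, with real values, expresses coefficients and inner products.\<close>

definition lin :: "('b \<Rightarrow> 'c::real_vector) \<Rightarrow> ('b \<Rightarrow>\<^sub>0 real) \<Rightarrow> 'c" where
  "lin f c = (\<Sum>b\<in>Poly_Mapping.keys c. Poly_Mapping.lookup c b *\<^sub>R f b)"

lemma linear_extension_eq_lin: "linear_extension f = lin f"
  by (rule ext) (simp add: linear_extension_def lin_def)

lemma lookup_scaleR [simp]:
  "Poly_Mapping.lookup (a *\<^sub>R c) x = a * Poly_Mapping.lookup (c :: 'b \<Rightarrow>\<^sub>0 real) x"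
  by (simp add: scaleR_poly_mapping_def Poly_Mapping.map.rep_eq when_def)

lemma lin_superset:
  assumes "finite A" "Poly_Mapping.keys c \<subseteq> A"
  shows "lin f c = (\<Sum>b\<in>A. Poly_Mapping.lookup c b *\<^sub>R f b)"
  unfolding lin_def using assms
  by (intro sum.mono_neutral_left) (auto simp: in_keys_iff)

lemma linear_lin: "linear (lin f)"
proof (rule linearI)
  fix c d :: "'a \<Rightarrow>\<^sub>0 real" and a :: real
  let ?A = "Poly_Mapping.keys c \<union> Poly_Mapping.keys d"
  have "Poly_Mapping.keys (c + d) \<subseteq> ?A"
    by (rule Poly_Mapping.keys_add)
  then show "lin f (c + d) = lin f c + lin f d"
    by (simp add: lin_superset[of ?A] lookup_add scaleR_left_distrib sum.distrib)
  have "Poly_Mapping.keys (a *\<^sub>R c) \<subseteq> Poly_Mapping.keys c"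
    by (auto simp: in_keys_iff)
  then show "lin f (a *\<^sub>R c) = a *\<^sub>R lin f c"
    by (simp add: lin_superset[of "Poly_Mapping.keys c"] scaleR_sum_right)
qed

lemmas lin_simps [simp] =
  linear_add[OF linear_lin] linear_diff[OF linear_lin] linear_neg[OF linear_lin]
  linear_scale[OF linear_lin] linear_0[OF linear_lin]
lemmas lin_sum = linear_sum[OF linear_lin]

lemma lin_bas [simp]: "lin f (bas x) = f x"
  by (simp add: lin_def)

lemma lin_bas_id [simp]: "lin bas c = c"
proof (rule poly_mapping_eqI)
  fix x
  show "Poly_Mapping.lookup (lin bas c) x = Poly_Mapping.lookup c x"
    by (simp add: lin_def lookup_sum lookup_single when_def in_keys_iff if_distrib cong: if_cong)
qed

lemma linear_lin_comp:
  assumes "linear h"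
  shows "h (lin f c) = lin (\<lambda>x. h (f x)) c"
  by (simp add: lin_def linear_sum[OF assms] linear_scale[OF assms])

lemma lin_lin: "lin g (lin f c) = lin (\<lambda>x. lin g (f x)) c"
  by (rule linear_lin_comp[OF linear_lin])

lemma lin_cong:
  assumes "\<And>x. x \<in> Poly_Mapping.keys c \<Longrightarrow> f x = g x"
  shows "lin f c = lin g c"
  by (simp add: lin_def assms)

lemma lin_add_fun: "lin (\<lambda>x. f x + g x) c = lin f c + lin g c"
  by (simp add: lin_def scaleR_right_distrib sum.distrib)

lemma lin_diff_fun: "lin (\<lambda>x. f x - g x) c = lin f c - lin g c"
  by (simp add: lin_def scaleR_right_diff_distrib sum_subtractf)

lemma lin_neg_fun: "lin (\<lambda>x. - f x) c = - lin f c"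
  by (simp add: lin_def sum_negf)

lemma lin_mem_subspace:
  assumes "subspace W" "\<And>x. x \<in> Poly_Mapping.keys c \<Longrightarrow> f x \<in> W"
  shows "lin f c \<in> W"
  unfolding lin_def using assms by (intro subspace_sum subspace_scale) auto

lemma linear_eq_lin:
  assumes "linear h"
  shows "h c = lin (\<lambda>x. h (bas x)) c"
  using linear_lin_comp[OF assms, of bas c] by simp

lemma lookup_lin:
  fixes f :: "'b \<Rightarrow> 'c \<Rightarrow>\<^sub>0 real"
  shows "Poly_Mapping.lookup (lin f c) x = lin (\<lambda>b. Poly_Mapping.lookup (f b) x) c"
  by (simp add: lin_def lookup_sum)

definition supp :: "'b set \<Rightarrow> ('b \<Rightarrow>\<^sub>0 real) set" where
  "supp A = {c. Poly_Mapping.keys c \<subseteq> A}"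

lemma supp_iff: "c \<in> supp A \<longleftrightarrow> (\<forall>x. x \<notin> A \<longrightarrow> Poly_Mapping.lookup c x = 0)"
  by (auto simp: supp_def in_keys_iff)

lemma subspace_supp: "subspace (supp A)"
  by (auto simp: subspace_def supp_iff lookup_add)

lemmas supp_intros = subspace_add[OF subspace_supp] subspace_diff[OF subspace_supp]
  subspace_neg[OF subspace_supp] subspace_scale[OF subspace_supp] subspace_0[OF subspace_supp]
  subspace_sum[OF subspace_supp]

lemma bas_in_supp [simp]: "bas x \<in> supp A \<longleftrightarrow> x \<in> A"
  by (auto simp: supp_def)

lemma supp_mono: "A \<subseteq> B \<Longrightarrow> supp A \<subseteq> supp B"
  by (auto simp: supp_def)

lemma lin_in_supp:
  assumes "c \<in> supp A" "\<And>x. x \<in> A \<Longrightarrow> f x \<in> W" "subspace W"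
  shows "lin f c \<in> W"
  using assms by (intro lin_mem_subspace) (auto simp: supp_def)

lemma lin_cong_supp:
  assumes "c \<in> supp A" "\<And>x. x \<in> A \<Longrightarrow> f x = g x"
  shows "lin f c = lin g c"
  using assms by (intro lin_cong) (auto simp: supp_def)

subsection \<open>Chains of ordered tuples\<close>

definition tcone :: "'b \<Rightarrow> ('b list \<Rightarrow>\<^sub>0 real) \<Rightarrow> ('b list \<Rightarrow>\<^sub>0 real)" where
  "tcone p = lin (\<lambda>xs. bas (p # xs))"

lemma linear_tcone: "linear (tcone p)"
  unfolding tcone_def by (rule linear_lin)

lemmas tcone_simps [simp] =
  linear_add[OF linear_tcone] linear_diff[OF linear_tcone] linear_neg[OF linear_tcone]
  linear_scale[OF linear_tcone] linear_0[OF linear_tcone]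
lemmas tcone_sum = linear_sum[OF linear_tcone]

lemma tcone_bas [simp]: "tcone p (bas xs) = bas (p # xs)"
  by (simp add: tcone_def)

lemma lin_tcone: "lin f (tcone p c) = lin (\<lambda>xs. f (p # xs)) c"
  by (simp add: tcone_def lin_lin)

lemma tcone_in_supp:
  assumes "c \<in> supp A" "\<And>xs. xs \<in> A \<Longrightarrow> p # xs \<in> B"
  shows "tcone p c \<in> supp B"
  unfolding tcone_def using assms by (intro lin_in_supp[OF _ _ subspace_supp]) auto

text \<open>The alternating sum of faces (\<open>tuple_bd_sum\<close>), written as the boundary
  formula of a cone. In this form \<partial>\<partial> = 0, naturality and the prism formula are
  inductions on the list. A one-element list has boundary \<open>bas []\<close>, so the complex is
  augmented.\<close>

fun tuple_bd :: "'b list \<Rightarrow> ('b list \<Rightarrow>\<^sub>0 real)" where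
  "tuple_bd [] = 0"
| "tuple_bd (p # ps) = bas ps - tcone p (tuple_bd ps)"

lemma tuple_bd_cone: "lin tuple_bd (tcone p c) = c - tcone p (lin tuple_bd c)"
proof -
  have "lin tuple_bd (tcone p c) = lin (\<lambda>xs. bas xs - tcone p (tuple_bd xs)) c"
    by (simp add: lin_tcone)
  also have "\<dots> = c - tcone p (lin tuple_bd c)"
    by (simp add: lin_diff_fun linear_lin_comp[OF linear_tcone])
  finally show ?thesis .
qed

lemma tuple_bd_bd: "lin tuple_bd (tuple_bd ps) = 0"
  by (induction ps) (simp_all add: tuple_bd_cone)

lemma tuple_bd_sum:
  "tuple_bd ps = (\<Sum>i<length ps. (-1) ^ i *\<^sub>R bas (take i ps @ drop (Suc i) ps))"
  by (induction ps) (simp_all add: sum.lessThan_Suc_shift tcone_sum sum_negf del: sum.lessThan_Suc)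

lemma tuple_bd_supp:
  "tuple_bd ps \<in> supp {take i ps @ drop (Suc i) ps | i. i < length ps}"
  unfolding tuple_bd_sum by (intro supp_intros) auto

lemma set_delete_nth: "set (take i ps @ drop (Suc i) ps) \<subseteq> set ps"
  using set_take_subset set_drop_subset by fastforce

definition tuple_map :: "('b \<Rightarrow> 'c) \<Rightarrow> ('b list \<Rightarrow>\<^sub>0 real) \<Rightarrow> ('c list \<Rightarrow>\<^sub>0 real)" where
  "tuple_map f = lin (\<lambda>xs. bas (map f xs))"

lemma tuple_map_bas [simp]: "tuple_map f (bas xs) = bas (map f xs)"
  by (simp add: tuple_map_def)

lemma linear_tuple_map: "linear (tuple_map f)"
  unfolding tuple_map_def by (rule linear_lin)

lemma tuple_map_cone: "tuple_map f (tcone p c) = tcone (f p) (tuple_map f c)"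
  unfolding tuple_map_def by (simp add: lin_tcone linear_lin_comp[OF linear_tcone])

lemma tuple_bd_map: "tuple_bd (map f ps) = tuple_map f (tuple_bd ps)"
  by (induction ps)
    (simp_all add: tuple_map_cone linear_diff[OF linear_tuple_map] linear_0[OF linear_tuple_map])

lemma tuple_bd_tuple_map: "lin tuple_bd (tuple_map f c) = tuple_map f (lin tuple_bd c)"
  by (simp add: tuple_map_def lin_lin tuple_bd_map[unfolded tuple_map_def])

text \<open>Unfolded, the usual prism operator: the alternating sum over i of f applied to the
  entries up to the i-th, followed by g applied to the entries from the i-th on.\<close>

fun prism :: "('b \<Rightarrow> 'c) \<Rightarrow> ('b \<Rightarrow> 'c) \<Rightarrow> 'b list \<Rightarrow> ('c list \<Rightarrow>\<^sub>0 real)" where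
  "prism f g [] = 0"
| "prism f g (p # ps) = bas (f p # g p # map g ps) - tcone (f p) (prism f g ps)"

lemma prism_cone:
  "lin (prism f g) (tcone p c) =
     tcone (f p) (tcone (g p) (tuple_map g c)) - tcone (f p) (lin (prism f g) c)"
  unfolding tuple_map_def
  by (simp add: lin_tcone lin_diff_fun linear_lin_comp[OF linear_tcone])

lemma tuple_bd_prism:
  "lin tuple_bd (prism f g ps) + lin (prism f g) (tuple_bd ps) = bas (map g ps) - bas (map f ps)"
proof (induction ps)
  case (Cons p ps)
  have IH: "lin tuple_bd (prism f g ps) =
      bas (map g ps) - bas (map f ps) - lin (prism f g) (tuple_bd ps)"
    using Cons by (simp add: algebra_simps)
  show ?case
    by (simp add: tuple_bd_cone prism_cone IH tuple_bd_map)
qed simp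

lemma tuple_bd_prism_chain:
  "lin tuple_bd (lin (prism f g) c) + lin (prism f g) (lin tuple_bd c) = tuple_map g c - tuple_map f c"
  unfolding tuple_map_def
  by (simp add: lin_lin tuple_bd_prism flip: lin_add_fun lin_diff_fun)

subsection \<open>Alternating functions of tuples\<close>

text \<open>Adjacent transpositions generate all permutations, so this is the usual notion, in a
  form that suits recursion over lists.\<close>

definition alternating :: "('b list \<Rightarrow> 'c::real_vector) \<Rightarrow> bool" where
  "alternating f \<longleftrightarrow> (\<forall>us a b vs. f (us @ a # b # vs) = - f (us @ b # a # vs))"

lemma alternatingD: "alternating f \<Longrightarrow> f (us @ a # b # vs) = - f (us @ b # a # vs)"
  unfolding alternating_def by blast

lemma alternating_Cons: "alternating f \<Longrightarrow> alternating (\<lambda>xs. f (x # xs))"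
  unfolding alternating_def by (metis append_Cons)

text \<open>The head of \<open>xs\<close> occurs in \<open>ys\<close> and can be moved to the front
  by adjacent swaps, which only change the sign; the tails are compared by induction, for
  \<open>f\<close> with its first entry fixed.\<close>

lemma alternating_zero_mset:
  assumes "alternating f" "mset xs = mset ys" "f xs = 0"
  shows "f ys = 0"
  using assms
proof (induction xs arbitrary: ys f)
  case (Cons x xs)
  have "x \<in> set ys"
    using Cons.prems(2) by (metis list.set_intros(1) set_mset_mset)
  then obtain us vs where ys: "ys = us @ x # vs"
    by (meson split_list)
  have "mset xs = mset (us @ vs)"
    using Cons.prems(2) by (simp add: ys)
  then have 0: "f (x # us @ vs) = 0"
    using Cons.IH[OF alternating_Cons[OF Cons.prems(1)]] Cons.prems(3) by blast
  have *: "f (ws @ us @ x # vs) = 0" if "f (ws @ x # us @ vs) = 0" for ws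
    using that
  proof (induction us arbitrary: ws)
    case (Cons u us)
    have "f (ws @ u # x # us @ vs) = 0"
      using alternatingD[OF \<open>alternating f\<close>, of ws u x "us @ vs"] Cons.prems by simp
    then show ?case
      using Cons.IH[of "ws @ [u]"] by simp
  qed simp
  show ?case
    using *[of "[]"] 0 by (simp add: ys)
qed simp

text \<open>This is how signs are controlled throughout: two alternating functions are compared at
  one convenient order of the entries. It is the vanishing statement for their difference.\<close>

lemma alternating_eq_mset:
  assumes "alternating f" "alternating g" "mset xs = mset ys" "f xs = g xs"
  shows "f ys = g ys"
proof -
  have "alternating (\<lambda>xs. f xs - g xs)"
    unfolding alternating_def
  proof (intro allI)
    fix us a b vs
    show "f (us @ a # b # vs) - g (us @ a # b # vs) = - (f (us @ b # a # vs) - g (us @ b # a # vs))"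
      by (simp only: alternatingD[OF assms(1), of us a b vs] alternatingD[OF assms(2), of us a b vs]
          minus_diff_minus)
  qed
  from alternating_zero_mset[OF this assms(3)] show ?thesis
    using assms(4) by simp
qed

text \<open>Two equal entries, moved to the front, are exchanged without effect, so the value there
  is its own negative.\<close>

lemma alternating_not_distinct:
  assumes "alternating f" "\<not> distinct xs"
  shows "f xs = 0"
proof -
  obtain us a vs ws where xs: "xs = us @ [a] @ vs @ [a] @ ws"
    using not_distinct_decomp[OF assms(2)] by blast
  have "f (a # a # us @ vs @ ws) = - f (a # a # us @ vs @ ws)"
    using alternatingD[OF assms(1), of "[]" a a "us @ vs @ ws"] unfolding append_Nil .
  then have 0: "f (a # a # us @ vs @ ws) = 0"
    by (metis add.right_inverse scaleR_2 scaleR_eq_0_iff zero_neq_numeral)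
  show ?thesis
    by (rule alternating_zero_mset[OF assms(1) _ 0]) (simp add: xs)
qed

text \<open>Deleting one of the two swapped entries gives two faces of opposite sign, which the swap
  exchanges; all other faces contain both entries. The induction generalises \<open>f\<close>,
  because a leading vertex u turns it into \<open>\<lambda>xs. f (u # xs)\<close>.\<close>

lemma alternating_lin_tuple_bd:
  assumes "alternating f"
  shows "alternating (\<lambda>xs. lin f (tuple_bd xs))"
  unfolding alternating_def
proof (intro allI)
  fix us a b vs
  show "lin f (tuple_bd (us @ a # b # vs)) = - lin f (tuple_bd (us @ b # a # vs))"
    using assms
  proof (induction us arbitrary: f)
    case Nil
    have "(\<lambda>x. f (a # b # x)) = (\<lambda>x. - f (b # a # x))"
      using alternatingD[OF Nil, of "[]" a b] by simp
    then show ?case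
      by (simp add: lin_tcone lin_neg_fun)
  next
    case (Cons u us)
    show ?case
      using Cons.IH[OF alternating_Cons[OF Cons.prems], of u] alternatingD[OF Cons.prems, of us a b vs]
      by (simp add: lin_tcone)
  qed
qed

subsection \<open>Oriented simplices as alternating functions of the vertices\<close>

lemma nth_swap_adjacent:
  "(us @ b # a # vs) ! i = (us @ a # b # vs) !
     (if i = length us then Suc (length us) else if i = Suc (length us) then length us else i)"
proof -
  consider "i < length us" | "i = length us" | "i = Suc (length us)"
    | j where "i = length us + Suc (Suc j)"
  proof -
    assume *: "i < length us \<Longrightarrow> thesis" "i = length us \<Longrightarrow> thesis" "i = Suc (length us) \<Longrightarrow> thesis"
      "\<And>j. i = length us + Suc (Suc j) \<Longrightarrow> thesis"
    show thesis
      using *(4)[of "i - length us - 2"] *(1-3) by linarith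
  qed
  then show ?thesis
    by cases (simp_all add: nth_append)
qed

lemma permute_list_transpose_adjacent:
  "permute_list (Transposition.transpose (length us) (Suc (length us))) (us @ a # b # vs) = us @ b # a # vs"
proof (rule nth_equalityI)
  fix i
  let ?t = "Transposition.transpose (length us) (Suc (length us))"
  have t: "?t permutes {..<length (us @ a # b # vs)}"
    by (rule permutes_swap_id) auto
  assume "i < length (permute_list ?t (us @ a # b # vs))"
  then have i: "i < length (us @ a # b # vs)"
    by simp
  show "permute_list ?t (us @ a # b # vs) ! i = (us @ b # a # vs) ! i"
    unfolding permute_list_nth[OF t i] nth_swap_adjacent[of us b a vs i] Transposition.transpose_def ..
qed simp

lemma permute_list_inject:
  assumes "distinct xs" "p permutes {..<length xs}" "q permutes {..<length xs}"
    and "permute_list p xs = permute_list q xs"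
  shows "p = q"
proof
  fix i
  show "p i = q i"
  proof (cases "i < length xs")
    case True
    have "xs ! p i = xs ! q i"
      using True assms by (metis permute_list_nth)
    moreover have "p i < length xs" "q i < length xs"
      using True assms(2,3) permutes_in_image[of _ "{..<length xs}" i] by auto
    ultimately show ?thesis
      using assms(1) nth_eq_iff_index_eq by blast
  next
    case False
    then show ?thesis
      using assms(2,3) by (auto simp: permutes_def)
  qed
qed

text \<open>For a distinct list the rearranging permutation is unique, so its parity is well
  defined; swapping neighbours composes it with one transposition.\<close>

lemma even_rearrangement_swap:
  assumes "distinct xs" "mset xs = mset (us @ a # b # vs)"
  shows "even_rearrangement xs (us @ b # a # vs) \<longleftrightarrow> \<not> even_rearrangement xs (us @ a # b # vs)"
proof -
  let ?ys = "us @ a # b # vs" and ?zs = "us @ b # a # vs"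
  let ?i = "length us" and ?t = "Transposition.transpose (length us) (Suc (length us))"
  have len: "length xs = length ?ys"
    using assms(2) mset_eq_length by blast
  obtain p where p: "p permutes {..<length xs}" "permute_list p xs = ?ys"
    using mset_eq_permutation[of ?ys xs] assms(2) by metis
  have t: "?t permutes {..<length xs}"
    by (rule permutes_swap_id) (auto simp: len)
  have pt: "(p \<circ> ?t) permutes {..<length xs}"
    by (rule permutes_compose[OF t p(1)])
  have zs: "permute_list (p \<circ> ?t) xs = ?zs"
    using permute_list_compose[OF t, of p] p(2)
    by (simp add: permute_list_transpose_adjacent)
  have perm: "permutation p" "permutation ?t"
    using p(1) t permutation_permutes by blast+
  have "even_rearrangement xs ?ys \<longleftrightarrow> evenperm p"
    unfolding even_rearrangement_def using p permute_list_inject[OF assms(1) p(1)] by metis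
  moreover have "even_rearrangement xs ?zs \<longleftrightarrow> evenperm (p \<circ> ?t)"
    unfolding even_rearrangement_def using pt zs permute_list_inject[OF assms(1) pt] by metis
  moreover have "evenperm (p \<circ> ?t) \<longleftrightarrow> \<not> evenperm p"
    using evenperm_comp[OF perm] by (simp add: evenperm_swap)
  ultimately show ?thesis
    by simp
qed

lemma even_rearrangement_refl: "even_rearrangement xs xs"
  unfolding even_rearrangement_def
  by (intro exI[of _ id]) (auto simp: permutes_id evenperm_id)

text \<open>Zero on tuples that are not an ordering of the vertices of an oriented simplex, so that
  alternation holds without side conditions.\<close>

definition osx :: "('a::euclidean_space set \<Rightarrow> 'a list) \<Rightarrow> 'a list \<Rightarrow> 'a chain" where
  "osx ori vs =
     (if distinct vs \<and> mset (ori (convex hull (set vs))) = mset vs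
      then oriented_simplex ori vs else 0)"

lemma alternating_osx: "alternating (osx ori)"
  unfolding alternating_def
proof (intro allI)
  fix us vs :: "'a list" and a b
  let ?S = "convex hull (set (us @ a # b # vs))"
  have S: "convex hull (set (us @ b # a # vs)) = ?S"
    by (simp add: insert_commute)
  show "osx ori (us @ a # b # vs) = - osx ori (us @ b # a # vs)"
  proof (cases "distinct (us @ a # b # vs) \<and> mset (ori ?S) = mset (us @ a # b # vs)")
    case True
    then have "distinct (ori ?S)"
      by (metis mset_eq_imp_distinct_iff)
    from even_rearrangement_swap[OF this, of us a b vs] True S show ?thesis
      by (auto simp: osx_def oriented_simplex_def Let_def insert_commute)
  next
    case False
    then show ?thesis
      by (auto simp: osx_def insert_commute)
  qed
qed

text \<open>Unlike \<^const>\<open>chain_bd\<close>, augmented: the boundary of a vertex is the empty simplex.\<close>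

definition obd :: "('a::euclidean_space set \<Rightarrow> 'a list) \<Rightarrow> 'a chain \<Rightarrow> 'a chain" where
  "obd ori = lin (\<lambda>S. lin (osx ori) (tuple_bd (ori S)))"

lemma linear_obd: "linear (obd ori)"
  unfolding obd_def by (rule linear_lin)

lemmas obd_simps [simp] =
  linear_add[OF linear_obd] linear_diff[OF linear_obd] linear_neg[OF linear_obd]
  linear_scale[OF linear_obd] linear_0[OF linear_obd]

lemma obd_bas: "obd ori (bas S) = lin (osx ori) (tuple_bd (ori S))"
  by (simp add: obd_def)

text \<open>\<open>U\<close> will be \<open>N \<union> M\<close>. This need not be a complex, since
  simplices of the two may overlap; what remains is closure under faces, and that is all the
  boundary needs.\<close>

locale oriented =
  fixes U :: "'a::euclidean_space set set" and ori :: "'a set \<Rightarrow> 'a list"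
  assumes ori_independent: "S \<in> U \<Longrightarrow> \<not> affine_dependent (set (ori S))"
    and hull_ori: "S \<in> U \<Longrightarrow> convex hull (set (ori S)) = S"
    and distinct_ori: "S \<in> U \<Longrightarrow> distinct (ori S)"
    and hull_in: "S \<in> U \<Longrightarrow> A \<subseteq> set (ori S) \<Longrightarrow> convex hull A \<in> U"
begin

lemma independent_subset: "S \<in> U \<Longrightarrow> A \<subseteq> set (ori S) \<Longrightarrow> \<not> affine_dependent A"
  using affine_independent_subset ori_independent by blast

lemma set_ori_hull:
  assumes "S \<in> U" "A \<subseteq> set (ori S)"
  shows "set (ori (convex hull A)) = A"
proof -
  have "x \<in> A \<longleftrightarrow> x \<in> set (ori (convex hull A))" for x
    using extreme_point_of_convex_hull_affine_independent[OF independent_subset[OF assms], of x]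
      extreme_point_of_convex_hull_affine_independent[OF ori_independent[OF hull_in[OF assms]], of x]
      hull_ori[OF hull_in[OF assms]] by simp
  then show ?thesis
    by blast
qed

lemma osx_ori: "S \<in> U \<Longrightarrow> osx ori (ori S) = bas S"
  by (simp add: osx_def hull_ori distinct_ori oriented_simplex_def even_rearrangement_refl)

lemma mset_ori_hull:
  assumes "S \<in> U" "set vs \<subseteq> set (ori S)" "distinct vs"
  shows "mset (ori (convex hull (set vs))) = mset vs"
  using set_ori_hull[OF assms(1,2)] distinct_ori[OF hull_in[OF assms(1,2)]] assms(3)
  by (simp add: set_eq_iff_mset_eq_distinct[symmetric])

lemma osx_sign:
  assumes "S \<in> U" "set vs \<subseteq> set (ori S)" "distinct vs"
  obtains s where "s = 1 \<or> s = (-1::real)" "osx ori vs = s *\<^sub>R bas (convex hull (set vs))"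
proof (cases "even_rearrangement (ori (convex hull (set vs))) vs")
  case True
  then show ?thesis
    using that[of 1] by (simp add: osx_def mset_ori_hull[OF assms] assms(3) oriented_simplex_def)
next
  case False
  then show ?thesis
    using that[of "-1"] by (simp add: osx_def mset_ori_hull[OF assms] assms(3) oriented_simplex_def)
qed

lemma osx_supp: "osx ori vs \<in> supp {S. S = convex hull (set vs) \<and> length (ori S) = length vs \<and> set (ori S) = set vs}"
proof (cases "mset (ori (convex hull (set vs))) = mset vs")
  case True
  then have "set (ori (convex hull (set vs))) = set vs"
    "length (ori (convex hull (set vs))) = length vs"
    by (metis mset_eq_setD, metis mset_eq_length)
  then show ?thesis
    by (auto simp: osx_def oriented_simplex_def Let_def intro!: supp_intros)
qed (auto simp: osx_def intro!: supp_intros)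

text \<open>Both sides alternate in \<open>vs\<close>, so they are compared at the chosen order of
  the vertex set, where \<open>osx\<close> is a basis element. On lists with a repetition both
  vanish.\<close>

lemma obd_osx:
  assumes "S \<in> U" "set vs \<subseteq> set (ori S)"
  shows "obd ori (osx ori vs) = lin (osx ori) (tuple_bd vs)"
proof -
  let ?g = "\<lambda>vs. lin (osx ori) (tuple_bd vs)"
  have g: "alternating ?g"
    by (rule alternating_lin_tuple_bd[OF alternating_osx])
  show ?thesis
  proof (cases "distinct vs")
    case True
    have f: "alternating (\<lambda>vs. obd ori (osx ori vs))"
      using alternating_osx[of ori] unfolding alternating_def
      by (metis linear_neg linear_obd)
    let ?T = "convex hull (set vs)"
    have "obd ori (osx ori (ori ?T)) = ?g (ori ?T)"
      by (simp add: osx_ori[OF hull_in[OF assms]] obd_bas)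
    from alternating_eq_mset[OF f g mset_ori_hull[OF assms True] this] show ?thesis .
  next
    case False
    then show ?thesis
      by (simp add: alternating_not_distinct[OF g] alternating_not_distinct[OF alternating_osx])
  qed
qed

lemma obd_lin_osx:
  assumes "c \<in> supp {vs. \<exists>S\<in>U. set vs \<subseteq> set (ori S)}"
  shows "obd ori (lin (osx ori) c) = lin (osx ori) (lin tuple_bd c)"
  by (simp add: linear_lin_comp[OF linear_obd] lin_lin)
    (rule lin_cong_supp[OF assms], auto intro: obd_osx)

lemma tuple_bd_supp_ori:
  assumes "S \<in> U"
  shows "tuple_bd (ori S) \<in> supp {vs. Suc (length vs) = length (ori S) \<and> set vs \<subseteq> set (ori S)}"
  using tuple_bd_supp[of "ori S"]
  by (rule subsetD[OF supp_mono, rotated]) (auto dest: in_set_takeD in_set_dropD)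

text \<open>Indexed by the number of vertices, which is one more than the dimension.\<close>

definition cells :: "'a set set \<Rightarrow> nat \<Rightarrow> 'a set set" where
  "cells K n = {S \<in> K. length (ori S) = n}"

definition face_closed :: "'a set set \<Rightarrow> bool" where
  "face_closed K \<longleftrightarrow> K \<subseteq> U \<and> (\<forall>S\<in>K. \<forall>A\<subseteq>set (ori S). convex hull A \<in> K)"

lemma face_closed_U: "face_closed U"
  by (auto simp: face_closed_def hull_in)

lemma osx_cells:
  assumes "face_closed K" "S \<in> K" "set vs \<subseteq> set (ori S)"
  shows "osx ori vs \<in> supp (cells K (length vs))"
proof -
  have "convex hull (set vs) \<in> K"
    using assms by (auto simp: face_closed_def)
  then show ?thesis
    using osx_supp[of vs] by (auto simp: supp_def cells_def)
qed

lemma obd_cells: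
  assumes K: "face_closed K" and c: "c \<in> supp (cells K (Suc n))"
  shows "obd ori c \<in> supp (cells K n)"
  unfolding obd_def
proof (rule lin_in_supp[OF c _ subspace_supp])
  fix S assume S: "S \<in> cells K (Suc n)"
  then have "S \<in> U"
    using K by (auto simp: face_closed_def cells_def)
  show "lin (osx ori) (tuple_bd (ori S)) \<in> supp (cells K n)"
    by (rule lin_in_supp[OF tuple_bd_supp_ori[OF \<open>S \<in> U\<close>] _ subspace_supp])
      (use S osx_cells[OF K] in \<open>auto simp: cells_def\<close>)
qed

lemma obd_cells_0:
  assumes "K \<subseteq> U" "c \<in> supp (cells K 0)"
  shows "obd ori c = 0"
proof -
  have "obd ori c = lin (\<lambda>S. 0) c"
    unfolding obd_def by (rule lin_cong_supp[OF assms(2)]) (simp add: cells_def)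
  then show ?thesis
    by (simp add: lin_def)
qed

lemma obd_obd:
  assumes "c \<in> supp U"
  shows "obd ori (obd ori c) = 0"
proof -
  have "obd ori (obd ori c) = lin (\<lambda>S. obd ori (lin (osx ori) (tuple_bd (ori S)))) c"
    by (subst (2) obd_def) (simp add: linear_lin_comp[OF linear_obd])
  also have "\<dots> = lin (\<lambda>S. 0) c"
  proof (rule lin_cong_supp[OF assms])
    fix S assume "S \<in> U"
    then have "tuple_bd (ori S) \<in> supp {vs. \<exists>S\<in>U. set vs \<subseteq> set (ori S)}"
      using tuple_bd_supp_ori[of S] by (auto simp: supp_def)
    from obd_lin_osx[OF this] show "obd ori (lin (osx ori) (tuple_bd (ori S))) = 0"
      by (simp add: tuple_bd_bd)
  qed
  finally show ?thesis
    by (simp add: lin_def)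
qed

lemma aff_dim_ori:
  assumes "S \<in> U"
  shows "aff_dim S = int (length (ori S)) - 1"
proof -
  have "aff_dim S = aff_dim (set (ori S))"
    using aff_dim_convex_hull[of "set (ori S)"] hull_ori[OF assms] by simp
  then show ?thesis
    using aff_dim_affine_independent[OF ori_independent[OF assms]]
      distinct_card[OF distinct_ori[OF assms]] by simp
qed

lemma simplex_iff_length: "S \<in> U \<Longrightarrow> int k simplex S \<longleftrightarrow> length (ori S) = Suc k"
proof
  assume "S \<in> U" "int k simplex S"
  then show "length (ori S) = Suc k"
    using aff_dim_simplex[of "int k" S] aff_dim_ori[of S] by linarith
next
  assume "S \<in> U" "length (ori S) = Suc k"
  then show "int k simplex S"
    unfolding simplex_def
    by (intro exI[of _ "set (ori S)"]) (simp add: ori_independent hull_ori distinct_card distinct_ori)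
qed

lemma simplices_of_eq_cells: "K \<subseteq> U \<Longrightarrow> simplices_of K k = cells K (Suc k)"
  by (auto simp: simplices_of_def cells_def simplex_iff_length dest: subsetD)

lemma chains_eq_supp: "K \<subseteq> U \<Longrightarrow> chains K k = supp (cells K (Suc k))"
  by (auto simp: chains_def supp_def simplices_of_eq_cells)

text \<open>In dimension 0 the two boundaries differ by the augmentation. From dimension 1 on they
  agree, which is enough: only boundaries of \<open>V (Suc k)\<close> enter the statement.\<close>

lemma chain_bd_eq_obd:
  assumes "c \<in> supp (cells U (Suc (Suc k)))"
  shows "chain_bd ori c = obd ori c"
  unfolding chain_bd_def obd_def linear_extension_eq_lin
proof (rule lin_cong_supp[OF assms])
  fix S assume S: "S \<in> cells U (Suc (Suc k))"
  then have "S \<in> U" "\<not> length (ori S) \<le> 1"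
    by (auto simp: cells_def)
  have "osx ori (take i (ori S) @ drop (Suc i) (ori S)) =
      oriented_simplex ori (take i (ori S) @ drop (Suc i) (ori S))" for i
  proof -
    have "distinct (take i (ori S) @ drop (Suc i) (ori S))"
      using distinct_ori[OF \<open>S \<in> U\<close>] by (auto simp: set_take_disj_set_drop_if_distinct)
    then show ?thesis
      using mset_ori_hull[OF \<open>S \<in> U\<close> set_delete_nth] unfolding osx_def by presburger
  qed
  then show "(let vs = ori S in if length vs \<le> 1 then 0
      else \<Sum>i<length vs. (-1) ^ i *\<^sub>R oriented_simplex ori (take i vs @ drop (Suc i) vs)) =
      lin (osx ori) (tuple_bd (ori S))"
    using \<open>\<not> length (ori S) \<le> 1\<close> by (simp add: tuple_bd_sum lin_sum Let_def)
qed

end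

subsection \<open>Barycentric coordinates\<close>

text \<open>Meaningful for p in the affine hull of V only, and determined there as soon as V is
  affinely independent (\<open>bary_unique\<close>).\<close>

definition bary :: "'a::euclidean_space set \<Rightarrow> 'a \<Rightarrow> 'a \<Rightarrow> real" where
  "bary V p = (SOME u. sum u V = 1 \<and> (\<Sum>v\<in>V. u v *\<^sub>R v) = p)"

lemma bary_props:
  assumes "finite V" "p \<in> affine hull V"
  shows sum_bary: "sum (bary V p) V = 1"
    and bary_combination: "(\<Sum>v\<in>V. bary V p v *\<^sub>R v) = p"
proof -
  have "\<exists>u. sum u V = 1 \<and> (\<Sum>v\<in>V. u v *\<^sub>R v) = p"
    using assms by (simp add: affine_hull_finite)
  from someI_ex[OF this] show "sum (bary V p) V = 1" "(\<Sum>v\<in>V. bary V p v *\<^sub>R v) = p"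
    by (auto simp: bary_def)
qed

lemma bary_unique:
  assumes V: "\<not> affine_dependent V" and u: "sum u V = 1" "(\<Sum>v\<in>V. u v *\<^sub>R v) = p" and "v \<in> V"
  shows "bary V p v = u v"
proof (rule ccontr)
  have fin: "finite V"
    using V aff_independent_finite by blast
  have p: "p \<in> affine hull V"
    using u fin by (auto simp: affine_hull_finite)
  assume "bary V p v \<noteq> u v"
  moreover have "sum (\<lambda>v. bary V p v - u v) V = 0"
    by (simp add: sum_subtractf sum_bary[OF fin p] u)
  moreover have "(\<Sum>v\<in>V. (bary V p v - u v) *\<^sub>R v) = 0"
    by (simp add: sum_subtractf scaleR_left_diff_distrib bary_combination[OF fin p] u)
  ultimately have "affine_dependent V"
    using \<open>v \<in> V\<close> fin by (auto simp: affine_dependent_explicit_finite intro!: exI[of _ "\<lambda>v. bary V p v - u v"])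
  then show False
    using V by simp
qed

lemma bary_affine_combination:
  assumes V: "\<not> affine_dependent V" and t: "sum t I = 1" "finite I"
    and q: "\<And>i. i \<in> I \<Longrightarrow> q i \<in> affine hull V" and "v \<in> V"
  shows "bary V (\<Sum>i\<in>I. t i *\<^sub>R q i) v = (\<Sum>i\<in>I. t i * bary V (q i) v)"
proof (rule bary_unique[OF V _ _ \<open>v \<in> V\<close>])
  have fin: "finite V"
    using V aff_independent_finite by blast
  have "(\<Sum>v\<in>V. \<Sum>i\<in>I. t i * bary V (q i) v) = (\<Sum>i\<in>I. t i * (\<Sum>v\<in>V. bary V (q i) v))"
    by (subst sum.swap) (simp add: sum_distrib_left)
  also have "\<dots> = 1"
    using t by (simp add: sum_bary[OF fin q])
  finally show "(\<Sum>v\<in>V. \<Sum>i\<in>I. t i * bary V (q i) v) = 1" .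
  have "(\<Sum>v\<in>V. (\<Sum>i\<in>I. t i * bary V (q i) v) *\<^sub>R v) =
      (\<Sum>i\<in>I. t i *\<^sub>R (\<Sum>v\<in>V. bary V (q i) v *\<^sub>R v))"
    by (simp add: scaleR_sum_left scaleR_sum_right) (rule sum.swap)
  also have "\<dots> = (\<Sum>i\<in>I. t i *\<^sub>R q i)"
    by (simp add: bary_combination[OF fin q])
  finally show "(\<Sum>v\<in>V. (\<Sum>i\<in>I. t i * bary V (q i) v) *\<^sub>R v) = (\<Sum>i\<in>I. t i *\<^sub>R q i)" .
qed

lemma bary_segment:
  assumes V: "\<not> affine_dependent V" and "p \<in> affine hull V" "q \<in> affine hull V" "v \<in> V"
  shows "bary V (p + e *\<^sub>R (q - p)) v = (1 - e) * bary V p v + e * bary V q v"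
proof -
  have "p + e *\<^sub>R (q - p) = (\<Sum>i\<in>UNIV. (if i then e else 1 - e) *\<^sub>R (if i then q else p))"
    by (simp add: UNIV_bool algebra_simps)
  also have "bary V \<dots> v = (\<Sum>i\<in>UNIV. (if i then e else 1 - e) * bary V (if i then q else p) v)"
    by (rule bary_affine_combination[OF V]) (auto simp: UNIV_bool assms)
  finally show ?thesis
    by (simp add: UNIV_bool)
qed

lemma bary_subset:
  assumes V: "\<not> affine_dependent V" and "W \<subseteq> V" "p \<in> affine hull W" "v \<in> V"
  shows "bary V p v = (if v \<in> W then bary W p v else 0)"
proof (rule bary_unique[OF V _ _ \<open>v \<in> V\<close>])
  have fin: "finite V"
    using V aff_independent_finite by blast
  then have finW: "finite W"
    using assms(2) finite_subset by blast
  show "(\<Sum>v\<in>V. if v \<in> W then bary W p v else 0) = 1"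
    using sum_bary[OF finW assms(3)] assms(2) fin
    by (simp add: sum.If_cases inf.absorb2)
  have "(\<Sum>v\<in>V. (if v \<in> W then bary W p v else 0) *\<^sub>R v) = (\<Sum>v\<in>W. bary W p v *\<^sub>R v)"
    by (rule sum.mono_neutral_cong_right) (use fin assms(2) in auto)
  then show "(\<Sum>v\<in>V. (if v \<in> W then bary W p v else 0) *\<^sub>R v) = p"
    using bary_combination[OF finW assms(3)] by simp
qed

lemma bary_vertex:
  assumes V: "\<not> affine_dependent V" and "v \<in> V" "w \<in> V"
  shows "bary V w v = (if v = w then 1 else 0)"
proof (rule bary_unique[OF V _ _ \<open>v \<in> V\<close>])
  have fin: "finite V"
    using V aff_independent_finite by blast
  show "(\<Sum>v\<in>V. if v = w then 1 else 0) = (1::real)" "(\<Sum>v\<in>V. (if v = w then 1 else 0) *\<^sub>R v) = w"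
    using fin assms(3) by (simp_all add: if_distrib[of "\<lambda>x. x *\<^sub>R _"] cong: if_cong)
qed

lemma convex_hull_iff_bary:
  assumes V: "\<not> affine_dependent V"
  shows "p \<in> convex hull V \<longleftrightarrow> p \<in> affine hull V \<and> (\<forall>v\<in>V. bary V p v \<ge> 0)"
proof
  have fin: "finite V"
    using V aff_independent_finite by blast
  {
    assume "p \<in> convex hull V"
    then obtain u where "\<forall>v\<in>V. 0 \<le> u v" "sum u V = 1" "(\<Sum>v\<in>V. u v *\<^sub>R v) = p"
      using fin by (auto simp: convex_hull_finite)
    moreover have "p \<in> affine hull V"
      using \<open>p \<in> convex hull V\<close> convex_hull_subset_affine_hull by blast
    ultimately show "p \<in> affine hull V \<and> (\<forall>v\<in>V. bary V p v \<ge> 0)"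
      using bary_unique[OF V] by metis
  next
    assume "p \<in> affine hull V \<and> (\<forall>v\<in>V. bary V p v \<ge> 0)"
    then show "p \<in> convex hull V"
      using bary_props[OF fin] by (auto simp: convex_hull_finite[OF fin])
  }
qed

lemma rel_interior_iff_bary:
  assumes V: "\<not> affine_dependent V"
  shows "p \<in> rel_interior (convex hull V) \<longleftrightarrow> p \<in> affine hull V \<and> (\<forall>v\<in>V. bary V p v > 0)"
proof
  have fin: "finite V"
    using V aff_independent_finite by blast
  {
    assume p: "p \<in> rel_interior (convex hull V)"
    then obtain u where "\<forall>v\<in>V. 0 < u v" "sum u V = 1" "(\<Sum>v\<in>V. u v *\<^sub>R v) = p"
      by (auto simp: rel_interior_convex_hull_explicit[OF V])
    moreover have "p \<in> affine hull V"
      using p rel_interior_subset convex_hull_subset_affine_hull by blast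
    ultimately show "p \<in> affine hull V \<and> (\<forall>v\<in>V. bary V p v > 0)"
      using bary_unique[OF V] by metis
  next
    assume "p \<in> affine hull V \<and> (\<forall>v\<in>V. bary V p v > 0)"
    then show "p \<in> rel_interior (convex hull V)"
      using bary_props[OF fin] by (auto simp: rel_interior_convex_hull_explicit[OF V])
  }
qed

lemma convex_hull_face_iff_bary:
  assumes V: "\<not> affine_dependent V" and "W \<subseteq> V"
  shows "p \<in> convex hull W \<longleftrightarrow> p \<in> convex hull V \<and> (\<forall>v\<in>V - W. bary V p v = 0)"
proof
  have fin: "finite V"
    using V aff_independent_finite by blast
  {
    assume p: "p \<in> convex hull W"
    then have "p \<in> affine hull W"
      using convex_hull_subset_affine_hull by blast
    then show "p \<in> convex hull V \<and> (\<forall>v\<in>V - W. bary V p v = 0)"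
      using p bary_subset[OF V assms(2)] hull_mono[OF assms(2)] by auto
  next
    assume p: "p \<in> convex hull V \<and> (\<forall>v\<in>V - W. bary V p v = 0)"
    then have aff: "p \<in> affine hull V" and pos: "\<forall>v\<in>V. bary V p v \<ge> 0"
      using convex_hull_iff_bary[OF V] by auto
    have "sum (bary V p) W = sum (bary V p) V"
      "(\<Sum>v\<in>W. bary V p v *\<^sub>R v) = (\<Sum>v\<in>V. bary V p v *\<^sub>R v)"
      by (rule sum.mono_neutral_left; use p fin assms(2) in auto)+
    then show "p \<in> convex hull W"
      using bary_props[OF fin aff] finite_subset[OF assms(2) fin] pos assms(2)
      by (auto simp: convex_hull_finite)
  }
qed

subsection \<open>Signed volumes relative to a simplex\<close>

text \<open>Row i holds the barycentric coordinates of \<open>ys ! i\<close>. The determinant is the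
  ratio of the signed volumes of the simplices \<open>ys\<close> and \<open>xs\<close>.\<close>

definition bary_mat :: "'a::euclidean_space list \<Rightarrow> 'a list \<Rightarrow> real mat" where
  "bary_mat xs ys =
     Matrix.mat (length xs) (length xs) (\<lambda>(i, j). bary (set xs) (ys ! i) (xs ! j))"

text \<open>The value \<open>0\<close> for lists of different lengths makes alternation hold without side conditions.\<close>

definition vol :: "'a::euclidean_space list \<Rightarrow> 'a list \<Rightarrow> real" where
  "vol xs ys = (if length ys = length xs then Determinant.det (bary_mat xs ys) else 0)"

lemma bary_mat_carrier [simp]: "bary_mat xs ys \<in> carrier_mat (length xs) (length xs)"
  by (simp add: bary_mat_def)

lemma alternating_vol_right: "alternating (vol xs)"
  unfolding alternating_def
proof (intro allI)
  fix us vs :: "'a list" and a b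
  let ?i = "length us"
  show "vol xs (us @ a # b # vs) = - vol xs (us @ b # a # vs)"
  proof (cases "length xs = length (us @ a # b # vs)")
    case True
    have "bary_mat xs (us @ b # a # vs) = swaprows ?i (Suc ?i) (bary_mat xs (us @ a # b # vs))"
      using True by (intro eq_matI) (auto simp: bary_mat_def nth_swap_adjacent[of us b a vs])
    moreover have "Determinant.det (swaprows ?i (Suc ?i) (bary_mat xs (us @ a # b # vs))) =
        - Determinant.det (bary_mat xs (us @ a # b # vs))"
      by (rule det_swaprows[of _ "length xs"]) (use True in \<open>auto simp: bary_mat_def\<close>)
    ultimately show ?thesis
      using True by (simp add: vol_def)
  qed (simp add: vol_def)
qed

lemma alternating_vol_left: "alternating (\<lambda>xs. vol xs ys)"
  unfolding alternating_def
proof (intro allI)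
  fix us vs :: "'a list" and a b
  let ?i = "length us"
  let ?xs = "us @ a # b # vs" and ?xs' = "us @ b # a # vs"
  have set: "set ?xs' = set ?xs"
    by auto
  show "vol ?xs ys = - vol ?xs' ys"
  proof (cases "length ys = length ?xs")
    case True
    have "bary_mat ?xs' ys = swapcols ?i (Suc ?i) (bary_mat ?xs ys)"
      by (intro eq_matI) (auto simp: bary_mat_def nth_swap_adjacent[of us b a vs] insert_commute)
    moreover have "Determinant.det (swapcols ?i (Suc ?i) (bary_mat ?xs ys)) =
        - Determinant.det (bary_mat ?xs ys)"
      by (rule det_swapcols[of _ "length ?xs"]) (auto simp: bary_mat_def)
    ultimately show ?thesis
      using True by (simp add: vol_def)
  qed (simp add: vol_def)
qed

lemma vol_refl:
  assumes "distinct xs" "\<not> affine_dependent (set xs)"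
  shows "vol xs xs = 1"
proof -
  have "bary_mat xs xs = 1\<^sub>m (length xs)"
    using assms by (intro eq_matI) (auto simp: bary_mat_def bary_vertex nth_eq_iff_index_eq)
  then show ?thesis
    by (simp add: vol_def)
qed

lemma vol_Cons_affine:
  assumes V: "\<not> affine_dependent (set xs)" and t: "sum t I = 1" "finite I"
    and q: "\<And>i. i \<in> I \<Longrightarrow> q i \<in> affine hull (set xs)"
  shows "vol xs ((\<Sum>i\<in>I. t i *\<^sub>R q i) # ys) = (\<Sum>i\<in>I. t i * vol xs (q i # ys))"
proof (cases "length xs = Suc (length ys)")
  case True
  let ?n = "length xs"
  have del: "mat_delete (bary_mat xs (a # ys)) 0 j = mat_delete (bary_mat xs (b # ys)) 0 j" for a b j
    by (intro eq_matI) (auto simp: mat_delete_def bary_mat_def)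
  \<comment> \<open>Cofactors of row 0 do not depend on row 0, so the point 0 is a mere placeholder
    there.\<close>
  define C where "C j = cofactor (bary_mat xs (0 # ys)) 0 j" for j
  have C: "vol xs (a # ys) = (\<Sum>j<?n. bary (set xs) a (xs ! j) * C j)" for a
    using laplace_expansion_row[of "bary_mat xs (a # ys)" ?n 0] True del[of a _ 0]
    by (simp add: vol_def C_def cofactor_def bary_mat_def)
  have "vol xs ((\<Sum>i\<in>I. t i *\<^sub>R q i) # ys) =
      (\<Sum>j<?n. (\<Sum>i\<in>I. t i * bary (set xs) (q i) (xs ! j)) * C j)"
    unfolding C by (intro sum.cong refl) (simp add: bary_affine_combination[OF V t q])
  also have "\<dots> = (\<Sum>i\<in>I. t i * vol xs (q i # ys))"
    unfolding C by (simp add: sum_distrib_right sum_distrib_left mult.assoc) (rule sum.swap)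
  finally show ?thesis .
qed (simp add: vol_def)

text \<open>Laplace expansion along the column of the vertex opposite to a face containing \<open>ys\<close>.\<close>

lemma vol_Cons_facet:
  assumes V: "\<not> affine_dependent (set xs)" "distinct xs" and j: "j < length xs"
    and ys: "set ys \<subseteq> affine hull (set (take j xs @ drop (Suc j) xs))"
  shows "vol xs (a # ys) =
    (-1) ^ j * bary (set xs) a (xs ! j) * vol (take j xs @ drop (Suc j) xs) ys"
proof (cases "length xs = Suc (length ys)")
  case True
  let ?n = "length xs" and ?xs = "take j xs @ drop (Suc j) xs"
  let ?B = "bary_mat xs (a # ys)"
  have sub: "set ?xs \<subseteq> set xs"
    by (rule set_delete_nth)
  have "distinct (take j xs @ xs ! j # drop (Suc j) xs)"
    unfolding id_take_nth_drop[OF j, symmetric] by (rule V(2))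
  then have notin: "xs ! j \<notin> set ?xs"
    by simp
  have nth: "?xs ! k = xs ! (if k < j then k else Suc k)" if "k < length ys" for k
    using that j True by (simp add: nth_append min_def)
  have zero: "bary (set xs) (ys ! i) (xs ! j) = 0" if "i < length ys" for i
  proof -
    have "ys ! i \<in> affine hull set ?xs"
      using ys that by auto
    from bary_subset[OF V(1) sub this nth_mem[OF j]] notin show ?thesis
      by simp
  qed
  have del: "mat_delete ?B 0 j = bary_mat ?xs ys"
  proof (rule eq_matI)
    fix i k assume "i < dim_row (bary_mat ?xs ys)" "k < dim_col (bary_mat ?xs ys)"
    then have i: "i < length ys" and k: "k < length ys"
      using True j by (auto simp: bary_mat_def)
    have xk: "?xs ! k \<in> set ?xs"
      by (rule nth_mem) (use k True j in simp)
    have yi: "ys ! i \<in> affine hull set ?xs"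
      using ys i by auto
    have "bary (set xs) (ys ! i) (?xs ! k) = bary (set ?xs) (ys ! i) (?xs ! k)"
      using bary_subset[OF V(1) sub yi subsetD[OF sub xk]] xk by presburger
    then show "mat_delete ?B 0 j $$ (i, k) = bary_mat ?xs ys $$ (i, k)"
      using i k True j nth[OF k] by (simp add: mat_delete_def bary_mat_def)
  qed (use True j in \<open>auto simp: mat_delete_def bary_mat_def\<close>)
  have "Determinant.det ?B = (\<Sum>i<?n. ?B $$ (i, j) * cofactor ?B i j)"
    by (rule laplace_expansion_column) (use j in auto)
  also have "\<dots> = ?B $$ (0, j) * cofactor ?B 0 j"
    unfolding True sum.lessThan_Suc_shift
    using zero j True by (simp add: bary_mat_def)
  also have "\<dots> = (-1) ^ j * bary (set xs) a (xs ! j) * Determinant.det (bary_mat ?xs ys)"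
    using j True by (simp add: cofactor_def del) (simp add: bary_mat_def)
  finally show ?thesis
    using True j by (simp add: vol_def)
qed (use j in \<open>simp add: vol_def\<close>)

text \<open>If the determinant vanished, a linear relation w between the rows would be an affine
  dependence of the points \<open>ys\<close>: coordinates sum to 1, so the weights w sum to
  0.\<close>

lemma vol_nonzero:
  assumes V: "\<not> affine_dependent (set xs)" "distinct xs"
    and ys: "\<not> affine_dependent (set ys)" "distinct ys" "set ys \<subseteq> affine hull (set xs)"
    and len: "length ys = length xs"
  shows "vol xs ys \<noteq> 0"
proof
  let ?n = "length xs"
  assume "vol xs ys = 0"
  then have "Determinant.det (transpose_mat (bary_mat xs ys)) = 0"
    using det_transpose[OF bary_mat_carrier, of xs ys] len by (simp add: vol_def)
  then have ex: "\<exists>w. w \<in> carrier_vec ?n \<and> w \<noteq> 0\<^sub>v ?n \<and>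
      transpose_mat (bary_mat xs ys) *\<^sub>v w = 0\<^sub>v ?n"
    by (rule iffD1[OF det_0_iff_vec_prod_zero[OF iffD2[OF transpose_carrier_mat bary_mat_carrier]]])
  obtain w where w: "w \<in> carrier_vec ?n" "w \<noteq> 0\<^sub>v ?n"
      "transpose_mat (bary_mat xs ys) *\<^sub>v w = 0\<^sub>v ?n"
    using ex by (elim exE conjE)
  have col: "(\<Sum>i<?n. vec_index w i * bary (set xs) (ys ! i) x) = 0" if x: "x \<in> set xs" for x
  proof -
    obtain j where j: "j < ?n" "x = xs ! j"
      using x unfolding in_set_conv_nth by blast
    have "vec_index (transpose_mat (bary_mat xs ys) *\<^sub>v w) j = 0"
      unfolding w(3) using j(1) by simp
    then show ?thesis
      using w(1) j by (simp add: scalar_prod_def bary_mat_def mult.commute lessThan_atLeast0)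
  qed
  have nth: "ys ! i \<in> affine hull (set xs)" if "i < ?n" for i
    using ys(3) that len by auto
  have "(\<Sum>i<?n. vec_index w i) = (\<Sum>i<?n. vec_index w i * (\<Sum>x\<in>set xs. bary (set xs) (ys ! i) x))"
    by (intro sum.cong refl) (use nth in \<open>simp add: sum_bary\<close>)
  also have "\<dots> = (\<Sum>x\<in>set xs. \<Sum>i<?n. vec_index w i * bary (set xs) (ys ! i) x)"
    by (simp add: sum_distrib_left) (rule sum.swap)
  also have "\<dots> = 0"
    by (simp add: col)
  finally have s0: "(\<Sum>i<?n. vec_index w i) = 0" .
  have "(\<Sum>i<?n. vec_index w i *\<^sub>R (ys ! i)) =
      (\<Sum>i<?n. vec_index w i *\<^sub>R (\<Sum>x\<in>set xs. bary (set xs) (ys ! i) x *\<^sub>R x))"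
    by (intro sum.cong refl) (use nth in \<open>simp add: bary_combination\<close>)
  also have "\<dots> = (\<Sum>x\<in>set xs. (\<Sum>i<?n. vec_index w i * bary (set xs) (ys ! i) x) *\<^sub>R x)"
    by (simp add: scaleR_sum_right scaleR_sum_left) (rule sum.swap)
  also have "\<dots> = 0"
    by (simp add: col)
  finally have s1: "(\<Sum>i<?n. vec_index w i *\<^sub>R (ys ! i)) = 0" .
  obtain k where k: "k < ?n" "vec_index w k \<noteq> 0"
  proof (rule ccontr)
    assume "\<not> thesis"
    then have "w = 0\<^sub>v ?n"
      using w(1) that by (intro eq_vecI) auto
    then show False
      using w(2) by simp
  qed
  \<comment> \<open>The weights move from indices to points, which is possible since
    \<open>ys\<close> is distinct.\<close>
  define u where "u y = vec_index w (THE i. i < ?n \<and> ys ! i = y)" for y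
  have u: "u (ys ! i) = vec_index w i" if "i < ?n" for i
  proof -
    have "(THE k. k < ?n \<and> ys ! k = ys ! i) = i"
      using that ys(2) len by (intro the_equality) (auto simp: nth_eq_iff_index_eq)
    then show ?thesis
      by (simp add: u_def)
  qed
  have bij: "bij_betw (\<lambda>i. ys ! i) {..<?n} (set ys)"
    using ys(2) len bij_betw_nth by metis
  have "sum u (set ys) = 0"
    using sum.reindex_bij_betw[OF bij, of u] s0 u by simp
  moreover have "(\<Sum>y\<in>set ys. u y *\<^sub>R y) = 0"
    using sum.reindex_bij_betw[OF bij, of "\<lambda>y. u y *\<^sub>R y"] s1 u by simp
  moreover have "\<exists>y\<in>set ys. u y \<noteq> 0"
    using k u len by (metis nth_mem)
  ultimately have "affine_dependent (set ys)"
    by (auto simp: affine_dependent_explicit_finite)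
  then show False
    using ys(1) by simp
qed

lemma mult_mat_entry:
  assumes "A \<in> carrier_mat n n" "B \<in> carrier_mat n n" "i < n" "j < n"
  shows "(A * B) $$ (i, j) = (\<Sum>k<n. A $$ (i, k) * B $$ (k, j))"
  using assms by (simp add: scalar_prod_def lessThan_atLeast0)

lemma mat_delete_0_0:
  assumes "D \<in> carrier_mat (Suc m) (Suc m)"
    and "\<And>i j. i < m \<Longrightarrow> j < m \<Longrightarrow> D $$ (Suc i, Suc j) = f (i, j)"
  shows "mat_delete D 0 0 = Matrix.mat m m f"
  using assms by (intro eq_matI) (auto simp: mat_delete_def)

lemma vol_eq_det_differences:
  assumes V: "\<not> affine_dependent (set xs)" "distinct xs" and ys: "set ys \<subseteq> affine hull (set xs)"
    and len: "length xs = Suc m" "length ys = Suc m"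
  shows "vol xs ys = Determinant.det (Matrix.mat m m (\<lambda>(i, j).
    bary (set xs) (ys ! Suc i) (xs ! Suc j) - bary (set xs) (ys ! 0) (xs ! Suc j)))"
proof -
  let ?n = "Suc m"
  let ?B = "bary_mat xs ys"
  \<comment> \<open>Multiplication by R from the right adds all columns to column 0, which becomes
    constantly 1; multiplication by L from the left subtracts row 0 from the other rows. Both have
    determinant 1, and afterwards column 0 is a unit vector.\<close>
  define L :: "real mat" where
    "L = Matrix.mat ?n ?n (\<lambda>(i, j). if i = j then 1 else if j = 0 then - 1 else 0)"
  define R :: "real mat" where
    "R = Matrix.mat ?n ?n (\<lambda>(i, j). if i = j then 1 else if j = 0 then 1 else 0)"
  have B: "?B \<in> carrier_mat ?n ?n"
    using bary_mat_carrier[of xs ys] len by simp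
  have L: "L \<in> carrier_mat ?n ?n" and R: "R \<in> carrier_mat ?n ?n"
    by (simp_all add: L_def R_def)
  have "diag_mat L = replicate ?n 1" "diag_mat R = replicate ?n 1"
    by (rule nth_equalityI; auto simp: diag_mat_def L_def R_def simp del: upt_Suc replicate_Suc)+
  then have detL: "Determinant.det L = 1" and detR: "Determinant.det R = 1"
    using det_lower_triangular[OF _ L] det_lower_triangular[OF _ R]
    by (simp_all add: L_def R_def prod_list_replicate)
  have rows: "(\<Sum>j<?n. ?B $$ (i, j)) = 1" if "i < ?n" for i
  proof -
    have "(\<Sum>j<?n. bary (set xs) (ys ! i) (xs ! j)) = sum (bary (set xs) (ys ! i)) (set xs)"
      using sum.reindex_bij_betw[OF bij_betw_nth[OF V(2) refl refl], of "bary (set xs) (ys ! i)"] len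
      by simp
    also have "\<dots> = 1"
      using that len ys by (intro sum_bary) auto
    finally show ?thesis
      using that len by (simp add: bary_mat_def)
  qed
  have BR: "(?B * R) $$ (i, j) = (if j = 0 then 1 else ?B $$ (i, j))" if "i < ?n" "j < ?n" for i j
  proof -
    have "(?B * R) $$ (i, j) = (\<Sum>k<?n. ?B $$ (i, k) * R $$ (k, j))"
      by (rule mult_mat_entry[OF B R that])
    also have "\<dots> = (\<Sum>k<?n. if j = 0 then ?B $$ (i, k) else if k = j then ?B $$ (i, k) else 0)"
      by (intro sum.cong refl) (use that in \<open>auto simp: R_def\<close>)
    also have "\<dots> = (if j = 0 then 1 else ?B $$ (i, j))"
      using rows[OF that(1)] that by (cases "j = 0") (auto simp: sum.delta)
    finally show ?thesis .
  qed
  have BRc: "?B * R \<in> carrier_mat ?n ?n"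
    using B R by simp
  have LBR: "(L * (?B * R)) $$ (i, j) =
      (if i = 0 then (?B * R) $$ (0, j) else (?B * R) $$ (i, j) - (?B * R) $$ (0, j))"
    if "i < ?n" "j < ?n" for i j
  proof -
    have "(L * (?B * R)) $$ (i, j) = (\<Sum>k<?n. L $$ (i, k) * (?B * R) $$ (k, j))"
      by (rule mult_mat_entry[OF L BRc that])
    also have "\<dots> = L $$ (i, 0) * (?B * R) $$ (0, j) +
        (\<Sum>k<m. L $$ (i, Suc k) * (?B * R) $$ (Suc k, j))"
      by (rule sum.lessThan_Suc_shift)
    also have "(\<Sum>k<m. L $$ (i, Suc k) * (?B * R) $$ (Suc k, j)) =
        (\<Sum>k<m. if k = i - 1 then (if i = 0 then 0 else (?B * R) $$ (i, j)) else 0)"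
      by (intro sum.cong refl) (use that in \<open>auto simp: L_def\<close>)
    finally show ?thesis
      using that by (auto simp: L_def sum.delta)
  qed
  let ?D = "L * (?B * R)"
  have D: "?D \<in> carrier_mat ?n ?n"
    using L BRc by simp
  have "vol xs ys = Determinant.det ?D"
    using det_mult[OF L BRc] det_mult[OF B R] detL detR len by (simp add: vol_def)
  also have "\<dots> = (\<Sum>i<?n. ?D $$ (i, 0) * cofactor ?D i 0)"
    by (rule laplace_expansion_column[OF D]) simp
  also have "\<dots> = cofactor ?D 0 0"
    unfolding sum.lessThan_Suc_shift by (simp add: LBR BR)
  also have "\<dots> = Determinant.det (mat_delete ?D 0 0)"
    by (simp add: cofactor_def)
  also have "mat_delete ?D 0 0 = Matrix.mat m m (\<lambda>(i, j).
      bary (set xs) (ys ! Suc i) (xs ! Suc j) - bary (set xs) (ys ! 0) (xs ! Suc j))"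
  proof (rule mat_delete_0_0[OF D])
    fix i j assume "i < m" "j < m"
    then have "?D $$ (Suc i, Suc j) = ?B $$ (Suc i, Suc j) - ?B $$ (0, Suc j)"
      using LBR[of "Suc i" "Suc j"] BR[of "Suc i" "Suc j"] BR[of 0 "Suc j"] by simp
    then show "?D $$ (Suc i, Suc j) = (case (i, j) of (i, j) \<Rightarrow>
        bary (set xs) (ys ! Suc i) (xs ! Suc j) - bary (set xs) (ys ! 0) (xs ! Suc j))"
      using \<open>i < m\<close> \<open>j < m\<close> len by (simp add: bary_mat_def)
  qed
  finally show ?thesis .
qed

text \<open>The matrix in \<open>compatibly_oriented\<close> is unique: its entries are differences
  of barycentric coordinates, and its determinant is the signed volume.\<close>

lemma compatibly_oriented_iff_vol:
  assumes V: "\<not> affine_dependent (set xs)" "distinct xs" and ys: "set ys \<subseteq> affine hull (set xs)"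
    and len: "length ys = length xs"
  shows "compatibly_oriented xs ys \<longleftrightarrow> vol xs ys > 0"
proof (cases "length xs")
  case 0
  then show ?thesis
    using len by (auto simp: compatibly_oriented_def vol_def bary_mat_def)
next
  case (Suc m)
  let ?b = "bary (set xs)"
  let ?A = "Matrix.mat m m (\<lambda>(i, j). ?b (ys ! Suc i) (xs ! Suc j) - ?b (ys ! 0) (xs ! Suc j))"
  have idx: "sum f (set xs) = f (xs ! 0) + (\<Sum>j<m. f (xs ! Suc j))" for f :: "'a \<Rightarrow> 'b::comm_monoid_add"
    using sum.reindex_bij_betw[OF bij_betw_nth[OF V(2) refl refl], of f]
    by (simp add: Suc sum.lessThan_Suc_shift del: sum.lessThan_Suc)
  have mem: "ys ! i \<in> affine hull (set xs)" if "i < Suc m" for i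
    using that ys len Suc by auto
  have first: "ys ! Suc i - ys ! 0 = (\<Sum>j<m. ?A $$ (i, j) *\<^sub>R (xs ! Suc j - xs ! 0))" if i: "i < m" for i
  proof -
    let ?d = "\<lambda>x. ?b (ys ! Suc i) x - ?b (ys ! 0) x"
    have "(\<Sum>x\<in>set xs. ?d x) = 0"
      using mem[of "Suc i"] mem[of 0] i by (simp add: sum_subtractf sum_bary)
    then have d0: "?d (xs ! 0) = - (\<Sum>j<m. ?d (xs ! Suc j))"
      by (simp add: idx)
    have "ys ! Suc i - ys ! 0 = (\<Sum>x\<in>set xs. ?d x *\<^sub>R x)"
      using mem[of "Suc i"] mem[of 0] i
      by (simp add: scaleR_left_diff_distrib sum_subtractf bary_combination)
    also have "\<dots> = (\<Sum>j<m. ?d (xs ! Suc j) *\<^sub>R (xs ! Suc j - xs ! 0))"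
      unfolding idx d0
      by (simp add: scaleR_right_diff_distrib scaleR_left_diff_distrib sum_subtractf scaleR_sum_left)
    finally show ?thesis
      using i by simp
  qed
  have unique: "A = ?A" if A: "A \<in> carrier_mat m m"
    and eq: "\<forall>i<m. ys ! Suc i - ys ! 0 = (\<Sum>j<m. A $$ (i, j) *\<^sub>R (xs ! Suc j - xs ! 0))" for A
  proof (rule eq_matI)
    fix i k assume "i < dim_row ?A" "k < dim_col ?A"
    then have i: "i < m" and k: "k < m"
      by auto
    \<comment> \<open>Adding row i of A to the coordinates of \<open>ys ! 0\<close>, and minus the
      row sum at \<open>xs ! 0\<close> to keep the total 1, gives coordinates of
      \<open>ys ! Suc i\<close>. Their uniqueness determines A.\<close>
    define u where "u x = ?b (ys ! 0) x + (if x = xs ! 0 then - (\<Sum>j<m. A $$ (i, j)) else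
        A $$ (i, THE j. j < m \<and> xs ! Suc j = x))" for x
    have the: "(THE j'. j' < m \<and> xs ! Suc j' = xs ! Suc j) = j" "xs ! Suc j \<noteq> xs ! 0" if "j < m" for j
      using that V(2) Suc by (auto simp: nth_eq_iff_index_eq)
    have uj: "u (xs ! Suc j) = ?b (ys ! 0) (xs ! Suc j) + A $$ (i, j)" if "j < m" for j
      using the[OF that] by (simp add: u_def)
    have u0: "u (xs ! 0) = ?b (ys ! 0) (xs ! 0) - (\<Sum>j<m. A $$ (i, j))"
      by (simp add: u_def)
    have "?b (ys ! Suc i) (xs ! Suc k) = u (xs ! Suc k)"
    proof (rule bary_unique[OF V(1)])
      have "sum u (set xs) = sum (?b (ys ! 0)) (set xs)"
        by (simp add: idx u0 uj sum.distrib)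
      then show "sum u (set xs) = 1"
        using mem[of 0] by (simp add: sum_bary)
      have "(\<Sum>x\<in>set xs. u x *\<^sub>R x) =
          (\<Sum>x\<in>set xs. ?b (ys ! 0) x *\<^sub>R x) + (\<Sum>j<m. A $$ (i, j) *\<^sub>R (xs ! Suc j - xs ! 0))"
        by (simp add: idx u0 uj sum.distrib algebra_simps sum_subtractf scaleR_sum_left)
      then show "(\<Sum>x\<in>set xs. u x *\<^sub>R x) = ys ! Suc i"
        unfolding eq[rule_format, OF i, symmetric]
        using bary_combination[OF finite_set mem[of 0]] by simp
      show "xs ! Suc k \<in> set xs"
        using k Suc by simp
    qed
    then show "A $$ (i, k) = ?A $$ (i, k)"
      using i k uj by simp
  qed (use A in auto)
  have vol: "vol xs ys = Determinant.det ?A"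
    by (rule vol_eq_det_differences[OF V ys]) (use len Suc in auto)
  show ?thesis
  proof
    assume "compatibly_oriented xs ys"
    then show "vol xs ys > 0"
      using unique unfolding vol compatibly_oriented_def Suc by auto
  next
    assume "vol xs ys > 0"
    then show "compatibly_oriented xs ys"
      unfolding compatibly_oriented_def Suc using len Suc first vol
      by (intro conjI bexI[of _ ?A]) auto
  qed
qed

subsection \<open>Geometry of subdivisions\<close>

context oriented
begin

lemma mem_iff_bary:
  assumes "S \<in> U"
  shows "p \<in> S \<longleftrightarrow> p \<in> affine hull (set (ori S)) \<and> (\<forall>v\<in>set (ori S). bary (set (ori S)) p v \<ge> 0)"
  using convex_hull_iff_bary[OF ori_independent[OF assms]] hull_ori[OF assms] by simp

lemma rel_interior_iff:
  assumes "S \<in> U"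
  shows "p \<in> rel_interior S \<longleftrightarrow>
    p \<in> affine hull (set (ori S)) \<and> (\<forall>v\<in>set (ori S). bary (set (ori S)) p v > 0)"
  using rel_interior_iff_bary[OF ori_independent[OF assms]] hull_ori[OF assms] by simp

lemma subset_affine_hull_ori: "S \<in> U \<Longrightarrow> S \<subseteq> affine hull (set (ori S))"
  using mem_iff_bary by blast

lemma set_ori_subset: "S \<in> U \<Longrightarrow> set (ori S) \<subseteq> S"
  using hull_ori hull_subset by metis

lemma convex_U: "S \<in> U \<Longrightarrow> convex S"
  using hull_ori convex_convex_hull by metis

lemma compact_U: "S \<in> U \<Longrightarrow> compact S"
  using hull_ori finite_imp_compact_convex_hull by (metis finite_set)

lemma rel_interior_nonempty: "S \<in> U \<Longrightarrow> S \<noteq> {} \<Longrightarrow> rel_interior S \<noteq> {}"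
  using rel_interior_eq_empty convex_U by blast

lemma face_iff:
  assumes "S \<in> U"
  shows "F face_of S \<longleftrightarrow> F \<in> U \<and> set (ori F) \<subseteq> set (ori S)"
proof -
  have "F face_of S \<longleftrightarrow> (\<exists>c\<subseteq>set (ori S). F = convex hull c)"
    using face_of_convex_hull_affine_independent[OF ori_independent[OF assms], of F]
      hull_ori[OF assms] by simp
  then show ?thesis
    using set_ori_hull[OF assms] hull_in[OF assms] hull_ori by metis
qed

lemma eq_if_set_ori_eq: "S \<in> U \<Longrightarrow> T \<in> U \<Longrightarrow> set (ori S) = set (ori T) \<Longrightarrow> S = T"
  using hull_ori by metis

lemma length_ori: "S \<in> U \<Longrightarrow> length (ori S) = card (set (ori S))"
  using distinct_card[OF distinct_ori] by simp

text \<open>The vertices at which p has a positive coordinate span the face.\<close>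

lemma mem_rel_interior_face:
  assumes "S \<in> U" "p \<in> S"
  obtains W where "W \<subseteq> set (ori S)" "p \<in> rel_interior (convex hull W)"
proof
  let ?V = "set (ori S)"
  let ?W = "{v \<in> ?V. bary ?V p v > 0}"
  show sub: "?W \<subseteq> ?V"
    by blast
  have V: "\<not> affine_dependent ?V"
    by (rule ori_independent[OF assms(1)])
  have p: "p \<in> convex hull ?V"
    using assms hull_ori by simp
  then have "\<forall>v\<in>?V - ?W. bary ?V p v = 0"
    using mem_iff_bary[OF assms(1)] assms(2) by force
  then have pW: "p \<in> convex hull ?W"
    using convex_hull_face_iff_bary[OF V sub] p by blast
  then have aff: "p \<in> affine hull ?W"
    using convex_hull_subset_affine_hull by blast
  have "bary ?W p v > 0" if "v \<in> ?W" for v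
    using bary_subset[OF V sub aff, of v] that by auto
  then show "p \<in> rel_interior (convex hull ?W)"
    using rel_interior_iff_bary[OF affine_independent_subset[OF V sub]] aff by blast
qed

end

section \<open>Complexes and subdivisions inside the family\<close>

locale oriented_complex = oriented +
  fixes K
  assumes K_complex: "simplicial_complex K" and K_U: "K \<subseteq> U"
begin

lemma KU: "S \<in> K \<Longrightarrow> S \<in> U"
  using K_U by blast

lemma finite_K: "finite K"
  using K_complex by (simp add: simplicial_complex_def)

lemma face_in_K: "S \<in> K \<Longrightarrow> F face_of S \<Longrightarrow> F \<in> K"
  using K_complex by (auto simp: simplicial_complex_def)

lemma Int_face: "S \<in> K \<Longrightarrow> T \<in> K \<Longrightarrow> (S \<inter> T) face_of S"
  using K_complex by (auto simp: simplicial_complex_def)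

lemma hull_in_K:
  assumes "S \<in> K" "A \<subseteq> set (ori S)"
  shows "convex hull A \<in> K"
  using face_in_K[OF assms(1)] face_iff[OF KU[OF assms(1)]] hull_in[OF KU[OF assms(1)] assms(2)]
    set_ori_hull[OF KU[OF assms(1)] assms(2)] assms(2) by simp

lemma face_closed_K: "face_closed K"
  using K_U hull_in_K by (auto simp: face_closed_def)

lemma subset_imp_set_ori_subset:
  assumes "S \<in> K" "T \<in> K" "T \<subseteq> S"
  shows "set (ori T) \<subseteq> set (ori S)"
  using Int_face[OF assms(1,2)] face_iff[OF KU[OF assms(1)], of T] assms(3)
  by (simp add: inf.absorb2)

lemma set_ori_subset_imp_subset:
  assumes "S \<in> K" "T \<in> K" "set (ori T) \<subseteq> set (ori S)"
  shows "T \<subseteq> S"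
  using face_iff[OF KU[OF assms(1)], of T] KU assms(2,3) face_of_imp_subset by blast

lemma rel_interior_meets_imp_subset:
  assumes "F \<in> K" "T \<in> K" "x \<in> rel_interior F" "x \<in> T"
  shows "F \<subseteq> T"
  using face_of_disjoint_rel_interior[OF Int_face[OF assms(1,2)]] assms rel_interior_subset by blast

lemma rel_interiors_meet_imp_eq:
  assumes "F \<in> K" "T \<in> K" "x \<in> rel_interior F" "x \<in> rel_interior T"
  shows "F = T"
  using rel_interior_meets_imp_subset[OF assms(1,2,3)] rel_interior_meets_imp_subset[OF assms(2,1,4)]
    assms(3,4) rel_interior_subset by blast

lemma eq_if_subset_length:
  assumes "S \<in> K" "T \<in> K" "T \<subseteq> S" "length (ori T) = length (ori S)"
  shows "T = S"
proof -
  have "set (ori T) = set (ori S)"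
    using subset_imp_set_ori_subset[OF assms(1-3)] assms(4) length_ori KU assms(1,2)
    by (metis card_subset_eq finite_set)
  then show ?thesis
    using eq_if_set_ori_eq KU assms(1,2) by blast
qed

lemma mem_rel_interior_in_K:
  assumes "S \<in> K" "p \<in> S"
  obtains F where "F \<in> K" "F \<subseteq> S" "p \<in> rel_interior F"
proof -
  obtain W where W: "W \<subseteq> set (ori S)" "p \<in> rel_interior (convex hull W)"
    using mem_rel_interior_face[OF KU[OF assms(1)] assms(2)] .
  show ?thesis
  proof
    show "convex hull W \<in> K"
      by (rule hull_in_K[OF assms(1) W(1)])
    show "convex hull W \<subseteq> S"
      using hull_mono[OF W(1)] hull_ori[OF KU[OF assms(1)]] by metis
  qed (rule W(2))
qed

lemma restrict_complex: "simplicial_complex {T \<in> K. T \<subseteq> S}"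
proof -
  have "F \<subseteq> S" if "F face_of T" "T \<subseteq> S" for F T
    using that face_of_imp_subset by blast
  then show ?thesis
    using K_complex unfolding simplicial_complex_def by auto
qed

end

locale subdivided = oriented +
  fixes N M
  assumes sub: "subdivision N M" and N_U: "N \<subseteq> U" and M_U: "M \<subseteq> U"
begin

sublocale N: oriented_complex U ori N
  using sub N_U by unfold_locales (auto simp: subdivision_def)

sublocale M: oriented_complex U ori M
  using sub M_U by unfold_locales (auto simp: subdivision_def)

lemma union_eq: "\<Union>M = \<Union>N"
  using sub by (auto simp: subdivision_def)

lemma contained: "T \<in> M \<Longrightarrow> \<exists>S\<in>N. T \<subseteq> S"
  using sub by (auto simp: subdivision_def)

text \<open>T lies in some S' of \<open>N\<close>. As \<open>S' \<inter> S\<close> is a face of S',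
  its trace on T is a face of T, and a face that meets the relative interior of T is T.\<close>

lemma rel_interior_meets_imp_contained:
  assumes "T \<in> M" "S \<in> N" "x \<in> rel_interior T" "x \<in> S"
  shows "T \<subseteq> S"
proof -
  obtain S' where S': "S' \<in> N" "T \<subseteq> S'"
    using contained[OF assms(1)] by blast
  have "(S' \<inter> S) face_of S'"
    by (rule N.Int_face[OF S'(1) assms(2)])
  then have "(S' \<inter> S \<inter> T) face_of (S' \<inter> T)"
    by (rule face_of_slice[OF _ convex_U[OF M.KU[OF assms(1)]]])
  moreover have "S' \<inter> T = T" "S' \<inter> S \<inter> T = S \<inter> T"
    using S'(2) by auto
  ultimately have "(S \<inter> T) face_of T"
    by simp
  from face_of_disjoint_rel_interior[OF this] show ?thesis
    using assms rel_interior_subset by blast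
qed

lemma cover:
  assumes "S \<in> N" "p \<in> S"
  obtains T where "T \<in> M" "T \<subseteq> S" "p \<in> rel_interior T"
proof -
  obtain T' where "T' \<in> M" "p \<in> T'"
    using union_eq assms by blast
  then obtain T where T: "T \<in> M" "p \<in> rel_interior T"
    using M.mem_rel_interior_in_K by metis
  then show ?thesis
    using that rel_interior_meets_imp_contained[OF T(1) assms(1) T(2) assms(2)] by blast
qed

lemma empty_in_M:
  assumes "S \<in> N" "S \<noteq> {}"
  shows "{} \<in> M"
proof -
  obtain v where "v \<in> S"
    using assms(2) by blast
  then obtain T where "T \<in> M"
    using cover[OF assms(1)] by blast
  then show ?thesis
    using M.hull_in_K[of T "{}"] by simp
qed

text \<open>Used twice: the part of \<open>M\<close> inside a simplex of \<open>N\<close>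
  triangulates a convex set and is therefore acyclic, and the relative homology argument for C_k > 0
  takes place inside one simplex.\<close>

lemma subdivided_restrict:
  assumes "S \<in> N"
  shows "subdivided U ori {T \<in> N. T \<subseteq> S} {T \<in> M. T \<subseteq> S}"
proof (unfold_locales)
  have "\<Union>{T \<in> N. T \<subseteq> S} = S"
    using assms by auto
  moreover have "\<Union>{T \<in> M. T \<subseteq> S} = S"
  proof (intro equalityI subsetI)
    fix p assume "p \<in> S"
    then show "p \<in> \<Union>{T \<in> M. T \<subseteq> S}"
      using cover[OF assms] rel_interior_subset by blast
  qed auto
  ultimately show "subdivision {T \<in> N. T \<subseteq> S} {T \<in> M. T \<subseteq> S}"
    unfolding subdivision_def using N.restrict_complex M.restrict_complex assms by auto
qed (use N_U M_U in auto)

text \<open>The simplices of \<open>M\<close> that miss x form a closed set, so a short move from x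
  towards q avoids them. It ends in a simplex containing x, hence all of F.\<close>

lemma star_segment:
  assumes S: "S \<in> N" and F: "F \<in> M" "F \<subseteq> S" and x: "x \<in> rel_interior F" and q: "q \<in> S"
  obtains T e where "T \<in> M" "T \<subseteq> S" "F \<subseteq> T" "0 < e" "e \<le> 1" "x + e *\<^sub>R (q - x) \<in> T"
proof -
  let ?C = "\<Union>{T \<in> M. x \<notin> T}"
  have "closed ?C"
    using M.finite_K compact_U M.KU by (intro closed_Union) (auto intro: compact_imp_closed)
  then have "open (- ?C)" "x \<in> - ?C"
    by auto
  then obtain d where d: "d > 0" "ball x d \<subseteq> - ?C"
    using open_contains_ball by blast
  \<comment> \<open>Small enough for the move to have length below d; the summand 1 keeps the
    denominator positive if q = x.\<close>
  define e where "e = min 1 (d / (2 * (norm (q - x) + 1)))"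
  have pos: "norm (q - x) + 1 > 0"
    using norm_ge_zero[of "q - x"] by linarith
  have e: "0 < e" "e \<le> 1"
    using d(1) pos by (auto simp: e_def)
  have "e * norm (q - x) \<le> d / (2 * (norm (q - x) + 1)) * norm (q - x)"
    by (intro mult_right_mono) (auto simp: e_def)
  also have "\<dots> < d"
  proof -
    have "d * norm (q - x) < d * (2 * (norm (q - x) + 1))"
      using d(1) pos by (intro mult_strict_left_mono) (auto simp: algebra_simps)
    then show ?thesis
      using pos by (simp add: pos_divide_less_eq)
  qed
  finally have "x + e *\<^sub>R (q - x) \<in> ball x d"
    using e(1) by (simp add: dist_norm)
  moreover have "x \<in> S"
    using F(2) x rel_interior_subset by blast
  then have "x + e *\<^sub>R (q - x) \<in> S"
    using convexD_alt[OF convex_U[OF N.KU[OF S]] _ q, of x e] e by (simp add: algebra_simps)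
  then obtain T where T: "T \<in> M" "T \<subseteq> S" "x + e *\<^sub>R (q - x) \<in> rel_interior T"
    using cover[OF S] by metis
  then have T': "x + e *\<^sub>R (q - x) \<in> T"
    using rel_interior_subset by blast
  ultimately have "x \<in> T"
    using T(1) d(2) by blast
  then have "F \<subseteq> T"
    by (rule M.rel_interior_meets_imp_subset[OF F(1) T(1) x])
  then show ?thesis
    using that T T' e by blast
qed

end

subsection \<open>The two sides of a face of codimension one\<close>

context oriented
begin

lemma vol_Cons_eq_0:
  assumes "\<not> affine_dependent (set xs)" "set f \<subseteq> affine hull (set xs)" "x \<in> affine hull (set f)"
  shows "vol xs (x # f) = 0"
proof -
  have "vol xs ((\<Sum>v\<in>set f. bary (set f) x v *\<^sub>R v) # f) =
      (\<Sum>v\<in>set f. bary (set f) x v * vol xs (v # f))"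
    by (rule vol_Cons_affine[OF assms(1)]) (use assms in \<open>auto simp: sum_bary\<close>)
  also have "\<dots> = 0"
    by (intro sum.neutral) (auto simp: alternating_not_distinct[OF alternating_vol_right])
  finally show ?thesis
    by (simp add: bary_combination[OF _ assms(3)])
qed

lemma vol_Cons_segment:
  assumes V: "\<not> affine_dependent (set xs)" and "p \<in> affine hull (set xs)" "q \<in> affine hull (set xs)"
  shows "vol xs ((p + e *\<^sub>R (q - p)) # f) = (1 - e) * vol xs (p # f) + e * vol xs (q # f)"
proof -
  have "p + e *\<^sub>R (q - p) = (\<Sum>i\<in>UNIV. (if i then e else 1 - e) *\<^sub>R (if i then q else p))"
    by (simp add: UNIV_bool algebra_simps)
  also have "vol xs (\<dots> # f) = (\<Sum>i\<in>UNIV. (if i then e else 1 - e) * vol xs ((if i then q else p) # f))"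
    by (rule vol_Cons_affine[OF V]) (auto simp: UNIV_bool assms)
  finally show ?thesis
    by (simp add: UNIV_bool)
qed

lemma affine_hull_eq_if_length:
  assumes "S \<in> U" "T \<in> U" "T \<subseteq> S" "length (ori T) = length (ori S)"
  shows "affine hull (set (ori T)) = affine hull (set (ori S))"
proof (cases "ori T = []")
  case True
  then show ?thesis
    using assms(4) by simp
next
  case False
  have "set (ori T) \<subseteq> affine hull (set (ori S))"
    using set_ori_subset[OF assms(2)] assms(3) subset_affine_hull_ori[OF assms(1)] by blast
  then have "affine hull (set (ori T)) \<subseteq> affine hull (set (ori S))"
    by (simp add: hull_minimal)
  moreover have "aff_dim (affine hull (set (ori T))) = aff_dim (affine hull (set (ori S)))"
    using aff_dim_ori[OF assms(1)] aff_dim_ori[OF assms(2)] assms(4) aff_dim_affine_hull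
      hull_ori assms(1,2) by (metis aff_dim_convex_hull)
  ultimately show ?thesis
    using False by (intro affine_dim_equal) auto
qed

lemma vol_ori_nonzero:
  assumes "S \<in> U" "T \<in> U" "T \<subseteq> S" "length (ori T) = length (ori S)" "set ys = set (ori T)" "distinct ys"
  shows "vol (ori S) ys \<noteq> 0"
proof (rule vol_nonzero)
  show "set ys \<subseteq> affine hull (set (ori S))"
    using set_ori_subset[OF assms(2)] assms(3,5) subset_affine_hull_ori[OF assms(1)] by blast
  show "length ys = length (ori S)"
    using assms length_ori distinct_card by metis
qed (use assms ori_independent distinct_ori in auto)

end

context oriented_complex
begin

text \<open>Points slightly off the relative interior of F in the direction of a2 are in the
  relative interior of T2, and also of T1 since a2 is on the side of a1. Relative interiors of
  distinct simplices of a complex are disjoint.\<close>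

lemma same_side_imp_eq:
  assumes S: "S \<in> U" and F: "F \<in> U" "F \<noteq> {}"
    and T1: "T1 \<in> K" "T1 \<subseteq> S" "set (ori T1) = insert a1 (set (ori F))" "a1 \<notin> set (ori F)"
    and T2: "T2 \<in> K" "T2 \<subseteq> S" "set (ori T2) = insert a2 (set (ori F))" "a2 \<notin> set (ori F)"
    and len: "length (ori S) = Suc (length (ori F))"
    and side: "vol (ori S) (a1 # ori F) * vol (ori S) (a2 # ori F) > 0"
  shows "T1 = T2"
proof -
  let ?f = "ori F" and ?V1 = "set (ori T1)" and ?V2 = "set (ori T2)"
  let ?h = "\<lambda>z. vol (ori S) (z # ori F)"
  have len1: "length (ori T1) = length (ori S)" and len2: "length (ori T2) = length (ori S)"
    using length_ori[OF KU[OF T1(1)]] length_ori[OF KU[OF T2(1)]] length_ori[OF F(1)] T1(3,4) T2(3,4) len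
    by auto
  have aff1: "affine hull ?V1 = affine hull (set (ori S))"
    by (rule affine_hull_eq_if_length[OF S KU[OF T1(1)] T1(2) len1])
  have aff2: "affine hull ?V2 = affine hull (set (ori S))"
    by (rule affine_hull_eq_if_length[OF S KU[OF T2(1)] T2(2) len2])
  have ind: "\<not> affine_dependent ?V1" "\<not> affine_dependent ?V2" "\<not> affine_dependent (set (ori S))"
    using ori_independent S KU T1(1) T2(1) by auto
  have a2: "a2 \<in> affine hull ?V1"
    using aff1 aff2 hull_inc[of a2 ?V2] T2(3) by auto
  obtain x where x: "x \<in> rel_interior F"
    using rel_interior_nonempty[OF F] by blast
  then have xF: "x \<in> affine hull (set ?f)" and xpos: "\<And>v. v \<in> set ?f \<Longrightarrow> bary (set ?f) x v > 0"
    using rel_interior_iff[OF F(1)] by auto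
  have f1: "set ?f \<subseteq> ?V1" and f2: "set ?f \<subseteq> ?V2"
    using T1(3) T2(3) by auto
  have x1: "x \<in> affine hull ?V1" and x2: "x \<in> affine hull ?V2"
    using xF hull_mono[OF f1] hull_mono[OF f2] by auto
  have fS: "set ?f \<subseteq> affine hull (set (ori S))"
    using f1 aff1 hull_subset[of ?V1 affine] by auto
  have "v \<in> affine hull (set (ori S))" if "v \<in> ?V1" for v
    using hull_inc[OF that, of affine] aff1 by simp
  then have "?h (\<Sum>v\<in>?V1. bary ?V1 a2 v *\<^sub>R v) = (\<Sum>v\<in>?V1. bary ?V1 a2 v * ?h v)"
    by (rule vol_Cons_affine[OF ind(3) sum_bary[OF finite_set a2] finite_set])
  \<comment> \<open>The volume vanishes at the vertices of F, so its values at a1 and a2 differ by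
    the a1-coordinate of a2 as a factor; being on the same side makes this factor positive.\<close>
  also have "\<dots> = (\<Sum>v\<in>{a1}. bary ?V1 a2 v * ?h v)"
    by (rule sum.mono_neutral_right)
      (auto simp: T1(3) alternating_not_distinct[OF alternating_vol_right])
  finally have "?h a2 = bary ?V1 a2 a1 * ?h a1"
    by (simp add: bary_combination[OF _ a2])
  then have "bary ?V1 a2 a1 * (?h a1)\<^sup>2 > 0"
    using side by (simp add: power2_eq_square mult_ac)
  then have \<beta>: "bary ?V1 a2 a1 > 0"
    by (simp add: zero_less_mult_iff)
  define y where "y e = x + e *\<^sub>R (a2 - x)" for e :: real
  have y1: "bary ?V1 (y e) v = (1 - e) * bary ?V1 x v + e * bary ?V1 a2 v" if "v \<in> ?V1" for e v
    unfolding y_def by (rule bary_segment[OF ind(1) x1 a2 that])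
  \<comment> \<open>For small e the coordinates at the vertices of F stay positive by continuity,
    while that at a1 becomes positive because of a2.\<close>
  have "\<forall>\<^sub>F e in at_right 0. \<forall>v\<in>set ?f. (1 - e) * bary ?V1 x v + e * bary ?V1 a2 v > 0"
  proof (intro eventually_ball_finite ballI finite_set)
    fix v assume v: "v \<in> set ?f"
    have pos: "bary ?V1 x v > 0"
      using bary_subset[OF ind(1) f1 xF, of v] v f1 xpos by auto
    have lim: "((\<lambda>e. (1 - e) * bary ?V1 x v + e * bary ?V1 a2 v) \<longlongrightarrow>
        (1 - 0) * bary ?V1 x v + 0 * bary ?V1 a2 v) (at_right 0)"
      by (intro tendsto_intros)
    show "\<forall>\<^sub>F e in at_right 0. (1 - e) * bary ?V1 x v + e * bary ?V1 a2 v > 0"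
      by (rule order_tendstoD(1)[OF lim]) (use pos in simp)
  qed
  moreover have "\<forall>\<^sub>F e in at_right 0. e > 0 \<and> e < (1::real)"
    by (rule eventually_at_rightI[of 0 1]) auto
  ultimately have "\<forall>\<^sub>F e in at_right 0. (\<forall>v\<in>set ?f. (1 - e) * bary ?V1 x v + e * bary ?V1 a2 v > 0) \<and>
      e > 0 \<and> e < (1::real)"
    by (rule eventually_conj)
  then obtain e :: real where e: "\<forall>v\<in>set ?f. (1 - e) * bary ?V1 x v + e * bary ?V1 a2 v > 0" "e > 0" "e < 1"
    using eventually_happens[of _ "at_right (0::real)"] by auto
  have xa1: "bary ?V1 x a1 = 0"
    using bary_subset[OF ind(1) f1 xF, of a1] T1(3,4) by auto
  have "bary ?V1 (y e) v > 0" if "v \<in> ?V1" for v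
  proof (cases "v = a1")
    case True
    then show ?thesis
      using y1[OF that] xa1 \<beta> e(2) by simp
  next
    case False
    then show ?thesis
      using y1[OF that] that T1(3) e(1) by auto
  qed
  moreover have "y e \<in> affine hull ?V1"
    using x1 a2 mem_affine[of "affine hull ?V1" x a2 "1 - e" e]
    by (simp add: y_def algebra_simps)
  ultimately have "y e \<in> rel_interior T1"
    using rel_interior_iff[OF KU[OF T1(1)]] by blast
  moreover have "y e \<in> rel_interior T2"
  proof -
    have "bary ?V2 (y e) v > 0" if v: "v \<in> ?V2" for v
    proof -
      have "bary ?V2 (y e) v = (1 - e) * bary ?V2 x v + e * bary ?V2 a2 v"
        unfolding y_def by (rule bary_segment[OF ind(2) x2 _ v]) (simp add: hull_inc T2(3))
      also have "bary ?V2 a2 v = (if v = a2 then 1 else 0)"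
        by (rule bary_vertex[OF ind(2) v]) (simp add: T2(3))
      also have "bary ?V2 x v = (if v \<in> set ?f then bary (set ?f) x v else 0)"
        by (rule bary_subset[OF ind(2) f2 xF v])
      finally show ?thesis
        using v T2(3,4) e(2,3) xpos[of v] by auto
    qed
    moreover have "y e \<in> affine hull ?V2"
      using \<open>y e \<in> affine hull ?V1\<close> aff1 aff2 by simp
    ultimately show ?thesis
      using rel_interior_iff[OF KU[OF T2(1)]] by blast
  qed
  ultimately show ?thesis
    using rel_interiors_meet_imp_eq[OF T1(1) T2(1)] by blast
qed

end

subsection \<open>The chain map of a subdivision\<close>

context oriented
begin

lemma obd_bas_supp:
  assumes "T \<in> U"
  shows "obd ori (bas T) \<in> supp {F \<in> U. set (ori F) \<subseteq> set (ori T) \<and> Suc (length (ori F)) = length (ori T)}"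
  unfolding obd_bas
proof (rule lin_in_supp[OF tuple_bd_supp_ori[OF assms] _ subspace_supp])
  fix vs assume vs: "vs \<in> {vs. Suc (length vs) = length (ori T) \<and> set vs \<subseteq> set (ori T)}"
  then have "convex hull (set vs) \<in> U"
    using hull_in[OF assms] by auto
  then show "osx ori vs \<in> supp {F \<in> U. set (ori F) \<subseteq> set (ori T) \<and> Suc (length (ori F)) = length (ori T)}"
    using osx_supp[of vs] vs by (auto simp: supp_def)
qed

text \<open>Write T as the cone from a over F. In its boundary F occurs once, with sign +1, and all
  other faces contain a; so the incidence number is the sign of the order
  \<open>a # ori F\<close>.\<close>

lemma incidence:
  assumes T: "T \<in> U" and F: "F \<in> U" and TF: "set (ori T) = insert a (set (ori F))" "a \<notin> set (ori F)"
  obtains s where "s = 1 \<or> s = (-1::real)" "osx ori (a # ori F) = s *\<^sub>R bas T"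
    "Poly_Mapping.lookup (obd ori (bas T)) F = s"
proof -
  let ?f = "ori F"
  have sub: "set (a # ?f) \<subseteq> set (ori T)" and dist: "distinct (a # ?f)"
    using TF distinct_ori[OF F] by auto
  have hull: "convex hull (set (a # ?f)) = T"
    using hull_ori[OF T] TF(1) by simp
  obtain s where s: "s = 1 \<or> s = (-1::real)" "osx ori (a # ?f) = s *\<^sub>R bas T"
    using osx_sign[OF T sub dist] unfolding hull by metis
  have "s *\<^sub>R obd ori (bas T) = obd ori (osx ori (a # ?f))"
    by (simp add: s(2))
  also have "\<dots> = bas F - lin (\<lambda>g. osx ori (a # g)) (tuple_bd ?f)"
    using obd_osx[OF T sub] by (simp add: lin_tcone osx_ori[OF F])
  finally have "s * Poly_Mapping.lookup (obd ori (bas T)) F =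
      1 - Poly_Mapping.lookup (lin (\<lambda>g. osx ori (a # g)) (tuple_bd ?f)) F"
    by (metis lookup_scaleR lookup_minus lookup_single_eq)
  moreover have "lin (\<lambda>g. osx ori (a # g)) (tuple_bd ?f) \<in> supp {G. a \<in> set (ori G)}"
  proof (rule lin_mem_subspace[OF subspace_supp])
    fix g
    show "osx ori (a # g) \<in> supp {G. a \<in> set (ori G)}"
      using osx_supp[of "a # g"] by (auto simp: supp_def)
  qed
  then have "Poly_Mapping.lookup (lin (\<lambda>g. osx ori (a # g)) (tuple_bd ?f)) F = 0"
    using TF(2) by (simp add: supp_iff)
  ultimately have "Poly_Mapping.lookup (obd ori (bas T)) F = s"
    using s(1) by auto
  then show ?thesis
    using that s by blast
qed

text \<open>If T is oriented like \<open>xs\<close>, the coefficient of F in its boundary tells on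
  which side of F the vertex a lies. For the proof, \<open>osx\<close> is compared with the
  alternating function \<open>g\<close> that weights T by signs of volumes.\<close>

lemma vol_incidence:
  assumes T: "T \<in> U" and F: "F \<in> U" and TF: "set (ori T) = insert a (set (ori F))" "a \<notin> set (ori F)"
    and nz: "vol xs (ori T) \<noteq> 0"
  shows "sgn (vol xs (ori T)) * Poly_Mapping.lookup (obd ori (bas T)) F = sgn (vol xs (a # ori F))"
proof -
  obtain s where s: "s = 1 \<or> s = (-1::real)" "osx ori (a # ori F) = s *\<^sub>R bas T"
    "Poly_Mapping.lookup (obd ori (bas T)) F = s"
    using incidence[OF T F TF] .
  define g where "g ys = (sgn (vol xs (ori T)) * sgn (vol xs ys)) *\<^sub>R bas T" for ys
  have alt: "alternating g"
    unfolding alternating_def g_def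
    using alternatingD[OF alternating_vol_right, of xs]
    by (metis sgn_minus mult_minus_right scaleR_minus_left)
  have "mset (ori T) = mset (a # ori F)"
    using TF distinct_ori[OF T] distinct_ori[OF F] by (subst set_eq_iff_mset_eq_distinct[symmetric]) auto
  moreover have "osx ori (ori T) = g (ori T)"
    using nz by (simp add: g_def osx_ori[OF T] flip: sgn_mult)
  ultimately have "osx ori (a # ori F) = g (a # ori F)"
    using alternating_eq_mset[OF alternating_osx alt] by blast
  then have "s *\<^sub>R bas T = (sgn (vol xs (ori T)) * sgn (vol xs (a # ori F))) *\<^sub>R bas T"
    using s(2) by (simp add: g_def)
  from arg_cong[OF this, of "\<lambda>c. Poly_Mapping.lookup c T"] have "s = sgn (vol xs (ori T)) * sgn (vol xs (a # ori F))"
    by simp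
  moreover have "sgn (vol xs (ori T)) * sgn (vol xs (ori T)) = 1"
    using nz by (simp flip: sgn_mult)
  ultimately show ?thesis
    using s(3) by (simp flip: mult.assoc)
qed

end

context subdivided
begin

text \<open>The vertices of the link of F in the part of \<open>M\<close> inside S; each stands for
  one coface of F. The last condition makes a and the vertices of F exactly the vertices of the
  coface.\<close>

definition apexes :: "'a set \<Rightarrow> 'a set \<Rightarrow> 'a set" where
  "apexes S F = {a. a \<notin> set (ori F) \<and> convex hull (insert a (set (ori F))) \<in> M \<and>
     convex hull (insert a (set (ori F))) \<subseteq> S \<and>
     set (ori (convex hull (insert a (set (ori F))))) = insert a (set (ori F))}"

lemma finite_apexes: "finite (apexes S F)"
proof (rule finite_subset)
  show "apexes S F \<subseteq> (\<Union>T\<in>M. set (ori T))"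
    by (force simp: apexes_def)
qed (use M.finite_K in auto)

lemma apexI:
  assumes "T \<in> M" "T \<subseteq> S" "set (ori T) = insert a (set (ori F))" "a \<notin> set (ori F)"
  shows "a \<in> apexes S F" "convex hull (insert a (set (ori F))) = T"
  using assms hull_ori[OF M.KU[OF assms(1)]] by (auto simp: apexes_def)

text \<open>A short move from the interior of F towards q stays in a simplex T containing F. The
  signed volume there is a convex combination of its values at the vertices of T, one of which must
  have the right sign. The sign of c selects the side.\<close>

lemma apex_exists:
  assumes S: "S \<in> N" and F: "F \<in> M" "F \<subseteq> S" "F \<noteq> {}"
    and q: "q \<in> S" "c * vol (ori S) (q # ori F) > 0"
  obtains a where "a \<in> apexes S F" "c * vol (ori S) (a # ori F) > 0"
proof -
  let ?h = "\<lambda>z. vol (ori S) (z # ori F)"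
  have SU: "S \<in> U" and FU: "F \<in> U"
    using S F N_U M_U by auto
  have V: "\<not> affine_dependent (set (ori S))"
    by (rule ori_independent[OF SU])
  have fS: "set (ori F) \<subseteq> affine hull (set (ori S))"
    using set_ori_subset[OF FU] F(2) subset_affine_hull_ori[OF SU] by blast
  obtain x where x: "x \<in> rel_interior F"
    using rel_interior_nonempty[OF FU F(3)] by blast
  then have xf: "x \<in> affine hull (set (ori F))"
    using rel_interior_iff[OF FU] by blast
  have xS: "x \<in> affine hull (set (ori S))" and qS: "q \<in> affine hull (set (ori S))"
    using x F(2) rel_interior_subset q(1) subset_affine_hull_ori[OF SU] by blast+
  obtain T e where T: "T \<in> M" "T \<subseteq> S" "F \<subseteq> T" and e: "0 < e" "e \<le> 1" and y: "x + e *\<^sub>R (q - x) \<in> T"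
    using star_segment[OF S F(1,2) x q(1)] .
  let ?y = "x + e *\<^sub>R (q - x)" and ?W = "set (ori T)"
  have TU: "T \<in> U"
    using T(1) by (rule M.KU)
  have "?h ?y = e * ?h q"
    using vol_Cons_segment[OF V xS qS] vol_Cons_eq_0[OF V fS xf] by simp
  then have "c * ?h ?y > 0"
    using mult_pos_pos[OF e(1) q(2)] by (simp add: mult.left_commute)
  moreover have yW: "?y \<in> affine hull ?W" and pos: "\<forall>v\<in>?W. bary ?W ?y v \<ge> 0"
    using y mem_iff_bary[OF TU] by auto
  have WS: "v \<in> affine hull (set (ori S))" if "v \<in> ?W" for v
    using that set_ori_subset[OF TU] T(2) subset_affine_hull_ori[OF SU] by blast
  have "?h (\<Sum>v\<in>?W. bary ?W ?y v *\<^sub>R v) = (\<Sum>v\<in>?W. bary ?W ?y v * ?h v)"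
    by (rule vol_Cons_affine[OF V sum_bary[OF finite_set yW] finite_set WS])
  then have "?h ?y = (\<Sum>v\<in>?W. bary ?W ?y v * ?h v)"
    by (simp only: bary_combination[OF finite_set yW])
  ultimately have "(\<Sum>v\<in>?W. bary ?W ?y v * (c * ?h v)) > 0"
    by (simp add: sum_distrib_left mult.left_commute)
  then obtain a where a: "a \<in> ?W" "bary ?W ?y a * (c * ?h a) > 0"
    by (meson not_le sum_nonpos)
  then have ha: "c * ?h a > 0"
    using pos by (metis mult_le_0_iff not_le)
  have af: "a \<notin> set (ori F)"
    using ha alternating_not_distinct[OF alternating_vol_right, of "a # ori F" "ori S"] by auto
  have sub: "insert a (set (ori F)) \<subseteq> ?W"
    using a(1) M.subset_imp_set_ori_subset[OF T(1) F(1) T(3)] by blast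
  have "convex hull (insert a (set (ori F))) \<subseteq> T"
    using hull_mono[OF sub] hull_ori[OF TU] by metis
  then have "a \<in> apexes S F"
    using af M.hull_in_K[OF T(1) sub] set_ori_hull[OF TU sub] T(2) by (auto simp: apexes_def)
  then show ?thesis
    using that ha by blast
qed

lemma apex_nonzero:
  assumes S: "S \<in> N" and F: "F \<in> M" and len: "length (ori S) = Suc (length (ori F))"
    and a: "a \<in> apexes S F"
  shows "vol (ori S) (a # ori F) \<noteq> 0"
proof -
  let ?T = "convex hull (insert a (set (ori F)))"
  have T: "?T \<in> M" "?T \<subseteq> S" "set (ori ?T) = insert a (set (ori F))" "a \<notin> set (ori F)"
    using a by (auto simp: apexes_def)
  have "length (ori ?T) = length (ori S)"
    using length_ori[OF M.KU[OF T(1)]] length_ori[OF M.KU[OF F]] T(3,4) len by simp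
  from vol_ori_nonzero[OF N.KU[OF S] M.KU[OF T(1)] T(2) this] show ?thesis
    using T(3,4) distinct_ori[OF M.KU[OF F]] by simp
qed

lemma apex_same_side:
  assumes S: "S \<in> N" and F: "F \<in> M" "F \<noteq> {}" and len: "length (ori S) = Suc (length (ori F))"
    and a: "a \<in> apexes S F" and b: "b \<in> apexes S F"
    and side: "vol (ori S) (a # ori F) * vol (ori S) (b # ori F) > 0"
  shows "a = b"
proof -
  have "convex hull (insert a (set (ori F))) = convex hull (insert b (set (ori F)))"
    by (rule M.same_side_imp_eq[OF N.KU[OF S] M.KU[OF F(1)] F(2) _ _ _ _ _ _ _ _ len side])
      (use a b in \<open>auto simp: apexes_def\<close>)
  then have "insert a (set (ori F)) = insert b (set (ori F))"
    using a b by (auto simp: apexes_def)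
  then show ?thesis
    using a b by (auto simp: apexes_def)
qed

lemma apex_subset: "a \<in> apexes S F \<Longrightarrow> a \<in> S"
  by (force simp: apexes_def intro: hull_inc)

text \<open>Each side of F has exactly one apex if S extends to that side, and none
  otherwise.\<close>

lemma sum_apexes:
  assumes S: "S \<in> N" and F: "F \<in> M" "F \<subseteq> S" "F \<noteq> {}" and len: "length (ori S) = Suc (length (ori F))"
  shows "(\<Sum>a\<in>apexes S F. sgn (vol (ori S) (a # ori F))) =
    of_bool (\<exists>q\<in>S. vol (ori S) (q # ori F) > 0) - of_bool (\<exists>q\<in>S. vol (ori S) (q # ori F) < 0)"
proof -
  let ?h = "\<lambda>z. vol (ori S) (z # ori F)"
  have card: "real (card {a \<in> apexes S F. c * ?h a > 0}) = of_bool (\<exists>q\<in>S. c * ?h q > 0)" for c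
  proof (cases "\<exists>q\<in>S. c * ?h q > 0")
    case True
    then obtain a where a: "a \<in> apexes S F" "c * ?h a > 0"
      using apex_exists[OF S F] by metis
    have "b = a" if "b \<in> apexes S F" "c * ?h b > 0" for b
    proof (rule apex_same_side[OF S F(1,3) len that(1) a(1)])
      have "c * ?h b * (c * ?h a) > 0"
        using that(2) a(2) by simp
      then have "c\<^sup>2 * (?h b * ?h a) > 0"
        by (simp add: power2_eq_square mult_ac)
      then show "?h b * ?h a > 0"
        by (simp add: zero_less_mult_iff)
    qed
    then have "{a \<in> apexes S F. c * ?h a > 0} = {a}"
      using a by blast
    then show ?thesis
      using True by simp
  next
    case False
    then have "{a \<in> apexes S F. c * ?h a > 0} = {}"
      using apex_subset by blast
    then show ?thesis
      using False by (simp only: card.empty) simp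
  qed
  have "(\<Sum>a\<in>apexes S F. sgn (?h a)) =
      (\<Sum>a\<in>apexes S F. of_bool (1 * ?h a > 0) - of_bool ((-1) * ?h a > 0))"
    by (intro sum.cong refl) (auto simp: sgn_if)
  also have "\<dots> = real (card {a \<in> apexes S F. 1 * ?h a > 0}) - real (card {a \<in> apexes S F. (-1) * ?h a > 0})"
    by (simp add: sum_subtractf finite_apexes Int_def)
  finally show ?thesis
    unfolding card by simp
qed

lemma exists_vol_nonzero:
  assumes S: "S \<in> U" and F: "F \<in> U" "F \<subseteq> S" and len: "length (ori S) = Suc (length (ori F))"
  obtains v where "v \<in> set (ori S)" "vol (ori S) (v # ori F) \<noteq> 0"
proof -
  have "\<not> set (ori S) \<subseteq> affine hull (set (ori F))"
  proof
    assume "set (ori S) \<subseteq> affine hull (set (ori F))"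
    then have "aff_dim (set (ori S)) \<le> aff_dim (affine hull (set (ori F)))"
      by (rule aff_dim_subset)
    then show False
      using aff_dim_affine_independent[OF ori_independent[OF S]]
        aff_dim_affine_independent[OF ori_independent[OF F(1)]] length_ori S F(1) len by simp
  qed
  then obtain v where v: "v \<in> set (ori S)" "v \<notin> affine hull (set (ori F))"
    by blast
  then have vf: "v \<notin> set (ori F)"
    using hull_inc by metis
  have "vol (ori S) (v # ori F) \<noteq> 0"
  proof (rule vol_nonzero)
    show "\<not> affine_dependent (set (v # ori F))"
      using affine_independent_insert[OF ori_independent[OF F(1)] v(2)] by simp
    show "set (v # ori F) \<subseteq> affine hull (set (ori S))"
    proof -
      have "v \<in> affine hull (set (ori S))"
        using v(1) by (rule hull_inc)
      moreover have "set (ori F) \<subseteq> affine hull (set (ori S))"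
        using set_ori_subset[OF F(1)] F(2) subset_affine_hull_ori[OF S] by blast
      ultimately show ?thesis
        by simp
    qed
  qed (use S F len vf ori_independent distinct_ori in auto)
  then show ?thesis
    using that v(1) by blast
qed

abbreviation "del j xs \<equiv> take j xs @ drop (Suc j) xs"

lemma set_del:
  assumes "distinct xs" "j < length xs"
  shows "set (del j xs) = set xs - {xs ! j}"
proof -
  have "distinct (take j xs @ xs ! j # drop (Suc j) xs)"
    unfolding id_take_nth_drop[OF assms(2), symmetric] by (rule assms(1))
  moreover have "set xs = set (take j xs @ xs ! j # drop (Suc j) xs)"
    unfolding id_take_nth_drop[OF assms(2), symmetric] ..
  ultimately show ?thesis
    by auto
qed

text \<open>The chain map property, at one cell F of codimension one in S. If F lies in a facet of
  S, then S is on one side of F and only this facet contributes. If not, S extends to both sides,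
  the two apexes cancel and no facet contributes.\<close>

lemma sum_apexes_eq_faces:
  assumes S: "S \<in> N" and F: "F \<in> M" "F \<subseteq> S" "F \<noteq> {}" and len: "length (ori S) = Suc (length (ori F))"
  shows "(\<Sum>a\<in>apexes S F. sgn (vol (ori S) (a # ori F))) =
    (\<Sum>j<length (ori S). (-1) ^ j *
      (if F \<subseteq> convex hull (set (del j (ori S))) then sgn (vol (del j (ori S)) (ori F)) else 0))"
proof -
  let ?xs = "ori S" and ?f = "ori F" and ?X = "set (ori S)"
  let ?h = "\<lambda>z. vol ?xs (z # ?f)" and ?G = "\<lambda>j. convex hull (set (del j ?xs))"
  have SU: "S \<in> U" and FU: "F \<in> U"
    using S F N_U M_U by auto
  have V: "\<not> affine_dependent ?X" "distinct ?xs"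
    using ori_independent[OF SU] distinct_ori[OF SU] by auto
  have fS: "set ?f \<subseteq> affine hull ?X"
    using set_ori_subset[OF FU] F(2) subset_affine_hull_ori[OF SU] by blast
  have facet: "?h q = (-1) ^ j * bary ?X q (?xs ! j) * vol (del j ?xs) ?f"
    if "j < length ?xs" "F \<subseteq> ?G j" for j q
  proof (rule vol_Cons_facet[OF V that(1)])
    show "set ?f \<subseteq> affine hull set (del j ?xs)"
      using set_ori_subset[OF FU] that(2) convex_hull_subset_affine_hull by blast
  qed
  have vertex: "bary ?X (?xs ! i) (?xs ! j) = (if i = j then 1 else 0)"
    if "i < length ?xs" "j < length ?xs" for i j
    using that bary_vertex[OF V(1), of "?xs ! j" "?xs ! i"] nth_eq_iff_index_eq[OF V(2)] by auto
  have nz: "vol (del j ?xs) ?f \<noteq> 0" if j: "j < length ?xs" "F \<subseteq> ?G j" for j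
  proof -
    obtain v where "?h v \<noteq> 0"
      using exists_vol_nonzero[OF SU FU F(2) len] .
    then show ?thesis
      using facet[OF j, of v] by auto
  qed
  show ?thesis
  proof (cases "\<exists>j<length ?xs. F \<subseteq> ?G j")
    case True
    then obtain j where j: "j < length ?xs" "F \<subseteq> ?G j"
      by blast
    \<comment> \<open>The vertex opposite to facet i belongs to facet j, so the volume vanishes
      there by the formula for j, but not by that for i.\<close>
    have unique: "\<not> F \<subseteq> ?G i" if i: "i < length ?xs" "i \<noteq> j" for i
    proof
      assume Fi: "F \<subseteq> ?G i"
      have "?h (?xs ! i) = 0"
        using facet[OF j, of "?xs ! i"] vertex[OF i(1) j(1)] i(2) by simp
      then show False
        using facet[OF i(1) Fi, of "?xs ! i"] vertex[OF i(1) i(1)] nz[OF i(1) Fi] by simp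
    qed
    let ?v = "(-1) ^ j * vol (del j ?xs) ?f"
    have hq: "?h q = bary ?X q (?xs ! j) * ?v" for q
      using facet[OF j, of q] by (simp add: mult_ac)
    have "?xs ! j \<in> S"
      using j(1) set_ori_subset[OF SU] by auto
    moreover have "?h (?xs ! j) = ?v"
      using hq[of "?xs ! j"] vertex[OF j(1) j(1)] by simp
    moreover have "bary ?X q (?xs ! j) \<ge> 0" if "q \<in> S" for q
      using that j(1) mem_iff_bary[OF SU, of q] by auto
    ultimately have "(\<exists>q\<in>S. ?h q > 0) \<longleftrightarrow> ?v > 0" "(\<exists>q\<in>S. ?h q < 0) \<longleftrightarrow> ?v < 0"
      unfolding hq by (metis zero_less_mult_iff not_le, metis mult_less_0_iff not_le)
    moreover have "of_bool (r > 0) - of_bool (r < 0) = sgn r" for r :: real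
      by (simp add: sgn_if)
    ultimately have "(\<Sum>a\<in>apexes S F. sgn (?h a)) = sgn ?v"
      unfolding sum_apexes[OF S F len] by simp
    also have "\<dots> = (-1) ^ j * sgn (vol (del j ?xs) ?f)"
      by (simp add: sgn_mult)
    also have "\<dots> = (\<Sum>i<length ?xs. if i = j then (-1) ^ j * sgn (vol (del j ?xs) ?f) else 0)"
      using j(1) by simp
    also have "\<dots> = (\<Sum>i<length ?xs. (-1) ^ i *
        (if F \<subseteq> ?G i then sgn (vol (del i ?xs) ?f) else 0))"
      by (intro sum.cong refl) (use j unique in auto)
    finally show ?thesis .
  next
    case False
    obtain x where x: "x \<in> rel_interior F"
      using rel_interior_nonempty[OF FU F(3)] by blast
    then have xF: "x \<in> F" and xf: "x \<in> affine hull (set ?f)" and xS: "x \<in> S"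
      using rel_interior_subset rel_interior_iff[OF FU] F(2) by blast+
    \<comment> \<open>With a coordinate equal to 0, the point x would be in a facet of S, and this
      facet would contain F.\<close>
    have pos: "bary ?X x v > 0" if v: "v \<in> ?X" for v
    proof (rule ccontr)
      assume "\<not> ?thesis"
      then have "bary ?X x v = 0"
        using v xS mem_iff_bary[OF SU, of x] by force
      moreover obtain j where j: "j < length ?xs" "v = ?xs ! j"
        using v unfolding in_set_conv_nth by blast
      ultimately have "x \<in> ?G j"
        unfolding set_del[OF V(2) j(1)] convex_hull_face_iff_bary[OF V(1) Diff_subset]
        using xS hull_ori[OF SU] by auto
      moreover have "?G j \<in> N"
        by (rule N.hull_in_K[OF S set_delete_nth])
      ultimately have "F \<subseteq> ?G j"
        using rel_interior_meets_imp_contained[OF F(1) _ x] by blast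
      then show False
        using False j(1) by blast
    qed
    have xA: "x \<in> affine hull ?X"
      using xS mem_iff_bary[OF SU] by blast
    have "?h (\<Sum>v\<in>?X. bary ?X x v *\<^sub>R v) = (\<Sum>v\<in>?X. bary ?X x v * ?h v)"
      by (rule vol_Cons_affine[OF V(1) sum_bary[OF finite_set xA] finite_set]) (rule hull_inc)
    then have sum0: "(\<Sum>v\<in>?X. bary ?X x v * ?h v) = 0"
      using vol_Cons_eq_0[OF V(1) fS xf] by (simp add: bary_combination[OF finite_set xA])
    obtain v where v: "v \<in> ?X" "?h v \<noteq> 0"
      using exists_vol_nonzero[OF SU FU F(2) len] .
    \<comment> \<open>A sum with positive weights vanishes although some term does not, so both
      signs occur.\<close>
    have both: "\<exists>w\<in>?X. c * ?h w > 0" if c: "c = 1 \<or> c = -1" for c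
    proof (rule ccontr)
      assume "\<not> ?thesis"
      then have "\<forall>w\<in>?X. 0 \<le> - (bary ?X x w * (c * ?h w))"
        using pos by (auto simp: mult_le_0_iff not_less intro: less_imp_le)
      moreover have "(\<Sum>w\<in>?X. - (bary ?X x w * (c * ?h w))) = 0"
        using sum0 by (simp add: sum_negf mult.left_commute flip: sum_distrib_left)
      ultimately have "\<forall>w\<in>?X. - (bary ?X x w * (c * ?h w)) = 0"
        by (subst (asm) sum_nonneg_eq_0_iff) auto
      then show False
        using v pos[OF v(1)] c by auto
    qed
    have "\<exists>q\<in>S. ?h q > 0" "\<exists>q\<in>S. ?h q < 0"
      using both[of 1] both[of "-1"] set_ori_subset[OF SU] by auto
    then have "(\<Sum>a\<in>apexes S F. sgn (?h a)) = 0"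
      unfolding sum_apexes[OF S F len] by simp
    also have "0 = (\<Sum>j<length ?xs. (-1) ^ j * (if F \<subseteq> ?G j then sgn (vol (del j ?xs) ?f) else 0))"
      using False by (simp add: sum.neutral)
    finally show ?thesis .
  qed
qed

text \<open>The image of an ordered simplex under the subdivision map, with signs of volumes in
  place of \<open>compatibly_oriented\<close>, so that it alternates in \<open>xs\<close>.\<close>

definition subd :: "'a list \<Rightarrow> 'a chain" where
  "subd xs = (\<Sum>T | T \<in> cells M (length xs) \<and> T \<subseteq> convex hull (set xs). sgn (vol xs (ori T)) *\<^sub>R bas T)"

lemma alternating_subd: "alternating subd"
  unfolding alternating_def
proof (intro allI)
  fix us vs :: "'a list" and a b
  have "set (us @ a # b # vs) = set (us @ b # a # vs)" "length (us @ a # b # vs) = length (us @ b # a # vs)"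
    by auto
  moreover have "sgn (vol (us @ a # b # vs) ys) = - sgn (vol (us @ b # a # vs) ys)" for ys
    using alternatingD[OF alternating_vol_left[of ys], of us a b vs] by (metis sgn_minus)
  ultimately show "subd (us @ a # b # vs) = - subd (us @ b # a # vs)"
    unfolding subd_def by (simp add: sum_negf)
qed

lemma linear_subdiv_map: "linear (subdiv_map ori M)"
  unfolding subdiv_map_def linear_extension_eq_lin by (rule linear_lin)

lemmas subdiv_map_simps [simp] =
  linear_add[OF linear_subdiv_map] linear_diff[OF linear_subdiv_map] linear_neg[OF linear_subdiv_map]
  linear_scale[OF linear_subdiv_map] linear_0[OF linear_subdiv_map]

lemma finite_cells: "finite (cells M n)"
  using M.finite_K by (simp add: cells_def)

lemma subdiv_map_bas:
  assumes "S \<in> N"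
  shows "subdiv_map ori M (bas S) = subd (ori S)"
proof -
  have SU: "S \<in> U"
    using assms N.KU by blast
  have eq: "{T. T \<in> M \<and> T \<subseteq> S \<and> aff_dim T = aff_dim S} =
      {T. T \<in> cells M (length (ori S)) \<and> T \<subseteq> convex hull (set (ori S))}"
    using aff_dim_ori[OF SU] aff_dim_ori[OF M.KU] hull_ori[OF SU] by (auto simp: cells_def)
  have "subdiv_map ori M (bas S) = (\<Sum>T | T \<in> M \<and> T \<subseteq> S \<and> aff_dim T = aff_dim S.
       if compatibly_oriented (ori S) (ori T) then bas T else - bas T)"
    by (simp add: subdiv_map_def linear_extension_eq_lin)
  also have "\<dots> = subd (ori S)"
    unfolding subd_def eq
  proof (rule sum.cong[OF refl])
    fix T assume "T \<in> {T. T \<in> cells M (length (ori S)) \<and> T \<subseteq> convex hull (set (ori S))}"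
    then have T: "T \<in> M" "T \<subseteq> S" "length (ori T) = length (ori S)"
      using hull_ori[OF SU] by (auto simp: cells_def)
    have TU: "T \<in> U"
      using T(1) M.KU by blast
    have "set (ori T) \<subseteq> affine hull (set (ori S))"
      using set_ori_subset[OF TU] T(2) subset_affine_hull_ori[OF SU] by blast
    from compatibly_oriented_iff_vol[OF ori_independent[OF SU] distinct_ori[OF SU] this T(3)]
    show "(if compatibly_oriented (ori S) (ori T) then bas T else - bas T) =
        sgn (vol (ori S) (ori T)) *\<^sub>R bas T"
      using vol_ori_nonzero[OF SU TU T(2,3) refl distinct_ori[OF TU]] by (auto simp: sgn_if)
  qed
  finally show ?thesis .
qed

lemma subdiv_map_osx:
  assumes "S \<in> N" "set vs \<subseteq> set (ori S)"
  shows "subdiv_map ori M (osx ori vs) = subd vs"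
proof (cases "distinct vs")
  case True
  have SU: "S \<in> U"
    using assms N.KU by blast
  have "subdiv_map ori M (osx ori (us @ a # b # ws)) = - subdiv_map ori M (osx ori (us @ b # a # ws))"
    for us a b ws
    using alternatingD[OF alternating_osx[of ori], of us a b ws] by (metis linear_neg linear_subdiv_map)
  then have f: "alternating (\<lambda>vs. subdiv_map ori M (osx ori vs))"
    unfolding alternating_def by blast
  let ?T = "convex hull (set vs)"
  have "subdiv_map ori M (osx ori (ori ?T)) = subd (ori ?T)"
    using subdiv_map_bas[OF N.hull_in_K[OF assms]] by (simp add: osx_ori[OF hull_in[OF SU assms(2)]])
  from alternating_eq_mset[OF f alternating_subd mset_ori_hull[OF SU assms(2) True] this] show ?thesis .
next
  case False
  then show ?thesis
    by (simp add: alternating_not_distinct[OF alternating_subd] alternating_not_distinct[OF alternating_osx])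
qed

lemma subdiv_map_common:
  assumes "S \<in> N" "S \<in> M"
  shows "subdiv_map ori M (bas S) = bas S"
proof -
  have SU: "S \<in> U"
    using assms N.KU by blast
  have "{T. T \<in> cells M (length (ori S)) \<and> T \<subseteq> convex hull (set (ori S))} = {S}"
    using M.eq_if_subset_length[OF assms(2)] assms(2) hull_ori[OF SU] by (auto simp: cells_def)
  then show ?thesis
    unfolding subdiv_map_bas[OF assms(1)] subd_def
    using vol_refl[OF distinct_ori[OF SU] ori_independent[OF SU]] by simp
qed

lemma lookup_subd:
  "Poly_Mapping.lookup (subd xs) F =
    (if F \<in> cells M (length xs) \<and> F \<subseteq> convex hull (set xs) then sgn (vol xs (ori F)) else 0)"
proof -
  let ?A = "{T. T \<in> cells M (length xs) \<and> T \<subseteq> convex hull (set xs)}"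
  have "finite ?A"
    using finite_cells by simp
  moreover have "Poly_Mapping.lookup (subd xs) F = (\<Sum>T\<in>?A. if T = F then sgn (vol xs (ori T)) else 0)"
    unfolding subd_def lookup_sum by (intro sum.cong refl) (simp add: lookup_single)
  ultimately show ?thesis
    by simp
qed

lemma subd_supp: "subd xs \<in> supp {T \<in> cells M (length xs). T \<subseteq> convex hull (set xs)}"
  by (auto simp: supp_iff lookup_subd)

text \<open>Only cofaces of F inside S contribute; they correspond to the apexes, and
  \<open>vol_incidence\<close> evaluates each contribution.\<close>

lemma lookup_obd_subd:
  assumes S: "S \<in> N" and F: "F \<in> M" "F \<subseteq> S" and len: "length (ori S) = Suc (length (ori F))"
  shows "Poly_Mapping.lookup (obd ori (subd (ori S))) F = (\<Sum>a\<in>apexes S F. sgn (vol (ori S) (a # ori F)))"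
proof -
  let ?A = "{T. T \<in> cells M (length (ori S)) \<and> T \<subseteq> convex hull (set (ori S))}"
  let ?c = "\<lambda>T. sgn (vol (ori S) (ori T)) * Poly_Mapping.lookup (obd ori (bas T)) F"
  let ?T = "\<lambda>a. convex hull (insert a (set (ori F)))"
  have SU: "S \<in> U" and FU: "F \<in> U"
    using S F N_U M_U by auto
  have fin: "finite ?A"
    using finite_cells by simp
  have "Poly_Mapping.lookup (obd ori (subd (ori S))) F = (\<Sum>T\<in>?A. ?c T)"
    unfolding subd_def linear_sum[OF linear_obd] lookup_sum by simp
  also have "\<dots> = (\<Sum>T\<in>?T ` apexes S F. ?c T)"
  proof (rule sum.mono_neutral_right[OF fin])
    show "?T ` apexes S F \<subseteq> ?A"
    proof
      fix T assume "T \<in> ?T ` apexes S F"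
      then obtain a where a: "T \<in> M" "T \<subseteq> S" "set (ori T) = insert a (set (ori F))" "a \<notin> set (ori F)"
        by (auto simp: apexes_def)
      then have "length (ori T) = length (ori S)"
        using length_ori[OF M.KU[OF a(1)]] length_ori[OF FU] len by simp
      then show "T \<in> ?A"
        using a hull_ori[OF SU] by (simp add: cells_def)
    qed
    show "\<forall>T\<in>?A - ?T ` apexes S F. ?c T = 0"
    proof
      fix T assume T: "T \<in> ?A - ?T ` apexes S F"
      then have T': "T \<in> M" "T \<subseteq> S" "T \<in> U"
        using hull_ori[OF SU] M_U by (auto simp: cells_def)
      have "Poly_Mapping.lookup (obd ori (bas T)) F = 0"
      proof (rule ccontr)
        assume "Poly_Mapping.lookup (obd ori (bas T)) F \<noteq> 0"
        then have *: "set (ori F) \<subseteq> set (ori T)" "Suc (length (ori F)) = length (ori T)"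
          using obd_bas_supp[OF T'(3)] by (auto simp: supp_iff)
        then have "card (set (ori T) - set (ori F)) = 1"
          using length_ori[OF T'(3)] length_ori[OF FU] by (simp add: card_Diff_subset)
        then obtain a where "set (ori T) - set (ori F) = {a}"
          using card_1_singletonE by blast
        then have a: "set (ori T) = insert a (set (ori F))" "a \<notin> set (ori F)"
          using *(1) by blast+
        then have "T \<in> ?T ` apexes S F"
          using apexI[OF T'(1,2) a] by blast
        then show False
          using T by blast
      qed
      then show "?c T = 0"
        by simp
    qed
  qed
  also have "\<dots> = (\<Sum>a\<in>apexes S F. ?c (?T a))"
  proof (rule sum.reindex_cong[OF _ refl refl])
    show "inj_on ?T (apexes S F)"
    proof (rule inj_onI)
      fix a b assume ab: "a \<in> apexes S F" "b \<in> apexes S F" "?T a = ?T b"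
      then have "insert a (set (ori F)) = insert b (set (ori F))"
        by (auto simp: apexes_def)
      then show "a = b"
        using ab by (auto simp: apexes_def)
    qed
  qed
  also have "\<dots> = (\<Sum>a\<in>apexes S F. sgn (vol (ori S) (a # ori F)))"
  proof (rule sum.cong[OF refl])
    fix a assume a: "a \<in> apexes S F"
    have T: "?T a \<in> M" "?T a \<subseteq> S" "set (ori (?T a)) = insert a (set (ori F))" "a \<notin> set (ori F)"
      using a by (auto simp: apexes_def)
    have "length (ori (?T a)) = length (ori S)"
      using length_ori[OF M.KU[OF T(1)]] length_ori[OF FU] T(3,4) len by simp
    from vol_ori_nonzero[OF SU M.KU[OF T(1)] T(2) this refl distinct_ori[OF M.KU[OF T(1)]]]
    show "?c (?T a) = sgn (vol (ori S) (a # ori F))"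
      by (rule vol_incidence[OF M.KU[OF T(1)] FU T(3,4)])
  qed
  finally show ?thesis .
qed

lemma obd_subdiv_map_bas:
  assumes S: "S \<in> N"
  shows "obd ori (subdiv_map ori M (bas S)) = subdiv_map ori M (obd ori (bas S))"
proof -
  have SU: "S \<in> U"
    using S N.KU by blast
  \<comment> \<open>The argument with sides starts at a relative interior point of a face, which
    must therefore be nonempty; simplices with at most one vertex are treated apart.\<close>
  consider "ori S = []" | v where "ori S = [v]" | "length (ori S) \<ge> 2"
    by (cases "ori S"; cases "tl (ori S)") auto
  then show ?thesis
  proof cases
    case 1
    have "obd ori (subd (ori S)) = 0"
    proof (rule obd_cells_0[OF M_U])
      show "subd (ori S) \<in> supp (cells M 0)"
        using subd_supp[of "ori S"] 1 by (auto simp: supp_def)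
    qed
    then show ?thesis
      by (simp add: subdiv_map_bas[OF S] obd_bas 1)
  next
    case (2 v)
    then have Sv: "S = {v}"
      using hull_ori[OF SU] by simp
    obtain T where T: "T \<in> M" "T \<subseteq> S" "v \<in> rel_interior T"
      using cover[OF S, of v] Sv by auto
    have "T = S"
      using T(2,3) Sv rel_interior_subset by blast
    then have "S \<in> M"
      using T(1) by simp
    have "{} \<in> N" "{} \<in> M"
      using N.hull_in_K[OF S, of "{}"] M.hull_in_K[OF T(1), of "{}"] by auto
    moreover have "osx ori [] = bas {}"
      using osx_ori[OF N.KU[OF \<open>{} \<in> N\<close>]] set_ori_hull[OF SU, of "{}"] by simp
    ultimately show ?thesis
      using subdiv_map_common[OF S \<open>S \<in> M\<close>] subdiv_map_common[OF \<open>{} \<in> N\<close> \<open>{} \<in> M\<close>]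
      by (simp add: obd_bas 2)
  next
    case 3
    obtain m where m: "length (ori S) = Suc m" "m \<noteq> 0"
      using 3 by (cases "length (ori S)") auto
    have rhs: "subdiv_map ori M (obd ori (bas S)) =
        (\<Sum>j<length (ori S). (-1) ^ j *\<^sub>R subd (del j (ori S)))"
      unfolding obd_bas tuple_bd_sum lin_sum linear_sum[OF linear_subdiv_map]
      by (intro sum.cong refl) (simp add: subdiv_map_osx[OF S set_delete_nth])
    have len: "length (del j (ori S)) = m" if "j < length (ori S)" for j
      using that m by simp
    have hull_del: "convex hull set (del j (ori S)) \<subseteq> S" for j
      using hull_mono[OF set_delete_nth, of convex j "ori S"] hull_ori[OF SU] by simp
    show ?thesis
    proof (rule poly_mapping_eqI)
      fix F
      show "Poly_Mapping.lookup (obd ori (subdiv_map ori M (bas S))) F =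
          Poly_Mapping.lookup (subdiv_map ori M (obd ori (bas S))) F"
      proof (cases "F \<in> cells M m \<and> F \<subseteq> S")
        case True
        then have F: "F \<in> M" "F \<subseteq> S" "length (ori S) = Suc (length (ori F))"
          using m by (auto simp: cells_def)
        have "F \<noteq> {}"
          using True m(2) set_ori_subset[OF M.KU[OF F(1)]] by (auto simp: cells_def)
        have "Poly_Mapping.lookup (obd ori (subdiv_map ori M (bas S))) F =
            (\<Sum>j<length (ori S). (-1) ^ j *
              (if F \<subseteq> convex hull (set (del j (ori S))) then sgn (vol (del j (ori S)) (ori F)) else 0))"
          unfolding subdiv_map_bas[OF S] lookup_obd_subd[OF S F]
          by (rule sum_apexes_eq_faces[OF S F(1,2) \<open>F \<noteq> {}\<close> F(3)])
        also have "\<dots> = Poly_Mapping.lookup (subdiv_map ori M (obd ori (bas S))) F"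
          unfolding rhs lookup_sum lookup_scaleR lookup_subd
          by (intro sum.cong refl) (use True len in auto)
        finally show ?thesis .
      next
        case False
        have "subd (ori S) \<in> supp (cells {T \<in> M. T \<subseteq> S} (Suc m))"
          using subd_supp[of "ori S"] hull_ori[OF SU] m by (auto simp: supp_def cells_def)
        moreover have "face_closed {T \<in> M. T \<subseteq> S}"
        proof -
          have "convex hull A \<subseteq> S" if "T \<in> M" "T \<subseteq> S" "A \<subseteq> set (ori T)" for T A
            using hull_mono[OF that(3), of convex] hull_ori[OF M.KU[OF that(1)]] that(2) by auto
          then show ?thesis
            using M.face_closed_K by (auto simp: face_closed_def)
        qed
        ultimately have "obd ori (subd (ori S)) \<in> supp (cells {T \<in> M. T \<subseteq> S} m)"
          using obd_cells by blast
        then have "Poly_Mapping.lookup (obd ori (subdiv_map ori M (bas S))) F = 0"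
          using False by (auto simp: subdiv_map_bas[OF S] supp_iff cells_def)
        moreover have "Poly_Mapping.lookup (subdiv_map ori M (obd ori (bas S))) F = 0"
          unfolding rhs lookup_sum lookup_scaleR lookup_subd
        proof (intro sum.neutral ballI)
          fix j assume "j \<in> {..<length (ori S)}"
          then have *: "\<not> (F \<in> cells M (length (del j (ori S))) \<and> F \<subseteq> convex hull set (del j (ori S)))"
            using False hull_del[of j] len[of j] order_trans[of F _ S] by (metis lessThan_iff)
          show "(-1) ^ j * (if F \<in> cells M (length (del j (ori S))) \<and> F \<subseteq> convex hull set (del j (ori S))
              then sgn (vol (del j (ori S)) (ori F)) else 0) = 0"
            unfolding if_not_P[OF *] by simp
        qed
        ultimately show ?thesis
          by simp
      qed
    qed
  qed
qed

lemma obd_subdiv_map: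
  assumes "c \<in> supp N"
  shows "obd ori (subdiv_map ori M c) = subdiv_map ori M (obd ori c)"
proof -
  have "linear (\<lambda>c. obd ori (subdiv_map ori M c))" "linear (\<lambda>c. subdiv_map ori M (obd ori c))"
    using linear_compose[OF linear_subdiv_map linear_obd] linear_compose[OF linear_obd linear_subdiv_map]
    by (simp_all add: o_def)
  then have "obd ori (subdiv_map ori M c) = lin (\<lambda>S. obd ori (subdiv_map ori M (bas S))) c"
    "subdiv_map ori M (obd ori c) = lin (\<lambda>S. subdiv_map ori M (obd ori (bas S))) c"
    by (auto dest: linear_eq_lin)
  moreover have "lin (\<lambda>S. obd ori (subdiv_map ori M (bas S))) c =
      lin (\<lambda>S. subdiv_map ori M (obd ori (bas S))) c"
    by (rule lin_cong_supp[OF assms]) (rule obd_subdiv_map_bas)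
  ultimately show ?thesis
    by simp
qed

lemma subdiv_map_cells:
  assumes "c \<in> supp (cells N n)"
  shows "subdiv_map ori M c \<in> supp (cells M n)"
proof -
  have "subdiv_map ori M c = lin (\<lambda>S. subdiv_map ori M (bas S)) c"
    by (rule linear_eq_lin[OF linear_subdiv_map])
  also have "\<dots> \<in> supp (cells M n)"
  proof (rule lin_in_supp[OF assms _ subspace_supp])
    fix S assume S: "S \<in> cells N n"
    then show "subdiv_map ori M (bas S) \<in> supp (cells M n)"
      using subd_supp[of "ori S"] by (auto simp: subdiv_map_bas cells_def supp_def)
  qed
  finally show ?thesis .
qed

end

subsection \<open>Small tuples in a convex set\<close>

text \<open>Simplices of the Vietoris-Rips complex of P at scale \<delta>, ordered and with
  repetitions allowed; they play the role of small singular simplices.\<close>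

definition small :: "'a::metric_space set \<Rightarrow> real \<Rightarrow> nat \<Rightarrow> 'a list set" where
  "small P \<delta> n = {ps. length ps = n \<and> set ps \<subseteq> P \<and> (\<forall>x\<in>set ps. \<forall>y\<in>set ps. dist x y < \<delta>)}"

lemma small_mono: "P \<subseteq> Q \<Longrightarrow> \<delta> \<le> \<epsilon> \<Longrightarrow> small P \<delta> n \<subseteq> small Q \<epsilon> n"
  unfolding small_def by force

lemma prism_supp:
  "prism f g ps \<in> supp {qs. length qs = Suc (length ps) \<and> set qs \<subseteq> f ` set ps \<union> g ` set ps}"
proof (induction ps)
  case (Cons p ps)
  have "tcone (f p) (prism f g ps) \<in>
      supp {qs. length qs = Suc (length (p # ps)) \<and> set qs \<subseteq> f ` set (p # ps) \<union> g ` set (p # ps)}"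
    by (rule tcone_in_supp[OF Cons]) auto
  then show ?case
    by (auto intro!: supp_intros)
qed (simp add: supp_intros)

text \<open>The straight-line contraction to a point, cut into steps so short that the prisms over small
  tuples stay small; no subdivision of the tuples is needed.\<close>

lemma small_cycle_bounds:
  fixes P :: "'a::euclidean_space set"
  assumes P: "convex P" "bounded P" "b \<in> P" and \<delta>: "0 < \<delta>" "\<delta> < \<epsilon>"
    and c: "c \<in> supp (small P \<delta> n)" "lin tuple_bd c = 0"
  obtains w where "w \<in> supp (small P \<epsilon> (Suc n))" "lin tuple_bd w = c"
proof -
  obtain D where D: "\<And>p. p \<in> P \<Longrightarrow> dist b p \<le> D"
    using P(2) bounded_any_center[of P b] by blast
  \<comment> \<open>D bounds the distances to b. In m steps each point moves by at most D / m at a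
    time, and \<delta> + D / m < \<epsilon>.\<close>
  obtain m :: nat where m: "D / (\<epsilon> - \<delta>) < real m"
    using reals_Archimedean2 by blast
  have D0: "D \<ge> 0"
    using D[OF P(3)] by simp
  then have "0 \<le> D / (\<epsilon> - \<delta>)"
    using \<delta> by simp
  then have m0: "real m > 0"
    using m by linarith
  have Dm: "D / real m < \<epsilon> - \<delta>"
    using m m0 \<delta> by (simp add: field_simps)
  define f where "f j p = p + (real j / real m) *\<^sub>R (b - p)" for j p
  have fP: "f j p \<in> P" if "p \<in> P" "j \<le> m" for j p
  proof -
    have "(1 - real j / real m) *\<^sub>R p + (real j / real m) *\<^sub>R b \<in> P"
      using that m0 by (intro convexD_alt[OF P(1) _ P(3)]) auto
    then show ?thesis
      by (simp add: f_def algebra_simps)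
  qed
  have contract: "dist (f j p) (f j q) \<le> dist p q" if "j \<le> m" for j p q
  proof -
    have "f j p - f j q = (1 - real j / real m) *\<^sub>R (p - q)"
      by (simp add: f_def algebra_simps)
    then have "dist (f j p) (f j q) = (1 - real j / real m) * dist p q"
      using that m0 by (simp add: dist_norm)
    also have "\<dots> \<le> 1 * dist p q"
      using m0 by (intro mult_right_mono) auto
    finally show ?thesis
      by simp
  qed
  have step: "dist (f j p) (f (Suc j) p) \<le> D / real m" if "p \<in> P" for j p
  proof -
    have "f (Suc j) p - f j p = (1 / real m) *\<^sub>R (b - p)"
      by (simp add: f_def algebra_simps add_divide_distrib)
    then have "dist (f (Suc j) p) (f j p) = (1 / real m) * dist b p"
      by (simp add: dist_norm)
    also have "\<dots> \<le> (1 / real m) * D"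
      using D[OF that] by (intro mult_left_mono) auto
    finally show ?thesis
      by (simp add: dist_commute)
  qed
  let ?h = "\<lambda>j. lin (prism (f j) (f (Suc j))) c"
  have h: "?h j \<in> supp (small P \<epsilon> (Suc n))" if j: "j < m" for j
  proof (rule lin_in_supp[OF c(1) _ subspace_supp])
    fix ps assume ps: "ps \<in> small P \<delta> n"
    let ?A = "f j ` set ps \<union> f (Suc j) ` set ps"
    have cross: "dist (f j p) (f (Suc j) q) < \<epsilon>" if "p \<in> set ps" "q \<in> set ps" for p q
    proof -
      have "dist (f j p) (f (Suc j) q) \<le> dist (f j p) (f j q) + dist (f j q) (f (Suc j) q)"
        by (rule dist_triangle)
      also have "\<dots> \<le> dist p q + D / real m"
        using contract[of j p q] step[of q j] j that ps by (intro add_mono) (auto simp: small_def)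
      also have "\<dots> < \<epsilon>"
        using Dm that ps by (force simp: small_def)
      finally show ?thesis .
    qed
    have same: "dist (f i p) (f i q) < \<epsilon>" if "p \<in> set ps" "q \<in> set ps" "i \<le> m" for i p q
    proof -
      have "dist p q < \<delta>"
        using that ps by (auto simp: small_def)
      then show ?thesis
        using contract[OF that(3), of p q] \<delta> by linarith
    qed
    have "dist x y < \<epsilon>" if "x \<in> ?A" "y \<in> ?A" for x y
      using that cross same j by (auto simp: dist_commute)
    moreover have "?A \<subseteq> P"
      using fP ps j by (auto simp: small_def)
    ultimately have "{qs. length qs = Suc (length ps) \<and> set qs \<subseteq> ?A} \<subseteq> small P \<epsilon> (Suc n)"
      using ps by (auto simp: small_def subset_iff)
    then show "prism (f j) (f (Suc j)) ps \<in> supp (small P \<epsilon> (Suc n))"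
      using prism_supp[of "f j" "f (Suc j)" ps] supp_mono by blast
  qed
  have bd: "lin tuple_bd (?h j) = tuple_map (f (Suc j)) c - tuple_map (f j) c" for j
    using tuple_bd_prism_chain[of "f j" "f (Suc j)" c] c(2) by simp
  have "(\<Sum>j<m. lin tuple_bd (?h j)) = tuple_map (f m) c - tuple_map (f 0) c"
    unfolding bd by (rule sum_lessThan_telescope)
  moreover have "f 0 = (\<lambda>p. p)"
    by (simp add: f_def fun_eq_iff)
  then have "tuple_map (f 0) c = c"
    by (simp add: tuple_map_def)
  ultimately have tel: "lin tuple_bd (\<Sum>j<m. ?h j) = tuple_map (f m) c - c"
    by (simp add: lin_sum)
  \<comment> \<open>At the end of the contraction all entries equal b, and this cycle is filled by
    the cone with apex b.\<close>
  let ?x = "tuple_map (f m) c"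
  have fm: "f m p = b" for p
    using m0 by (simp add: f_def)
  have "lin tuple_bd (tcone b ?x) = ?x"
    by (simp add: tuple_bd_cone tuple_bd_tuple_map c(2) linear_0[OF linear_tuple_map])
  moreover have "tcone b ?x \<in> supp (small P \<epsilon> (Suc n))"
  proof (rule tcone_in_supp)
    show "?x \<in> supp {qs. length qs = n \<and> set qs \<subseteq> {b}}"
      unfolding tuple_map_def
      by (rule lin_in_supp[OF c(1) _ subspace_supp]) (auto simp: fm small_def)
    show "b # xs \<in> small P \<epsilon> (Suc n)" if xs: "xs \<in> {qs. length qs = n \<and> set qs \<subseteq> {b}}" for xs
    proof -
      have "x = b" if "x \<in> set (b # xs)" for x
        using that xs by auto
      then have "dist x y < \<epsilon>" if "x \<in> set (b # xs)" "y \<in> set (b # xs)" for x y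
        using that \<delta> by (metis dist_self less_trans)
      then show ?thesis
        using xs P(3) unfolding small_def by auto
    qed
  qed
  ultimately show ?thesis
    using that[of "tcone b ?x - (\<Sum>j<m. ?h j)"] tel h by (auto intro!: supp_intros)
qed

subsection \<open>Acyclic carriers\<close>

context oriented
begin

text \<open>One induction for two purposes: with \<open>e = 0\<close> and \<sigma> = 1 it builds a
  chain map, with \<sigma> = -1 a chain homotopy. The value on S is chosen in
  \<open>\<Phi> S\<close>, the cycle to be filled lies in \<open>\<Psi> S\<close>; they are separate
  because filling may raise the degree or the mesh.\<close>

lemma carrier_extension:
  fixes D :: "'z::real_vector \<Rightarrow> 'z"
  assumes K: "face_closed K" "finite K" and D: "linear D"
    and sub: "\<And>S. S \<in> K \<Longrightarrow> subspace (\<Psi> S)"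
    and facet: "\<And>S F. S \<in> K \<Longrightarrow> F \<in> K \<Longrightarrow> set (ori F) \<subseteq> set (ori S) \<Longrightarrow>
      Suc (length (ori F)) = length (ori S) \<Longrightarrow> \<Phi> F \<subseteq> \<Psi> S"
    and acyclic: "\<And>S c. S \<in> K \<Longrightarrow> ori S \<noteq> [] \<Longrightarrow> c \<in> \<Psi> S \<Longrightarrow> D c = 0 \<Longrightarrow> \<exists>w\<in>\<Phi> S. D w = c"
    and e: "\<And>S. S \<in> K \<Longrightarrow> ori S \<noteq> [] \<Longrightarrow> e S \<in> \<Psi> S"
      "\<And>S. S \<in> K \<Longrightarrow> ori S \<noteq> [] \<Longrightarrow> D (e S) = - (\<sigma> *\<^sub>R lin e (obd ori (bas S)))"
    and base: "base \<in> \<Phi> {}" "D base = e {}"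
  obtains h where "h {} = base" "\<And>S. S \<in> K \<Longrightarrow> h S \<in> \<Phi> S"
    "\<And>S. S \<in> K \<Longrightarrow> D (h S) = e S + \<sigma> *\<^sub>R lin h (obd ori (bas S))"
proof -
  have KU: "S \<in> U" if "S \<in> K" for S
    using K(1) that by (auto simp: face_closed_def)
  have empty: "S = {}" if "S \<in> K" "ori S = []" for S
    using hull_ori[OF KU[OF that(1)]] that(2) by simp
  have bd_supp: "obd ori (bas S) \<in> supp {F \<in> K. set (ori F) \<subseteq> set (ori S) \<and> Suc (length (ori F)) = length (ori S)}"
    if S: "S \<in> K" for S
  proof -
    have "F \<in> K" if "F \<in> U" "set (ori F) \<subseteq> set (ori S)" for F
      using that K(1) S hull_ori[OF that(1)] by (metis face_closed_def)
    then have "{F \<in> U. set (ori F) \<subseteq> set (ori S) \<and> Suc (length (ori F)) = length (ori S)} \<subseteq>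
        {F \<in> K. set (ori F) \<subseteq> set (ori S) \<and> Suc (length (ori F)) = length (ori S)}"
      by blast
    then show ?thesis
      using obd_bas_supp[OF KU[OF S]] supp_mono by blast
  qed
  have "\<exists>h. h {} = base \<and> (\<forall>S\<in>K. length (ori S) \<le> n \<longrightarrow>
      h S \<in> \<Phi> S \<and> D (h S) = e S + \<sigma> *\<^sub>R lin h (obd ori (bas S)))" for n
  proof (induction n)
    case 0
    have "base \<in> \<Phi> S \<and> D base = e S + \<sigma> *\<^sub>R lin (\<lambda>S. base) (obd ori (bas S))"
      if "S \<in> K" "ori S = []" for S
      using empty[OF that] base that(2) by (simp add: obd_bas)
    then show ?case
      by (intro exI[of _ "\<lambda>S. base"]) simp
  next
    case (Suc n)
    then obtain h where h: "h {} = base" "\<And>S. S \<in> K \<Longrightarrow> length (ori S) \<le> n \<Longrightarrow> h S \<in> \<Phi> S"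
      "\<And>S. S \<in> K \<Longrightarrow> length (ori S) \<le> n \<Longrightarrow> D (h S) = e S + \<sigma> *\<^sub>R lin h (obd ori (bas S))"
      by blast
    have ex: "\<exists>w\<in>\<Phi> S. D w = e S + \<sigma> *\<^sub>R lin h (obd ori (bas S))"
      if S: "S \<in> K" "length (ori S) = Suc n" for S
    proof (rule acyclic[OF S(1)])
      let ?b = "obd ori (bas S)"
      show ne: "ori S \<noteq> []"
        using S(2) by auto
      have "lin h ?b \<in> \<Psi> S"
      proof (rule lin_in_supp[OF bd_supp[OF S(1)] _ sub[OF S(1)]])
        fix F assume F: "F \<in> {F \<in> K. set (ori F) \<subseteq> set (ori S) \<and> Suc (length (ori F)) = length (ori S)}"
        then have "h F \<in> \<Phi> F"
          using S(2) by (intro h(2)) auto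
        then show "h F \<in> \<Psi> S"
          using facet[OF S(1), of F] F by blast
      qed
      then show "e S + \<sigma> *\<^sub>R lin h ?b \<in> \<Psi> S"
        using e(1)[OF S(1) ne] sub[OF S(1)] by (intro subspace_add subspace_scale) auto
      \<comment> \<open>The chain to be filled is a cycle: D applied to h(\<partial>S) gives
        e(\<partial>S), as the other term contains \<partial>\<partial>S = 0, and the assumption on
        \<open>D (e S)\<close> cancels this.\<close>
      have "D (lin h ?b) = lin (\<lambda>F. D (h F)) ?b"
        by (rule linear_lin_comp[OF D])
      also have "\<dots> = lin (\<lambda>F. e F + \<sigma> *\<^sub>R lin h (obd ori (bas F))) ?b"
        by (rule lin_cong_supp[OF bd_supp[OF S(1)]], rule h(3)) (use S(2) in auto)
      also have "\<dots> = lin e ?b + \<sigma> *\<^sub>R lin h (lin (\<lambda>F. obd ori (bas F)) ?b)"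
        using linear_lin_comp[OF linear_compose_scale_right[OF linear_lin], of \<sigma> h "\<lambda>F. obd ori (bas F)" ?b]
        by (simp add: lin_add_fun)
      also have "lin (\<lambda>F. obd ori (bas F)) ?b = obd ori ?b"
        by (rule linear_eq_lin[OF linear_obd, symmetric])
      also have "\<dots> = 0"
        using KU[OF S(1)] by (intro obd_obd) simp
      finally show "D (e S + \<sigma> *\<^sub>R lin h ?b) = 0"
        using e(2)[OF S(1) ne] by (simp add: linear_add[OF D] linear_scale[OF D])
    qed
    \<comment> \<open>Values change on simplices with n + 1 vertices only. The boundaries of
      simplices of up to this size involve fewer vertices, so the earlier equations survive.\<close>
    define h' where "h' S = (if length (ori S) = Suc n \<and> S \<in> K
      then SOME w. w \<in> \<Phi> S \<and> D w = e S + \<sigma> *\<^sub>R lin h (obd ori (bas S)) else h S)" for S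
    have h'h: "h' S = h S" if "length (ori S) \<noteq> Suc n" for S
      using that by (simp add: h'_def)
    have bd_eq: "lin h' (obd ori (bas S)) = lin h (obd ori (bas S))" if "S \<in> K" "length (ori S) \<le> Suc n" for S
      by (rule lin_cong_supp[OF bd_supp[OF that(1)]], rule h'h) (use that in auto)
    have "h' S \<in> \<Phi> S \<and> D (h' S) = e S + \<sigma> *\<^sub>R lin h' (obd ori (bas S))"
      if S: "S \<in> K" "length (ori S) \<le> Suc n" for S
    proof (cases "length (ori S) = Suc n")
      case True
      have "h' S \<in> \<Phi> S \<and> D (h' S) = e S + \<sigma> *\<^sub>R lin h (obd ori (bas S))"
        using someI_ex[OF ex[OF S(1) True, unfolded Bex_def]] True S(1) by (simp add: h'_def)
      then show ?thesis
        using bd_eq[OF S] by simp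
    next
      case False
      then show ?thesis
        using h(2,3)[OF S(1)] bd_eq[OF S] h'h[OF False] S(2) by simp
    qed
    moreover have "h' {} = base"
    proof -
      have "length (ori {}) \<noteq> Suc n \<or> {} \<notin> K"
        using set_ori_subset[OF KU, of "{}"] by force
      then show ?thesis
        using h(1) by (auto simp: h'_def)
    qed
    ultimately show ?case
      by blast
  qed
  moreover have "length (ori S) \<le> (\<Sum>S\<in>K. length (ori S))" if "S \<in> K" for S
    using that K(2) by (intro member_le_sum) auto
  ultimately show ?thesis
    using that by meson
qed

lemma osx_faces:
  assumes "S \<in> U" "set vs \<subseteq> set (ori S)"
  shows "osx ori vs \<in> supp {F \<in> cells U (length vs). set (ori F) \<subseteq> set (ori S)}"
  by (rule subsetD[OF supp_mono osx_supp]) (use hull_in[OF assms] assms(2) in \<open>auto simp: cells_def\<close>)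

text \<open>The cone from a vertex v of S fills cycles. A face that already contains v is sent to 0,
  since \<open>osx\<close> vanishes on a list with a repetition.\<close>

lemma simplex_cycle_bounds:
  assumes S: "S \<in> U" "ori S \<noteq> []"
    and c: "c \<in> supp {F \<in> cells U n. set (ori F) \<subseteq> set (ori S)}" "obd ori c = 0"
  shows "\<exists>w\<in>supp {F \<in> cells U (Suc n). set (ori F) \<subseteq> set (ori S)}. obd ori w = c"
proof -
  let ?v = "hd (ori S)"
  let ?k = "lin (\<lambda>F. osx ori (?v # ori F))"
  have v: "?v \<in> set (ori S)"
    using S(2) by simp
  have k: "?k (osx ori g) = osx ori (?v # g)" if g: "set g \<subseteq> set (ori S)" for g
  proof (cases "distinct g")
    case True
    let ?G = "convex hull (set g)"
    have "?k (osx ori (us @ a # b # ws)) = - ?k (osx ori (us @ b # a # ws))" for us a b ws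
      using alternatingD[OF alternating_osx[of ori], of us a b ws] by (metis linear_neg linear_lin)
    then have "alternating (\<lambda>g. ?k (osx ori g))"
      unfolding alternating_def by blast
    moreover have "?k (osx ori (ori ?G)) = osx ori (?v # ori ?G)"
      by (simp add: osx_ori[OF hull_in[OF S(1) g]])
    ultimately show ?thesis
      using alternating_eq_mset[OF _ alternating_Cons[OF alternating_osx] mset_ori_hull[OF S(1) g True]]
      by blast
  next
    case False
    then show ?thesis
      by (simp add: alternating_not_distinct[OF alternating_osx])
  qed
  have "obd ori (?k (bas F)) = bas F - ?k (obd ori (bas F))"
    if F: "F \<in> U" "set (ori F) \<subseteq> set (ori S)" for F
  proof -
    have "obd ori (?k (bas F)) = lin (osx ori) (tuple_bd (?v # ori F))"
      using obd_osx[OF S(1), of "?v # ori F"] v F(2) by simp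
    also have "\<dots> = bas F - lin (\<lambda>g. osx ori (?v # g)) (tuple_bd (ori F))"
      by (simp add: lin_tcone osx_ori[OF F(1)])
    also have "lin (\<lambda>g. osx ori (?v # g)) (tuple_bd (ori F)) = lin (\<lambda>g. ?k (osx ori g)) (tuple_bd (ori F))"
      by (rule lin_cong_supp[OF tuple_bd_supp_ori[OF F(1)]], rule k[symmetric]) (use F(2) in auto)
    also have "\<dots> = ?k (obd ori (bas F))"
      unfolding obd_bas by (rule lin_lin[symmetric])
    finally show ?thesis .
  qed
  note * = this
  have "obd ori (?k c) = lin (\<lambda>F. obd ori (?k (bas F))) c"
    by (simp add: linear_lin_comp[OF linear_obd])
  also have "\<dots> = lin (\<lambda>F. bas F - ?k (obd ori (bas F))) c"
    by (rule lin_cong_supp[OF c(1)], rule *) (auto simp: cells_def)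
  also have "\<dots> = c - ?k (lin (\<lambda>F. obd ori (bas F)) c)"
    by (simp only: lin_diff_fun lin_bas_id lin_lin)
  also have "lin (\<lambda>F. obd ori (bas F)) c = obd ori c"
    by (rule linear_eq_lin[OF linear_obd, symmetric])
  finally have "obd ori (?k c) = c"
    using c(2) by simp
  moreover have "?k c \<in> supp {F \<in> cells U (Suc n). set (ori F) \<subseteq> set (ori S)}"
  proof (rule lin_in_supp[OF c(1) _ subspace_supp])
    fix F assume F: "F \<in> {F \<in> cells U n. set (ori F) \<subseteq> set (ori S)}"
    then show "osx ori (?v # ori F) \<in> supp {F \<in> cells U (Suc n). set (ori F) \<subseteq> set (ori S)}"
      using osx_faces[OF S(1), of "?v # ori F"] v by (auto simp: cells_def)
  qed
  ultimately show ?thesis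
    by blast
qed

end

context oriented_complex
begin

text \<open>The open stars of the vertices cover the compact polyhedron, with a Lebesgue number
  \<epsilon>; p is labelled by a vertex whose star contains the \<epsilon>-ball around p. Points
  close to a point of T then have labels among the vertices of T.\<close>

lemma star_labelling:
  obtains l :: "'a \<Rightarrow> 'a" and \<epsilon> where "\<epsilon> > 0"
    "\<And>T p. T \<in> K \<Longrightarrow> p \<in> T \<Longrightarrow> l p \<in> set (ori T)"
    "\<And>T p q. T \<in> K \<Longrightarrow> p \<in> T \<Longrightarrow> q \<in> \<Union>K \<Longrightarrow> dist q p < \<epsilon> \<Longrightarrow> l q \<in> set (ori T)"
proof -
  \<comment> \<open>The open star of v together with everything outside the polyhedron, which makes
    it open in the whole space.\<close>
  define st where "st v = - \<Union>{T \<in> K. v \<notin> set (ori T)}" for v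
  have "compact (\<Union>K)"
    using finite_K compact_U KU by (intro compact_Union) auto
  moreover have "\<Union>K \<subseteq> \<Union>(range st)"
  proof
    fix p assume "p \<in> \<Union>K"
    then obtain S where "S \<in> K" "p \<in> S"
      by blast
    then obtain F where F: "F \<in> K" "p \<in> rel_interior F"
      using mem_rel_interior_in_K by metis
    have "F \<noteq> {}"
      using F(2) rel_interior_subset by blast
    then obtain v where v: "v \<in> set (ori F)"
      using hull_ori[OF KU[OF F(1)]] by (cases "ori F") auto
    have "v \<in> set (ori T)" if "T \<in> K" "p \<in> T" for T
      using subset_imp_set_ori_subset[OF that(1) F(1) rel_interior_meets_imp_subset[OF F(1) that(1) F(2) that(2)]] v
      by blast
    then show "p \<in> \<Union>(range st)"
      by (auto simp: st_def)
  qed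
  moreover have "open G" if G: "G \<in> range st" for G
  proof -
    obtain v where "G = st v"
      using G by blast
    moreover have "closed (\<Union>{T \<in> K. v \<notin> set (ori T)})"
      using finite_K compact_U KU by (intro closed_Union) (auto intro: compact_imp_closed)
    ultimately show ?thesis
      by (simp add: st_def open_Compl)
  qed
  ultimately obtain \<epsilon> where \<epsilon>: "0 < \<epsilon>" "\<And>x. x \<in> \<Union>K \<Longrightarrow> \<exists>G\<in>range st. ball x \<epsilon> \<subseteq> G"
    using Heine_Borel_lemma[of "\<Union>K" "range st"] by metis
  define l where "l p = (SOME v. ball p \<epsilon> \<subseteq> st v)" for p
  have l: "ball p \<epsilon> \<subseteq> st (l p)" if p: "p \<in> \<Union>K" for p
  proof -
    have "\<exists>v. ball p \<epsilon> \<subseteq> st v"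
      using \<epsilon>(2)[OF p] by blast
    then show ?thesis
      unfolding l_def by (rule someI_ex)
  qed
  have near: "l q \<in> set (ori T)" if "T \<in> K" "p \<in> T" "q \<in> \<Union>K" "dist q p < \<epsilon>" for T p q
  proof -
    have "p \<in> st (l q)"
      using l[OF that(3)] that(4) by auto
    then show ?thesis
      using that(1,2) by (auto simp: st_def)
  qed
  have "l p \<in> set (ori T)" if "T \<in> K" "p \<in> T" for T p
    using near[OF that, of p] that \<epsilon>(1) by auto
  then show ?thesis
    using that[OF \<epsilon>(1)] near by blast
qed

text \<open>The chain map \<psi> turns c into a cycle of small tuples, which bounds some \<omega> by
  convexity. Labelling, the chain map \<phi>, brings \<omega> back to \<open>K\<close>, and a
  homotopy h from \<phi>\<psi> to the identity corrects the boundary: c is the boundary of \<phi>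
  \<omega> + h c.\<close>

theorem convex_cycle_bounds:
  assumes convex: "convex (\<Union>K)" and ne: "\<Union>K \<noteq> {}"
    and c: "c \<in> supp (cells K n)" "obd ori c = 0"
  shows "\<exists>w\<in>supp (cells K (Suc n)). obd ori w = c"
proof -
  obtain l \<epsilon> where \<epsilon>: "\<epsilon> > 0" and l: "\<And>T p. T \<in> K \<Longrightarrow> p \<in> T \<Longrightarrow> l p \<in> set (ori T)"
    and near: "\<And>T p q. T \<in> K \<Longrightarrow> p \<in> T \<Longrightarrow> q \<in> \<Union>K \<Longrightarrow> dist q p < \<epsilon> \<Longrightarrow> l q \<in> set (ori T)"
    using star_labelling by metis
  let ?X = "\<Union>K"
  define \<phi> where "\<phi> = lin (\<lambda>ps. osx ori (map l ps))"
  have lin_\<phi>: "linear \<phi>"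
    unfolding \<phi>_def by (rule linear_lin)
  have small_l: "\<exists>T\<in>K. set (map l ps) \<subseteq> set (ori T)" if ps: "ps \<in> small ?X \<epsilon> m" for ps m
  proof (cases ps)
    case Nil
    then show ?thesis
      using ne by auto
  next
    case (Cons p qs)
    then obtain T where T: "T \<in> K" "p \<in> T"
      using ps by (auto simp: small_def)
    have "l q \<in> set (ori T)" if "q \<in> set ps" for q
    proof (rule near[OF T])
      show "q \<in> ?X" "dist q p < \<epsilon>"
        using that ps Cons unfolding small_def by (blast, force)
    qed
    then show ?thesis
      using T(1) by auto
  qed
  have \<phi>_bd: "obd ori (\<phi> t) = \<phi> (lin tuple_bd t)" if t: "t \<in> supp (small ?X \<epsilon> m)" for t m
  proof -
    have "obd ori (\<phi> t) = lin (\<lambda>ps. obd ori (osx ori (map l ps))) t"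
      unfolding \<phi>_def by (rule linear_lin_comp[OF linear_obd])
    also have "\<dots> = lin (\<lambda>ps. lin (osx ori) (tuple_bd (map l ps))) t"
    proof (rule lin_cong_supp[OF t])
      fix ps assume "ps \<in> small ?X \<epsilon> m"
      then show "obd ori (osx ori (map l ps)) = lin (osx ori) (tuple_bd (map l ps))"
        using small_l obd_osx KU by metis
    qed
    also have "\<dots> = \<phi> (lin tuple_bd t)"
      by (simp add: \<phi>_def tuple_bd_map tuple_map_def lin_lin)
    finally show ?thesis .
  qed
  have \<phi>_cells: "\<phi> t \<in> supp (cells K m)" if t: "t \<in> supp (small ?X \<epsilon> m)" for t m
    unfolding \<phi>_def
  proof (rule lin_in_supp[OF t _ subspace_supp])
    fix ps assume ps: "ps \<in> small ?X \<epsilon> m"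
    then obtain T where "T \<in> K" "set (map l ps) \<subseteq> set (ori T)"
      using small_l by blast
    then show "osx ori (map l ps) \<in> supp (cells K m)"
      using osx_cells[OF face_closed_K, of T "map l ps"] ps by (simp add: small_def)
  qed
  \<comment> \<open>Each extension step costs some mesh, so \<delta> grows with the number of
    vertices. B exceeds all these numbers and \<delta> B = \<epsilon>; with B' = B - 1 all values of
    \<psi> have mesh below \<delta> B', which leaves room for the contraction of the whole
    cycle.\<close>
  define B where "B = Suc (\<Sum>S\<in>K. length (ori S))"
  have len_B: "length (ori S) < B" if "S \<in> K" for S
    using that finite_K member_le_sum[of S K "\<lambda>S. length (ori S)"] by (simp add: B_def)
  define \<delta> where "\<delta> k = \<epsilon> * (real (Suc k) / real (Suc B))" for k
  have \<delta>_pos: "0 < \<delta> k" and \<delta>_Suc: "\<delta> k < \<delta> (Suc k)" for k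
    using \<epsilon> by (simp_all add: \<delta>_def divide_strict_right_mono)
  have \<delta>_mono: "\<delta> j \<le> \<delta> k" if "j \<le> k" for j k
    using \<delta>_Suc lift_Suc_mono_le[of \<delta>] that less_imp_le by metis
  have \<delta>_B: "\<delta> B = \<epsilon>"
    by (simp add: \<delta>_def)
  obtain B' where B': "B = Suc B'"
    using B_def by blast
  have \<delta>_le: "\<delta> (length (ori S)) \<le> \<delta> B'" if "S \<in> K" for S
    using len_B[OF that] B' by (intro \<delta>_mono) simp
  have lt: "\<delta> B' < \<epsilon>"
    using \<delta>_Suc[of B'] \<delta>_B B' by simp
  let ?\<Phi> = "\<lambda>S. supp (small S (\<delta> (length (ori S))) (length (ori S)))"
  let ?\<Psi> = "\<lambda>S. supp (small S (\<delta> (length (ori S) - 1)) (length (ori S) - 1))"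
  obtain \<psi> where \<psi>: "\<psi> {} = bas []" "\<And>S. S \<in> K \<Longrightarrow> \<psi> S \<in> ?\<Phi> S"
    "\<And>S. S \<in> K \<Longrightarrow> lin tuple_bd (\<psi> S) = 0 + 1 *\<^sub>R lin \<psi> (obd ori (bas S))"
  proof (rule carrier_extension[OF face_closed_K finite_K linear_lin[of tuple_bd],
      where \<Phi> = ?\<Phi> and \<Psi> = ?\<Psi> and e = "\<lambda>S. 0" and \<sigma> = 1 and base = "bas []"])
    fix S F assume S: "S \<in> K" and F: "F \<in> K" "set (ori F) \<subseteq> set (ori S)" "Suc (length (ori F)) = length (ori S)"
    then have "length (ori F) = length (ori S) - 1"
      by simp
    then show "?\<Phi> F \<subseteq> ?\<Psi> S"
      using supp_mono[OF small_mono[OF set_ori_subset_imp_subset[OF S F(1,2)] order_refl]] by simp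
  next
    fix S t assume S: "S \<in> K" "ori S \<noteq> []" and t: "t \<in> ?\<Psi> S" "lin tuple_bd t = 0"
    obtain m where m: "length (ori S) = Suc m"
      using S(2) by (cases "ori S") auto
    have "hd (ori S) \<in> S"
      using set_ori_subset[OF KU[OF S(1)]] S(2) by auto
    from small_cycle_bounds[OF convex_U[OF KU[OF S(1)]] compact_imp_bounded[OF compact_U[OF KU[OF S(1)]]]
        this \<delta>_pos[of m] \<delta>_Suc[of m], of t m]
    show "\<exists>w\<in>?\<Phi> S. lin tuple_bd w = t"
      using t m by auto
  next
    have "ori {} = []"
    proof -
      obtain S where "S \<in> K"
        using ne by blast
      then show ?thesis
        using set_ori_hull[OF KU[of S], of "{}"] by simp
    qed
    then show "bas [] \<in> ?\<Phi> {}"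
      by (simp add: small_def)
  qed (simp_all add: subspace_supp supp_intros lin_def that)
  have \<psi>_bd: "lin tuple_bd (lin \<psi> x) = lin \<psi> (obd ori x)" if "x \<in> supp K" for x
  proof -
    have "lin tuple_bd (lin \<psi> x) = lin (\<lambda>S. lin tuple_bd (\<psi> S)) x"
      by (rule lin_lin)
    also have "\<dots> = lin (\<lambda>S. lin \<psi> (obd ori (bas S))) x"
      by (rule lin_cong_supp[OF that]) (simp add: \<psi>(3))
    also have "\<dots> = lin \<psi> (obd ori x)"
      using linear_eq_lin[OF linear_obd, of ori x] by (simp flip: lin_lin)
    finally show ?thesis .
  qed
  have \<psi>_small: "\<psi> S \<in> supp (small S (\<delta> B') (length (ori S)))" if "S \<in> K" for S
    using \<psi>(2)[OF that] supp_mono[OF small_mono[OF order_refl \<delta>_le[OF that]]] by blast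
  have \<psi>_\<epsilon>: "\<psi> S \<in> supp (small ?X \<epsilon> (length (ori S)))" if "S \<in> K" for S
    using \<psi>_small[OF that] supp_mono[OF small_mono[of S ?X "\<delta> B'" \<epsilon>]] that lt by fastforce
  \<comment> \<open>The identity and \<phi>\<psi> both send S to chains on the faces of S, whose
    complex is a cone; hence the homotopy.\<close>
  let ?e = "\<lambda>S. bas S - \<phi> (\<psi> S)"
  let ?\<Phi> = "\<lambda>S. supp {F \<in> cells U (Suc (length (ori S))). set (ori F) \<subseteq> set (ori S)}"
  let ?\<Psi> = "\<lambda>S. supp {F \<in> cells U (length (ori S)). set (ori F) \<subseteq> set (ori S)}"
  have lin_e: "lin ?e x = x - \<phi> (lin \<psi> x)" for x
    by (simp add: lin_diff_fun linear_lin_comp[OF lin_\<phi>])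
  obtain h where "h {} = 0" and h: "\<And>S. S \<in> K \<Longrightarrow> h S \<in> ?\<Phi> S"
    "\<And>S. S \<in> K \<Longrightarrow> obd ori (h S) = ?e S + (-1) *\<^sub>R lin h (obd ori (bas S))"
  proof (rule carrier_extension[OF face_closed_K finite_K linear_obd[of ori],
      where \<Phi> = ?\<Phi> and \<Psi> = ?\<Psi> and e = ?e and \<sigma> = "-1" and base = 0])
    fix S F assume "S \<in> K" "F \<in> K" "set (ori F) \<subseteq> set (ori S)" "Suc (length (ori F)) = length (ori S)"
    then show "?\<Phi> F \<subseteq> ?\<Psi> S"
      by (intro supp_mono) auto
  next
    fix S t assume S: "S \<in> K" "ori S \<noteq> []" and t: "t \<in> ?\<Psi> S" "obd ori t = 0"
    show "\<exists>w\<in>?\<Phi> S. obd ori w = t"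
      by (rule simplex_cycle_bounds[OF KU[OF S(1)] S(2) t])
  next
    fix S assume S: "S \<in> K" "ori S \<noteq> []"
    have "\<phi> (\<psi> S) \<in> ?\<Psi> S"
      unfolding \<phi>_def
    proof (rule lin_in_supp[OF \<psi>_small[OF S(1)] _ subspace_supp])
      fix ps assume ps: "ps \<in> small S (\<delta> B') (length (ori S))"
      then have sub: "set (map l ps) \<subseteq> set (ori S)"
        using l[OF S(1)] by (auto simp: small_def)
      show "osx ori (map l ps) \<in> ?\<Psi> S"
        using osx_faces[OF KU[OF S(1)] sub] ps by (simp add: small_def)
    qed
    then show "?e S \<in> ?\<Psi> S"
      using KU[OF S(1)] by (intro supp_intros) (auto simp: cells_def)
    have "obd ori (?e S) = obd ori (bas S) - \<phi> (lin tuple_bd (\<psi> S))"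
      by (simp add: \<phi>_bd[OF \<psi>_\<epsilon>[OF S(1)]])
    also have "\<dots> = lin ?e (obd ori (bas S))"
      by (simp add: \<psi>(3)[OF S(1)] lin_e)
    finally show "obd ori (?e S) = - ((-1) *\<^sub>R lin ?e (obd ori (bas S)))"
      by simp
  next
    obtain S where "S \<in> K"
      using ne by blast
    then have "{} \<in> U" "ori {} = []"
      using hull_in[OF KU[of S], of "{}"] set_ori_hull[OF KU[of S], of "{}"] by auto
    then have "osx ori [] = bas {}"
      using osx_ori by metis
    then show "obd ori 0 = ?e {}"
      by (simp add: \<psi>(1) \<phi>_def)
  qed (simp_all add: subspace_supp supp_intros that)
  have cK: "c \<in> supp K"
    using c(1) by (auto simp: supp_def cells_def)
  have "lin \<psi> c \<in> supp (small ?X (\<delta> B') n)"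
  proof (rule lin_in_supp[OF c(1) _ subspace_supp])
    fix S assume S: "S \<in> cells K n"
    then show "\<psi> S \<in> supp (small ?X (\<delta> B') n)"
      using \<psi>_small[of S] supp_mono[OF small_mono[of S ?X "\<delta> B'" "\<delta> B'" n]] by (fastforce simp: cells_def)
  qed
  moreover have "lin tuple_bd (lin \<psi> c) = 0"
    using \<psi>_bd[OF cK] c(2) by simp
  moreover have "bounded ?X"
    using finite_K compact_U KU by (intro compact_imp_bounded compact_Union) auto
  moreover obtain b where "b \<in> ?X"
    using ne by blast
  ultimately obtain \<omega> where \<omega>: "\<omega> \<in> supp (small ?X \<epsilon> (Suc n))" "lin tuple_bd \<omega> = lin \<psi> c"
    using small_cycle_bounds[OF convex _ _ \<delta>_pos[of B'] lt] by metis
  have "obd ori (lin h c) = lin (\<lambda>S. obd ori (h S)) c"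
    by (rule linear_lin_comp[OF linear_obd])
  also have "\<dots> = lin (\<lambda>S. ?e S - lin h (obd ori (bas S))) c"
    by (rule lin_cong_supp[OF cK]) (simp add: h(2))
  also have "\<dots> = lin ?e c - lin h (lin (\<lambda>S. obd ori (bas S)) c)"
    by (simp only: lin_diff_fun lin_lin)
  also have "lin (\<lambda>S. obd ori (bas S)) c = obd ori c"
    by (rule linear_eq_lin[OF linear_obd, symmetric])
  finally have "obd ori (lin h c) = c - \<phi> (lin \<psi> c)"
    using c(2) lin_e by simp
  then have "obd ori (\<phi> \<omega> + lin h c) = c"
    using \<phi>_bd[OF \<omega>(1)] \<omega>(2) by simp
  moreover have "lin h c \<in> supp (cells K (Suc n))"
  proof (rule lin_in_supp[OF c(1) _ subspace_supp])
    fix S assume S: "S \<in> cells K n"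
    then have "S \<in> K" "length (ori S) = n"
      by (auto simp: cells_def)
    moreover have "F \<in> K" if "F \<in> U" "set (ori F) \<subseteq> set (ori S)" for F
      using that face_closed_K \<open>S \<in> K\<close> hull_ori[OF that(1)] by (metis face_closed_def)
    ultimately show "h S \<in> supp (cells K (Suc n))"
      using h(1)[of S] by (auto simp: supp_def cells_def)
  qed
  ultimately show ?thesis
    using \<phi>_cells[OF \<omega>(1)] by (intro bexI[of _ "\<phi> \<omega> + lin h c"] supp_intros)
qed

end

subsection \<open>A subdivision induces an isomorphism in homology\<close>

context subdivided
begin

text \<open>Take the simplex of \<open>N\<close> whose relative interior contains a given relative
  interior point of T. The empty T has no such point and gets the empty simplex.\<close>

lemma carrier_cell_exists:
  assumes "T \<in> M"
  shows "\<exists>S\<in>N. T \<subseteq> S \<and> (\<forall>S'\<in>N. T \<subseteq> S' \<longrightarrow> S \<subseteq> S')"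
proof (cases "T = {}")
  case True
  obtain S where "S \<in> N"
    using contained[OF assms] by blast
  then have "{} \<in> N"
    using N.hull_in_K[of S "{}"] by simp
  then show ?thesis
    using True by blast
next
  case False
  obtain x where x: "x \<in> rel_interior T"
    using rel_interior_nonempty[OF M.KU[OF assms] False] by blast
  then have xT: "x \<in> T"
    using rel_interior_subset by blast
  obtain S1 where S1: "S1 \<in> N" "T \<subseteq> S1"
    using contained[OF assms] by blast
  then obtain S where S: "S \<in> N" "x \<in> rel_interior S"
    using N.mem_rel_interior_in_K[of S1 x] xT by blast
  have "T \<subseteq> S"
    using rel_interior_meets_imp_contained[OF assms S(1) x] S(2) rel_interior_subset by blast
  moreover have "S \<subseteq> S'" if "S' \<in> N" "T \<subseteq> S'" for S'
    using N.rel_interior_meets_imp_subset[OF S(1) that(1) S(2)] that(2) xT by blast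
  ultimately show ?thesis
    using S(1) by blast
qed

definition carrier_cell :: "'a set \<Rightarrow> 'a set" where
  "carrier_cell T = (SOME S. S \<in> N \<and> T \<subseteq> S \<and> (\<forall>S'\<in>N. T \<subseteq> S' \<longrightarrow> S \<subseteq> S'))"

lemma carrier_cell:
  assumes "T \<in> M"
  shows "carrier_cell T \<in> N" "T \<subseteq> carrier_cell T" "\<And>S. S \<in> N \<Longrightarrow> T \<subseteq> S \<Longrightarrow> carrier_cell T \<subseteq> S"
proof -
  have "\<exists>S. S \<in> N \<and> T \<subseteq> S \<and> (\<forall>S'\<in>N. T \<subseteq> S' \<longrightarrow> S \<subseteq> S')"
    using carrier_cell_exists[OF assms] by blast
  from someI_ex[OF this] show "carrier_cell T \<in> N" "T \<subseteq> carrier_cell T"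
    "\<And>S. S \<in> N \<Longrightarrow> T \<subseteq> S \<Longrightarrow> carrier_cell T \<subseteq> S"
    by (auto simp: carrier_cell_def)
qed

lemma carrier_cell_mono: "T \<in> M \<Longrightarrow> T' \<in> M \<Longrightarrow> T \<subseteq> T' \<Longrightarrow> carrier_cell T \<subseteq> carrier_cell T'"
  using carrier_cell[of T] carrier_cell(1,2)[of T'] by blast

text \<open>A Sperner labelling of the vertices of \<open>M\<close>.\<close>

definition label :: "'a \<Rightarrow> 'a" where
  "label v = hd (ori (carrier_cell {v}))"

lemma label_in:
  assumes "T \<in> M" "v \<in> set (ori T)" "S \<in> N" "T \<subseteq> S"
  shows "label v \<in> set (ori S)"
proof -
  have v: "{v} \<in> M"
    using M.hull_in_K[OF assms(1), of "{v}"] assms(2) by simp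
  have "{v} \<subseteq> S"
    using set_ori_subset[OF M.KU[OF assms(1)]] assms(2,4) by blast
  then have "carrier_cell {v} \<subseteq> S"
    by (rule carrier_cell(3)[OF v assms(3)])
  then have "set (ori (carrier_cell {v})) \<subseteq> set (ori S)"
    by (rule N.subset_imp_set_ori_subset[OF assms(3) carrier_cell(1)[OF v]])
  moreover have "ori (carrier_cell {v}) \<noteq> []"
    using carrier_cell(2)[OF v] hull_ori[OF N.KU[OF carrier_cell(1)[OF v]]] by force
  ultimately show ?thesis
    unfolding label_def using hd_in_set by blast
qed

text \<open>The chain map of the simplicial map \<open>label\<close>; a simplex whose labels
  coincide somewhere is sent to 0 by \<open>osx\<close>.\<close>

definition retr :: "'a chain \<Rightarrow> 'a chain" where
  "retr = lin (\<lambda>T. osx ori (map label (ori T)))"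

lemma linear_retr: "linear retr"
  unfolding retr_def by (rule linear_lin)

lemmas retr_simps [simp] =
  linear_add[OF linear_retr] linear_diff[OF linear_retr] linear_neg[OF linear_retr]
  linear_scale[OF linear_retr] linear_0[OF linear_retr]

lemma retr_bas_supp:
  assumes "T \<in> M" "S \<in> N" "T \<subseteq> S"
  shows "retr (bas T) \<in> supp {F \<in> cells N (length (ori T)). F \<subseteq> S}"
proof -
  have sub: "set (map label (ori T)) \<subseteq> set (ori S)"
    using label_in[OF assms(1) _ assms(2,3)] by auto
  have "{F. F = convex hull (set (map label (ori T))) \<and> length (ori F) = length (map label (ori T)) \<and>
      set (ori F) = set (map label (ori T))} \<subseteq> {F \<in> cells N (length (ori T)). F \<subseteq> S}"
    using N.hull_in_K[OF assms(2) sub] hull_mono[OF sub, of convex] hull_ori[OF N.KU[OF assms(2)]]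
    by (auto simp: cells_def)
  then show ?thesis
    unfolding retr_def lin_bas using osx_supp[of "map label (ori T)"] supp_mono by blast
qed

lemma retr_cells:
  assumes "c \<in> supp (cells M n)"
  shows "retr c \<in> supp (cells N n)"
proof -
  have "retr c = lin (\<lambda>T. retr (bas T)) c"
    by (rule linear_eq_lin[OF linear_retr])
  also have "\<dots> \<in> supp (cells N n)"
  proof (rule lin_in_supp[OF assms _ subspace_supp])
    fix T assume T: "T \<in> cells M n"
    then obtain S where "S \<in> N" "T \<subseteq> S"
      using contained by (auto simp: cells_def)
    then show "retr (bas T) \<in> supp (cells N n)"
      using retr_bas_supp[of T S] T by (auto simp: cells_def supp_def)
  qed
  finally show ?thesis .
qed

lemma retr_osx:
  assumes "T \<in> M" "set g \<subseteq> set (ori T)"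
  shows "retr (osx ori g) = osx ori (map label g)"
proof -
  have alt: "alternating (\<lambda>g. osx ori (map label g))"
    unfolding alternating_def map_append list.map using alternatingD[OF alternating_osx] by blast
  show ?thesis
  proof (cases "distinct g")
    case True
    let ?G = "convex hull (set g)"
    have "retr (osx ori (us @ a # b # ws)) = - retr (osx ori (us @ b # a # ws))" for us a b ws
      using alternatingD[OF alternating_osx[of ori], of us a b ws] by (metis linear_neg linear_retr)
    then have f: "alternating (\<lambda>g. retr (osx ori g))"
      unfolding alternating_def by blast
    have "retr (osx ori (ori ?G)) = osx ori (map label (ori ?G))"
      unfolding osx_ori[OF hull_in[OF M.KU[OF assms(1)] assms(2)]] by (simp add: retr_def)
    from alternating_eq_mset[OF f alt mset_ori_hull[OF M.KU[OF assms(1)] assms(2) True] this]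
    show ?thesis .
  next
    case False
    then show ?thesis
      by (simp add: alternating_not_distinct[OF alternating_osx] alternating_not_distinct[OF alt])
  qed
qed

lemma obd_retr_bas:
  assumes "T \<in> M"
  shows "obd ori (retr (bas T)) = retr (obd ori (bas T))"
proof -
  obtain S where S: "S \<in> N" "T \<subseteq> S"
    using contained[OF assms] by blast
  have "obd ori (retr (bas T)) = lin (osx ori) (tuple_bd (map label (ori T)))"
    using obd_osx[OF N.KU[OF S(1)], of "map label (ori T)"] label_in[OF assms _ S]
    by (auto simp: retr_def)
  also have "\<dots> = lin (\<lambda>g. osx ori (map label g)) (tuple_bd (ori T))"
    by (simp add: tuple_bd_map tuple_map_def lin_lin)
  also have "\<dots> = lin (\<lambda>g. retr (osx ori g)) (tuple_bd (ori T))"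
    by (rule lin_cong_supp[OF tuple_bd_supp_ori[OF M.KU[OF assms]]], rule retr_osx[OF assms, symmetric]) simp
  also have "\<dots> = retr (obd ori (bas T))"
    unfolding obd_bas by (rule linear_lin_comp[OF linear_retr, symmetric])
  finally show ?thesis .
qed

lemma obd_retr:
  assumes "c \<in> supp M"
  shows "obd ori (retr c) = retr (obd ori c)"
proof -
  have "linear (\<lambda>c. obd ori (retr c))" "linear (\<lambda>c. retr (obd ori c))"
    using linear_compose[OF linear_retr linear_obd] linear_compose[OF linear_obd linear_retr]
    by (simp_all add: o_def)
  then have "obd ori (retr c) = lin (\<lambda>S. obd ori (retr (bas S))) c"
    "retr (obd ori c) = lin (\<lambda>S. retr (obd ori (bas S))) c"
    by (auto dest: linear_eq_lin)
  moreover have "lin (\<lambda>S. obd ori (retr (bas S))) c = lin (\<lambda>S. retr (obd ori (bas S))) c"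
    by (rule lin_cong_supp[OF assms]) (rule obd_retr_bas)
  ultimately show ?thesis
    by simp
qed

lemma obd_bas_nonzero:
  assumes "S \<in> U" "ori S \<noteq> []"
  shows "obd ori (bas S) \<noteq> 0"
proof -
  let ?F = "convex hull (set (tl (ori S)))"
  have sub: "set (tl (ori S)) \<subseteq> set (ori S)"
    using assms(2) by (simp add: list.set_sel(2) subsetI)
  have "set (ori ?F) = set (tl (ori S))"
    by (rule set_ori_hull[OF assms(1) sub])
  moreover have "hd (ori S) \<notin> set (tl (ori S))" "set (ori S) = insert (hd (ori S)) (set (tl (ori S)))"
    using distinct_ori[OF assms(1)] assms(2) by (cases "ori S"; auto)+
  ultimately obtain s where "s = 1 \<or> s = (-1::real)" "Poly_Mapping.lookup (obd ori (bas S)) ?F = s"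
    using incidence[OF assms(1) hull_in[OF assms(1) sub], of "hd (ori S)"] by metis
  then show ?thesis
    by auto
qed

lemma subdiv_map_bas_supp:
  assumes "S \<in> N"
  shows "subdiv_map ori M (bas S) \<in> supp {T \<in> cells M (length (ori S)). T \<subseteq> S}"
  using subd_supp[of "ori S"] hull_ori[OF N.KU[OF assms]] by (simp add: subdiv_map_bas[OF assms])

lemma supp_singletonE:
  assumes "c \<in> supp {x}"
  obtains a where "c = a *\<^sub>R bas x"
proof
  show "c = Poly_Mapping.lookup c x *\<^sub>R bas x"
    using assms by (intro poly_mapping_eqI) (auto simp: supp_iff lookup_single when_def)
qed

lemma supp_cells_supp: "c \<in> supp (cells K n) \<Longrightarrow> c \<in> supp K"
  by (auto simp: supp_def cells_def)

lemma retr_subdiv_map_if_bas: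
  assumes "c \<in> supp A" "\<And>S. S \<in> A \<Longrightarrow> retr (subdiv_map ori M (bas S)) = bas S"
  shows "retr (subdiv_map ori M c) = c"
proof -
  have "linear (\<lambda>c. retr (subdiv_map ori M c))"
    using linear_compose[OF linear_subdiv_map linear_retr] by (simp add: o_def)
  from linear_eq_lin[OF this, of c] show ?thesis
    using lin_cong_supp[OF assms(1), of "\<lambda>S. retr (subdiv_map ori M (bas S))" bas] assms(2) by simp
qed

text \<open>The algebraic form of Sperner's lemma. Labels inside S are vertices of S, and no other
  face of S has as many vertices, so the result is a multiple of S. By induction its boundary is
  that of S, which is nonzero even for a vertex thanks to the augmentation.\<close>

lemma retr_subdiv_map:
  assumes "{} \<in> M" "c \<in> supp (cells N n)"
  shows "retr (subdiv_map ori M c) = c"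
  using assms(2)
proof (induction n arbitrary: c)
  case 0
  show ?case
  proof (rule retr_subdiv_map_if_bas[OF 0])
    fix S assume S: "S \<in> cells N 0"
    then have SN: "S \<in> N" and ori: "ori S = []"
      by (auto simp: cells_def)
    then have "S = {}"
      using hull_ori[OF N.KU[OF SN]] by simp
    then show "retr (subdiv_map ori M (bas S)) = bas S"
      using subdiv_map_common[OF SN] osx_ori[OF N.KU[OF SN]] ori assms(1) by (simp add: retr_def)
  qed
next
  case (Suc n)
  show ?case
  proof (rule retr_subdiv_map_if_bas[OF Suc.prems])
    fix S assume S: "S \<in> cells N (Suc n)"
    then have SN: "S \<in> N" and len: "length (ori S) = Suc n"
      by (auto simp: cells_def)
    let ?x = "retr (subdiv_map ori M (bas S))"
    have sd: "subdiv_map ori M (bas S) \<in> supp {T \<in> cells M (Suc n). T \<subseteq> S}"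
      using subdiv_map_bas_supp[OF SN] len by simp
    have "?x = lin (\<lambda>T. retr (bas T)) (subdiv_map ori M (bas S))"
      by (rule linear_eq_lin[OF linear_retr])
    also have "\<dots> \<in> supp {S}"
    proof (rule lin_in_supp[OF sd _ subspace_supp])
      fix T assume T: "T \<in> {T \<in> cells M (Suc n). T \<subseteq> S}"
      then have "retr (bas T) \<in> supp {F \<in> cells N (Suc n). F \<subseteq> S}"
        using retr_bas_supp[OF _ SN, of T] by (auto simp: cells_def)
      moreover have "{F \<in> cells N (Suc n). F \<subseteq> S} \<subseteq> {S}"
        using N.eq_if_subset_length[OF SN] len by (auto simp: cells_def)
      ultimately show "retr (bas T) \<in> supp {S}"
        using supp_mono by blast
    qed
    finally obtain a where a: "?x = a *\<^sub>R bas S"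
      by (rule supp_singletonE)
    have "obd ori (bas S) \<in> supp (cells N n)"
      using S by (intro obd_cells[OF N.face_closed_K]) simp
    then have "retr (subdiv_map ori M (obd ori (bas S))) = obd ori (bas S)"
      by (rule Suc.IH)
    moreover have "retr (subdiv_map ori M (obd ori (bas S))) = obd ori ?x"
      using obd_retr[of "subdiv_map ori M (bas S)"] obd_subdiv_map_bas[OF SN]
        subdiv_map_cells[of "bas S" "Suc n"] S by (simp add: supp_cells_supp)
    ultimately have "(a - 1) *\<^sub>R obd ori (bas S) = 0"
      by (simp add: a scaleR_left_diff_distrib)
    moreover have "ori S \<noteq> []"
      using len by auto
    ultimately have "a = 1"
      using obd_bas_nonzero[OF N.KU[OF SN]] by simp
    then show "?x = bas S"
      by (simp add: a)
  qed
qed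

text \<open>The identity and the composition both send T to chains inside
  \<open>carrier_cell T\<close>. The part of \<open>M\<close> in this simplex is acyclic by
  \<open>convex_cycle_bounds\<close>, so the carrier argument applies.\<close>

lemma subdiv_retr_homotopy:
  assumes M0: "{} \<in> M"
  obtains h where "\<And>c n. c \<in> supp (cells M n) \<Longrightarrow> lin h c \<in> supp (cells M (Suc n))"
    "\<And>c. c \<in> supp M \<Longrightarrow>
      obd ori (lin h c) = c - subdiv_map ori M (retr c) - lin h (obd ori c)"
proof -
  let ?e = "\<lambda>T. bas T - subdiv_map ori M (retr (bas T))"
  let ?\<Phi> = "\<lambda>T. supp {F \<in> cells M (Suc (length (ori T))). F \<subseteq> carrier_cell T}"
  let ?\<Psi> = "\<lambda>T. supp {F \<in> cells M (length (ori T)). F \<subseteq> carrier_cell T}"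
  have lin_sr: "linear (\<lambda>c. subdiv_map ori M (retr c))"
    using linear_compose[OF linear_retr linear_subdiv_map] by (simp add: o_def)
  have lin_e: "lin ?e c = c - subdiv_map ori M (retr c)" for c
    using linear_eq_lin[OF lin_sr, of c] by (simp add: lin_diff_fun)
  have sr_bd: "obd ori (subdiv_map ori M (retr c)) = subdiv_map ori M (retr (obd ori c))"
    if "T \<in> M" "c = bas T" for c T
  proof -
    have "retr c \<in> supp N"
      using retr_cells[of c "length (ori T)"] that by (auto simp: cells_def supp_cells_supp)
    then show ?thesis
      using obd_subdiv_map[of "retr c"] obd_retr_bas[OF that(1)] that(2) by simp
  qed
  obtain h where "h {} = 0" and h: "\<And>T. T \<in> M \<Longrightarrow> h T \<in> ?\<Phi> T"
    "\<And>T. T \<in> M \<Longrightarrow> obd ori (h T) = ?e T + (-1) *\<^sub>R lin h (obd ori (bas T))"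
  proof (rule carrier_extension[OF M.face_closed_K M.finite_K linear_obd[of ori],
      where \<Phi> = ?\<Phi> and \<Psi> = ?\<Psi> and e = ?e and \<sigma> = "-1" and base = 0])
    fix T F assume T: "T \<in> M" and F: "F \<in> M" "set (ori F) \<subseteq> set (ori T)" "Suc (length (ori F)) = length (ori T)"
    have "carrier_cell F \<subseteq> carrier_cell T"
      by (rule carrier_cell_mono[OF F(1) T M.set_ori_subset_imp_subset[OF T F(1,2)]])
    then show "?\<Phi> F \<subseteq> ?\<Psi> T"
      using F(3) by (intro supp_mono) auto
  next
    fix T t assume T: "T \<in> M" "ori T \<noteq> []" and t: "t \<in> ?\<Psi> T" "obd ori t = 0"
    interpret R: subdivided U ori "{S \<in> N. S \<subseteq> carrier_cell T}" "{S \<in> M. S \<subseteq> carrier_cell T}"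
      by (rule subdivided_restrict[OF carrier_cell(1)[OF T(1)]])
    have union: "\<Union>{S \<in> M. S \<subseteq> carrier_cell T} = carrier_cell T"
      using R.union_eq carrier_cell(1)[OF T(1)] by auto
    have cells: "cells {S \<in> M. S \<subseteq> carrier_cell T} n = {F \<in> cells M n. F \<subseteq> carrier_cell T}" for n
      by (auto simp: cells_def)
    have "carrier_cell T \<noteq> {}"
      using carrier_cell(2)[OF T(1)] set_ori_subset[OF M.KU[OF T(1)]] T(2) by auto
    then show "\<exists>w\<in>?\<Phi> T. obd ori w = t"
      using R.M.convex_cycle_bounds[of t "length (ori T)"] convex_U[OF N.KU[OF carrier_cell(1)[OF T(1)]]] t
      by (simp add: union cells)
  next
    fix T assume T: "T \<in> M" "ori T \<noteq> []"
    have r: "retr (bas T) \<in> supp {F \<in> cells N (length (ori T)). F \<subseteq> carrier_cell T}"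
      by (rule retr_bas_supp[OF T(1) carrier_cell(1,2)[OF T(1)]])
    have "subdiv_map ori M (bas S) \<in> ?\<Psi> T"
      if "S \<in> {F \<in> cells N (length (ori T)). F \<subseteq> carrier_cell T}" for S
      using subdiv_map_bas_supp[of S] that by (auto simp: cells_def supp_def)
    then have "lin (\<lambda>S. subdiv_map ori M (bas S)) (retr (bas T)) \<in> ?\<Psi> T"
      by (rule lin_in_supp[OF r _ subspace_supp])
    then have "subdiv_map ori M (retr (bas T)) \<in> ?\<Psi> T"
      using linear_eq_lin[OF linear_subdiv_map, of "retr (bas T)"] by simp
    then show "?e T \<in> ?\<Psi> T"
      using T(1) carrier_cell(2)[OF T(1)] by (intro supp_intros) (auto simp: cells_def)
    show "obd ori (?e T) = - ((-1) *\<^sub>R lin ?e (obd ori (bas T)))"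
      using sr_bd[OF T(1) refl] by (simp add: lin_e)
  next
    have ori0: "ori {} = []"
      using set_ori_hull[OF M.KU[OF M0], of "{}"] by simp
    have "retr (bas {}) = bas {}"
      using osx_ori[OF M.KU[OF M0]] ori0 by (simp add: retr_def)
    moreover have "{} \<in> N"
      using carrier_cell(1)[OF M0] N.hull_in_K[of _ "{}"] by fastforce
    then have "subdiv_map ori M (bas {}) = bas {}"
      by (rule subdiv_map_common[OF _ M0])
    ultimately show "obd ori 0 = ?e {}"
      by simp
  qed (simp_all add: subspace_supp supp_intros that)
  have "obd ori (lin h c) = c - subdiv_map ori M (retr c) - lin h (obd ori c)" if c: "c \<in> supp M" for c
  proof -
    have "obd ori (lin h c) = lin (\<lambda>T. obd ori (h T)) c"
      by (rule linear_lin_comp[OF linear_obd])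
    also have "\<dots> = lin (\<lambda>T. ?e T - lin h (obd ori (bas T))) c"
      by (rule lin_cong_supp[OF c]) (simp add: h(2))
    also have "\<dots> = lin ?e c - lin h (lin (\<lambda>T. obd ori (bas T)) c)"
      by (simp only: lin_diff_fun lin_lin)
    also have "lin (\<lambda>T. obd ori (bas T)) c = obd ori c"
      by (rule linear_eq_lin[OF linear_obd, symmetric])
    finally show ?thesis
      by (simp add: lin_e)
  qed
  moreover have "lin h c \<in> supp (cells M (Suc n))" if c: "c \<in> supp (cells M n)" for c n
  proof (rule lin_in_supp[OF c _ subspace_supp])
    fix T assume "T \<in> cells M n"
    then show "h T \<in> supp (cells M (Suc n))"
      using h(1)[of T] by (auto simp: cells_def supp_def)
  qed
  ultimately show ?thesis
    using that by blast
qed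

text \<open>Vanishing of the homology of the quotient complex of the injective chain map.\<close>

theorem relative_cycle_bounds:
  assumes M0: "{} \<in> M" and v: "v \<in> supp (cells M (Suc n))" and x: "x \<in> supp (cells N n)"
    and eq: "obd ori v = subdiv_map ori M x"
  obtains z u where "z \<in> supp (cells N (Suc n))" "u \<in> supp (cells M (Suc (Suc n)))"
    "v = subdiv_map ori M z + obd ori u"
proof -
  obtain h where h: "\<And>c n. c \<in> supp (cells M n) \<Longrightarrow> lin h c \<in> supp (cells M (Suc n))"
    "\<And>c. c \<in> supp M \<Longrightarrow> obd ori (lin h c) = c - subdiv_map ori M (retr c) - lin h (obd ori c)"
    using subdiv_retr_homotopy[OF M0] by metis
  let ?z = "retr v"
  \<comment> \<open>The retraction inverts the subdivision map, so w is a cycle with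
    \<open>retr ?w = 0\<close>, and the homotopy fills it.\<close>
  let ?w = "v - subdiv_map ori M ?z"
  have z: "?z \<in> supp (cells N (Suc n))"
    by (rule retr_cells[OF v])
  have "obd ori ?z = x"
    using obd_retr[OF supp_cells_supp[OF v]] eq retr_subdiv_map[OF M0 x] by simp
  then have "obd ori ?w = 0"
    using obd_subdiv_map[OF supp_cells_supp[OF z]] eq by simp
  moreover have w: "?w \<in> supp (cells M (Suc n))"
    using v subdiv_map_cells[OF z] by (intro supp_intros)
  moreover have "retr ?w = 0"
    using retr_subdiv_map[OF M0 z] by simp
  ultimately have "obd ori (lin h ?w) = ?w"
    using h(2)[OF supp_cells_supp[OF w]] by simp
  then have "v = subdiv_map ori M ?z + obd ori (lin h ?w)"
    by simp
  then show ?thesis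
    using that z h(1)[OF w] by blast
qed

end

subsection \<open>Orthogonal complements and angles of chain spaces\<close>

lemma chain_inner_superset:
  assumes "finite A" "Poly_Mapping.keys c \<subseteq> A"
  shows "chain_inner c d = (\<Sum>S\<in>A. Poly_Mapping.lookup c S * Poly_Mapping.lookup d S)"
  unfolding chain_inner_def using assms
  by (intro sum.mono_neutral_left) (auto simp: in_keys_iff)

lemma chain_inner_commute: "chain_inner c d = chain_inner d c"
proof -
  let ?A = "Poly_Mapping.keys c \<union> Poly_Mapping.keys d"
  have "chain_inner c d = (\<Sum>S\<in>?A. Poly_Mapping.lookup c S * Poly_Mapping.lookup d S)"
    by (rule chain_inner_superset) auto
  moreover have "chain_inner d c = (\<Sum>S\<in>?A. Poly_Mapping.lookup d S * Poly_Mapping.lookup c S)"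
    by (rule chain_inner_superset) auto
  ultimately show ?thesis
    by (simp add: mult.commute)
qed

lemma chain_inner_eq_lin: "chain_inner c d = lin (Poly_Mapping.lookup d) c"
  by (simp add: chain_inner_def lin_def)

lemma linear_chain_inner_left: "linear (\<lambda>c. chain_inner c d)"
  unfolding chain_inner_eq_lin by (rule linear_lin)

lemma linear_chain_inner_right: "linear (\<lambda>d. chain_inner c d)"
  using linear_chain_inner_left[of c] by (simp add: chain_inner_commute[of c])

lemmas chain_inner_simps [simp] =
  linear_add[OF linear_chain_inner_left] linear_add[OF linear_chain_inner_right]
  linear_diff[OF linear_chain_inner_left] linear_diff[OF linear_chain_inner_right]
  linear_neg[OF linear_chain_inner_left] linear_neg[OF linear_chain_inner_right]
  linear_scale[OF linear_chain_inner_left] linear_scale[OF linear_chain_inner_right]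
  linear_0[OF linear_chain_inner_left] linear_0[OF linear_chain_inner_right]

lemma chain_inner_bas [simp]: "chain_inner (bas S) d = Poly_Mapping.lookup d S"
  by (simp add: chain_inner_eq_lin)

lemma chain_inner_bas_right [simp]: "chain_inner d (bas S) = Poly_Mapping.lookup d S"
  by (simp add: chain_inner_commute[of d])

lemma chain_inner_nonneg [simp]: "chain_inner c c \<ge> 0"
  by (simp add: chain_inner_def sum_nonneg)

lemma chain_inner_eq_0 [simp]: "chain_inner c c = 0 \<longleftrightarrow> c = 0"
proof
  assume "chain_inner c c = 0"
  then have "\<forall>S\<in>Poly_Mapping.keys c. Poly_Mapping.lookup c S * Poly_Mapping.lookup c S = 0"
    unfolding chain_inner_def by (subst (asm) sum_nonneg_eq_0_iff) auto
  then show "c = 0"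
    by (intro poly_mapping_eqI) (auto simp: in_keys_iff)
qed simp

lemma chain_norm_eq_1: "chain_norm c = 1 \<longleftrightarrow> chain_inner c c = 1"
  by (simp add: chain_norm_def)

lemma orthogonal_projection_span:
  assumes "finite B"
  shows "\<exists>p\<in>span B. \<forall>b\<in>B. chain_inner b (x - p) = 0"
  using assms
proof (induction B arbitrary: x)
  case empty
  then show ?case
    by (auto simp: span_zero)
next
  case (insert b B)
  have ortho: "chain_inner y r = 0" if "y \<in> span B" "\<forall>b\<in>B. chain_inner b r = 0" for y r
    using linear_eq_0_on_span[OF linear_chain_inner_left, of B r y] that by blast
  obtain q where q: "q \<in> span B" "\<forall>a\<in>B. chain_inner a (b - q) = 0"
    using insert.IH[of b] by blast
  obtain p where p: "p \<in> span B" "\<forall>a\<in>B. chain_inner a (x - p) = 0"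
    using insert.IH[of x] by blast
  define r where "r = b - q"
  \<comment> \<open>A step of the Gram-Schmidt process. If b depends on B, then r = 0 and p' = p,
    whatever the quotient.\<close>
  define p' where "p' = p + (chain_inner r x / chain_inner r r) *\<^sub>R r"
  have sub: "span B \<subseteq> span (insert b B)"
    by (intro span_mono) auto
  have "r \<in> span (insert b B)"
    unfolding r_def using q(1) sub by (intro span_diff) (auto intro: span_base)
  then have "p' \<in> span (insert b B)"
    unfolding p'_def using p(1) sub by (intro span_add span_scale) auto
  moreover have B: "chain_inner a (x - p') = 0" if "a \<in> B" for a
    using p(2) q(2) that by (simp add: p'_def r_def)
  have "chain_inner r p = 0"
    using ortho[OF p(1), of r] q(2) by (simp add: r_def chain_inner_commute)
  then have "chain_inner r (x - p') = 0"
    by (simp add: p'_def)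
  moreover have "chain_inner q (x - p') = 0"
    using ortho[OF q(1)] B by blast
  ultimately have "p' \<in> span (insert b B)" "chain_inner b (x - p') = 0"
    by (simp_all add: r_def)
  then show ?case
    using B by blast
qed

lemma supp_subset_span: "finite A \<Longrightarrow> supp A \<subseteq> span (bas ` A)"
proof
  fix c assume "finite A" "c \<in> supp A"
  then have "lin bas c \<in> span (bas ` A)"
    by (intro lin_in_supp[of c A]) (auto intro: span_base)
  then show "c \<in> span (bas ` A)"
    by simp
qed

lemma orthogonal_projection:
  assumes A: "finite A" and W: "subspace W" "W \<subseteq> supp A"
  obtains p where "p \<in> W" "\<And>w. w \<in> W \<Longrightarrow> chain_inner w (x - p) = 0"
proof -
  obtain B where B: "B \<subseteq> W" "independent B" "W \<subseteq> span B"
    using maximal_independent_subset .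
  have "B \<subseteq> span (bas ` A)"
    using B(1) W(2) supp_subset_span[OF A] by blast
  then have "finite B"
    using independent_span_bound[OF finite_imageI[OF A] B(2)] by blast
  from orthogonal_projection_span[OF this, of x] obtain p where
    p: "p \<in> span B" "\<forall>b\<in>B. chain_inner b (x - p) = 0"
    by blast
  have "p \<in> W"
    using p(1) span_minimal[OF B(1) W(1)] by blast
  moreover have "chain_inner w (x - p) = 0" if "w \<in> W" for w
    using linear_eq_0_on_span[OF linear_chain_inner_left, of B "x - p" w] p(2) B(3) that by blast
  ultimately show ?thesis
    using that by blast
qed

text \<open>Describes W by linear equations between coefficients; this is what makes its unit sphere
  closed for pointwise convergence.\<close>

lemma subspace_eq_double_complement:
  assumes A: "finite A" and W: "subspace W" "W \<subseteq> supp A"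
  shows "W = {x \<in> supp A. \<forall>z\<in>supp A. (\<forall>w\<in>W. chain_inner w z = 0) \<longrightarrow> chain_inner z x = 0}"
proof (intro equalityI subsetI)
  fix x assume "x \<in> W"
  then show "x \<in> {x \<in> supp A. \<forall>z\<in>supp A. (\<forall>w\<in>W. chain_inner w z = 0) \<longrightarrow> chain_inner z x = 0}"
    using W(2) by (auto simp: chain_inner_commute)
next
  fix x assume x: "x \<in> {x \<in> supp A. \<forall>z\<in>supp A. (\<forall>w\<in>W. chain_inner w z = 0) \<longrightarrow> chain_inner z x = 0}"
  obtain p where p: "p \<in> W" "\<And>w. w \<in> W \<Longrightarrow> chain_inner w (x - p) = 0"
    using orthogonal_projection[OF A W, of x] by blast
  have "x - p \<in> supp A"
    using x p(1) W(2) by (intro supp_intros) auto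
  then have "chain_inner (x - p) x = 0"
    using x p(2) by blast
  moreover have "chain_inner (x - p) p = 0"
    using p by (simp add: chain_inner_commute)
  ultimately have "chain_inner (x - p) (x - p) = 0"
    by simp
  then have "x - p = 0"
    unfolding chain_inner_eq_0 .
  then have "x = p"
    by simp
  then show "x \<in> W"
    using p(1) by simp
qed

text \<open>The functions of coefficients carry the topology of pointwise convergence.\<close>

lemma compact_unit_sphere:
  assumes A: "finite A" and W: "subspace W" "W \<subseteq> supp A"
  shows "compact (Poly_Mapping.lookup ` {x \<in> W. chain_inner x x = 1})"
proof -
  \<comment> \<open>Tychonoff's theorem makes this box compact although there may be infinitely many
    coordinates. The chains in \<open>?Z\<close> are the equations that cut out W.\<close>
  let ?Q = "PiE UNIV (\<lambda>S. if S \<in> A then {-1..1::real} else {0})"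
  let ?Z = "{z \<in> supp A. \<forall>w\<in>W. chain_inner w z = 0}"
  let ?R = "?Q \<inter> {f. (\<Sum>S\<in>A. f S * f S) = 1} \<inter>
    (\<Inter>z\<in>?Z. {f. (\<Sum>S\<in>A. Poly_Mapping.lookup z S * f S) = 0})"
  have "compact ?Q"
    using compactin_PiE[of "\<lambda>_. euclidean" UNIV "\<lambda>S. if S \<in> A then {-1..1::real} else {0}"]
    by (auto simp: euclidean_product_topology)
  moreover have "closed {f :: 'a set \<Rightarrow> real. (\<Sum>S\<in>A. f S * f S) = 1}"
    by (intro closed_Collect_eq continuous_intros continuous_on_product_coordinates)
  moreover have "closed (\<Inter>z\<in>?Z. {f. (\<Sum>S\<in>A. Poly_Mapping.lookup z S * f S) = 0})"
    by (intro closed_INT ballI closed_Collect_eq continuous_intros continuous_on_product_coordinates)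
  ultimately have "compact ?R"
    by (intro compact_Int_closed) auto
  moreover have "Poly_Mapping.lookup ` {x \<in> W. chain_inner x x = 1} = ?R"
  proof (intro equalityI subsetI)
    fix f assume "f \<in> Poly_Mapping.lookup ` {x \<in> W. chain_inner x x = 1}"
    then obtain x where x: "x \<in> W" "chain_inner x x = 1" and f: "f = Poly_Mapping.lookup x"
      by blast
    have xA: "x \<in> supp A"
      using x(1) W(2) by blast
    then have inner: "chain_inner x y = (\<Sum>S\<in>A. f S * Poly_Mapping.lookup y S)" for y
      using chain_inner_superset[OF A] f by (auto simp: supp_def)
    have "f S \<in> {-1..1}" if "S \<in> A" for S
    proof -
      have "f S * f S \<le> (\<Sum>S\<in>A. f S * f S)"
        using A that by (intro member_le_sum) auto
      then have "(f S)\<^sup>2 \<le> 1"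
        using x(2) inner[of x] by (simp add: f power2_eq_square)
      then show ?thesis
        by (auto simp: abs_square_le_1 abs_le_iff)
    qed
    moreover have "f S = 0" if "S \<notin> A" for S
      using xA that f by (simp add: supp_iff)
    moreover have "(\<Sum>S\<in>A. Poly_Mapping.lookup z S * f S) = 0" if "z \<in> ?Z" for z
    proof -
      have "chain_inner x z = 0"
        using that x(1) by blast
      then show ?thesis
        using inner[of z] by (simp add: mult.commute)
    qed
    ultimately show "f \<in> ?R"
      using x(2) inner[of x] f by auto
  next
    fix f assume f: "f \<in> ?R"
    then have zero: "f S = 0" if "S \<notin> A" for S
      using that by (auto simp: PiE_iff split: if_splits)
    define x where "x = Abs_poly_mapping f"
    have "{S. f S \<noteq> 0} \<subseteq> A"
      using zero by auto
    then have fx: "Poly_Mapping.lookup x = f"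
      using finite_subset[OF _ A] by (simp add: x_def)
    have xA: "x \<in> supp A"
      using zero by (simp add: supp_iff fx)
    have "chain_inner z x = 0" if "z \<in> ?Z" for z
      using f that chain_inner_superset[OF A, of z x] by (auto simp: fx supp_def)
    then have "x \<in> W"
      using subspace_eq_double_complement[OF A W] xA by blast
    moreover have "chain_inner x x = 1"
      using chain_inner_superset[OF A, of x x] xA f by (auto simp: fx supp_def)
    ultimately show "f \<in> Poly_Mapping.lookup ` {x \<in> W. chain_inner x x = 1}"
      using fx by blast
  qed
  ultimately show ?thesis
    by simp
qed

lemma normalize_chain:
  assumes "subspace W" "x \<in> W" "x \<noteq> 0"
  shows "(1 / chain_norm x) *\<^sub>R x \<in> W" "chain_norm ((1 / chain_norm x) *\<^sub>R x) = 1" "chain_norm x > 0"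
proof -
  show pos: "chain_norm x > 0"
    using assms(3) chain_inner_nonneg[of x] unfolding chain_norm_def
    by (simp add: order.order_iff_strict)
  show "(1 / chain_norm x) *\<^sub>R x \<in> W"
    using assms by (simp add: subspace_scale)
  have "(chain_norm x)\<^sup>2 = chain_inner x x"
    by (simp add: chain_norm_def)
  then show "chain_norm ((1 / chain_norm x) *\<^sub>R x) = 1"
    unfolding chain_norm_eq_1 using pos assms(3) by (simp add: power2_eq_square)
qed

text \<open>By compactness the maximum exists, so \<open>GREATEST\<close> denotes it. It is positive
  because x and y can be normalised and x given the right sign. It is below 1 because unit vectors
  with inner product 1 coincide and would be a nonzero common element.\<close>

lemma max_cos_bounds:
  assumes A: "finite A" and X: "subspace X" "X \<subseteq> supp A" and Y: "subspace Y" "Y \<subseteq> supp A"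
    and disjoint: "X \<inter> Y \<subseteq> {0}" and xy: "x \<in> X" "y \<in> Y" "chain_inner x y \<noteq> 0"
  shows "max_cos X Y \<in> {0<..<1}"
proof -
  let ?P = "\<lambda>r. \<exists>x\<in>X. \<exists>y\<in>Y. chain_norm x = 1 \<and> chain_norm y = 1 \<and> r = chain_inner x y"
  let ?SX = "Poly_Mapping.lookup ` {x \<in> X. chain_inner x x = 1}"
  let ?SY = "Poly_Mapping.lookup ` {y \<in> Y. chain_inner y y = 1}"
  let ?F = "\<lambda>(f, g). \<Sum>S\<in>A. f S * g S :: real"
  have nz: "x \<noteq> 0" "y \<noteq> 0"
    using xy(3) by auto
  define s where "s = sgn (chain_inner x y)"
  define x' where "x' = (s / chain_norm x) *\<^sub>R x"
  define y' where "y' = (1 / chain_norm y) *\<^sub>R y"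
  have y': "y' \<in> Y" "chain_norm y' = 1" "chain_norm y > 0"
    unfolding y'_def using normalize_chain[OF Y(1) xy(2) nz(2)] by auto
  have x'_eq: "x' = s *\<^sub>R ((1 / chain_norm x) *\<^sub>R x)"
    by (simp add: x'_def)
  have ss: "s * s = 1"
    using xy(3) by (simp add: s_def flip: sgn_mult)
  have x': "x' \<in> X" "chain_norm x' = 1" "chain_norm x > 0"
    using normalize_chain[OF X(1) xy(1) nz(1)] subspace_scale[OF X(1) xy(1)] ss
    unfolding x'_eq chain_norm_eq_1 by (auto simp: mult.assoc[symmetric])
  have "chain_inner x' y' = \<bar>chain_inner x y\<bar> / (chain_norm x * chain_norm y)"
    by (simp add: x'_def y'_def s_def abs_sgn mult.commute)
  then have pos: "chain_inner x' y' > 0"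
    using xy(3) x'(3) y'(3) by simp
  have "compact (?SX \<times> ?SY)"
    by (intro compact_Times compact_unit_sphere[OF A] X Y)
  moreover have "?SX \<times> ?SY \<noteq> {}"
    using x' y' by (auto simp: chain_norm_eq_1)
  moreover have "continuous_on (?SX \<times> ?SY) ?F"
    unfolding case_prod_unfold
    by (intro continuous_intros continuous_on_compose2[OF continuous_on_product_coordinates]) auto
  ultimately obtain p where p: "p \<in> ?SX \<times> ?SY" "\<And>q. q \<in> ?SX \<times> ?SY \<Longrightarrow> ?F q \<le> ?F p"
    using continuous_attains_sup[of "?SX \<times> ?SY" ?F] by blast
  have F: "?F (Poly_Mapping.lookup x, Poly_Mapping.lookup y) = chain_inner x y" if "x \<in> X" for x y
    using chain_inner_superset[OF A, of x y] X(2) that by (auto simp: supp_def)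
  obtain x0 y0 where p0: "p = (Poly_Mapping.lookup x0, Poly_Mapping.lookup y0)"
      "x0 \<in> X" "y0 \<in> Y" "chain_norm x0 = 1" "chain_norm y0 = 1"
    using p(1) by (auto simp: chain_norm_eq_1)
  have max: "r \<le> chain_inner x0 y0" if "?P r" for r
  proof -
    obtain x1 y1 where 1: "x1 \<in> X" "y1 \<in> Y" "chain_norm x1 = 1" "chain_norm y1 = 1" "r = chain_inner x1 y1"
      using \<open>?P r\<close> by blast
    then have "(Poly_Mapping.lookup x1, Poly_Mapping.lookup y1) \<in> ?SX \<times> ?SY"
      by (auto simp: chain_norm_eq_1)
    from p(2)[OF this] show ?thesis
      using F[OF 1(1)] F[OF p0(2)] 1(5) p0(1) by simp
  qed
  have eq: "max_cos X Y = chain_inner x0 y0"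
    unfolding max_cos_def by (rule Greatest_equality) (use p0 max in blast)+
  have "chain_inner x' y' \<le> chain_inner x0 y0"
    using max x' y' by blast
  then have "max_cos X Y > 0"
    using pos eq by simp
  moreover have "chain_inner x0 y0 < 1"
  proof (rule ccontr)
    assume "\<not> ?thesis"
    moreover have "chain_inner (x0 - y0) (x0 - y0) = 2 - 2 * chain_inner x0 y0"
      using p0(4,5) by (simp add: chain_norm_eq_1 chain_inner_commute[of y0 x0])
    ultimately have "chain_inner (x0 - y0) (x0 - y0) = 0"
      using chain_inner_nonneg[of "x0 - y0"] by linarith
    then have "x0 = y0"
      unfolding chain_inner_eq_0 by simp
    then have "x0 = 0"
      using disjoint p0(2,3) by blast
    then show False
      using p0(4) by (simp add: chain_norm_def)
  qed
  ultimately show ?thesis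
    using eq by simp
qed

subsection \<open>The complements and their boundaries\<close>

context subdivided
begin

abbreviation "sd \<equiv> subdiv_map ori M"
abbreviation "V \<equiv> subspace_V ori N M"

lemma V_supp: "V k \<subseteq> supp (cells M (Suc k))"
  unfolding chains_eq_supp[OF M_U, symmetric] by (subst subspace_V.simps) (auto simp: perp_def)

lemma chain_bd_V: "chain_bd ori ` V (Suc k) = obd ori ` V (Suc k)"
proof (rule image_cong[OF refl])
  fix c assume "c \<in> V (Suc k)"
  then have "c \<in> supp (cells U (Suc (Suc k)))"
    using V_supp[of "Suc k"] M_U by (auto simp: supp_def cells_def)
  then show "chain_bd ori c = obd ori c"
    by (rule chain_bd_eq_obd)
qed

lemma subspace_V: "subspace (V k)"
proof -
  have "subspace (perp M k X)" for X
    unfolding perp_def chains_eq_supp[OF M_U] subspace_def by (auto intro: supp_intros)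
  then show ?thesis
    by (subst subspace_V.simps) simp
qed

lemma im_subdiv_eq: "im_subdiv ori N M k = sd ` supp (cells N (Suc k))"
  by (simp add: im_subdiv_def chains_eq_supp[OF N_U])

text \<open>From the top dimension on, \<open>V (Suc k)\<close> is {0}, so the two cases of the
  recursion are one formula.\<close>

lemma V_unfold: "V k = perp M k (im_subdiv ori N M k + obd ori ` V (Suc k))"
proof (cases "int k < complex_dim M")
  case True
  then show ?thesis
    by (subst subspace_V.simps) (simp add: chain_bd_V)
next
  case False
  have "cells M (Suc (Suc k)) = {}"
  proof (rule ccontr)
    assume "cells M (Suc (Suc k)) \<noteq> {}"
    then obtain T where T: "T \<in> M" "length (ori T) = Suc (Suc k)"
      by (auto simp: cells_def)
    have "aff_dim T \<le> complex_dim M"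
      unfolding complex_dim_def using M.finite_K T(1) by (intro Max_ge) auto
    then show False
      using aff_dim_ori[OF M.KU[OF T(1)]] T(2) False by simp
  qed
  then have "V (Suc k) \<subseteq> {0}"
    using V_supp[of "Suc k"] by (auto simp: supp_def)
  then have "V (Suc k) = {0}"
    using subspace_0[OF subspace_V, of "Suc k"] by blast
  then have "im_subdiv ori N M k + obd ori ` V (Suc k) = im_subdiv ori N M k"
    by (simp add: set_plus_def)
  then show ?thesis
    using False by (subst subspace_V.simps) simp
qed

lemma V_iff: "c \<in> V k \<longleftrightarrow> c \<in> supp (cells M (Suc k)) \<and>
    (\<forall>x\<in>supp (cells N (Suc k)). chain_inner (sd x) c = 0) \<and> (\<forall>v\<in>V (Suc k). chain_inner (obd ori v) c = 0)"
proof -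
  have 0: "0 \<in> supp (cells N (Suc k))" "0 \<in> V (Suc k)"
    by (simp_all add: supp_intros subspace_0[OF subspace_V])
  have "(\<forall>z\<in>im_subdiv ori N M k + obd ori ` V (Suc k). chain_inner z c = 0) \<longleftrightarrow>
      (\<forall>x\<in>supp (cells N (Suc k)). \<forall>v\<in>V (Suc k). chain_inner (sd x + obd ori v) c = 0)"
    unfolding im_subdiv_eq set_plus_def by blast
  also have "\<dots> \<longleftrightarrow> (\<forall>x\<in>supp (cells N (Suc k)). chain_inner (sd x) c = 0) \<and>
      (\<forall>v\<in>V (Suc k). chain_inner (obd ori v) c = 0)"
  proof (intro iffI conjI ballI)
    assume *: "\<forall>x\<in>supp (cells N (Suc k)). \<forall>v\<in>V (Suc k). chain_inner (sd x + obd ori v) c = 0"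
    show "chain_inner (sd x) c = 0" if "x \<in> supp (cells N (Suc k))" for x
      using *[rule_format, OF that 0(2)] by simp
    show "chain_inner (obd ori v) c = 0" if "v \<in> V (Suc k)" for v
      using *[rule_format, OF 0(1) that] by simp
  qed simp
  finally show ?thesis
    by (subst V_unfold) (simp add: perp_def chains_eq_supp[OF M_U])
qed

text \<open>Project to the sum of the first two spaces; the remainder is orthogonal to both and so
  belongs to \<open>V k\<close>.\<close>

lemma decomposition:
  assumes "c \<in> supp (cells M (Suc k))"
  obtains x v q where "x \<in> supp (cells N (Suc k))" "v \<in> V (Suc k)" "q \<in> V k"
    "c = sd x + obd ori v + q"
proof -
  let ?W = "{a + b | a b. a \<in> sd ` supp (cells N (Suc k)) \<and> b \<in> obd ori ` V (Suc k)}"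
  have "subspace ?W"
    by (intro subspace_sums linear_subspace_image linear_subdiv_map linear_obd subspace_supp subspace_V)
  moreover have sub: "?W \<subseteq> supp (cells M (Suc k))"
    using subdiv_map_cells obd_cells[OF M.face_closed_K] V_supp[of "Suc k"]
    by (auto intro!: supp_intros)
  ultimately obtain p where p: "p \<in> ?W" "\<And>w. w \<in> ?W \<Longrightarrow> chain_inner w (c - p) = 0"
    using orthogonal_projection[OF finite_cells, of ?W "Suc k" c] by blast
  have 0: "0 \<in> supp (cells N (Suc k))" "0 \<in> V (Suc k)"
    by (simp_all add: supp_intros subspace_0[OF subspace_V])
  have sdW: "sd x \<in> ?W" if "x \<in> supp (cells N (Suc k))" for x
    using that 0(2) by (intro CollectI exI[of _ "sd x"] exI[of _ 0]) (auto intro: image_eqI[of _ _ 0])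
  have bdW: "obd ori v \<in> ?W" if "v \<in> V (Suc k)" for v
    using that 0(1) by (intro CollectI exI[of _ 0] exI[of _ "obd ori v"]) (auto intro: image_eqI[of _ _ 0])
  have "c - p \<in> supp (cells M (Suc k))"
    using assms p(1) sub by (intro supp_intros) auto
  then have "c - p \<in> V k"
    unfolding V_iff using p(2)[OF sdW] p(2)[OF bdW] by blast
  moreover obtain x v where "x \<in> supp (cells N (Suc k))" "v \<in> V (Suc k)" "p = sd x + obd ori v"
    using p(1) by blast
  ultimately show ?thesis
    using that[of x v "c - p"] by simp
qed

lemma cells_supp_U: "c \<in> supp (cells M n) \<Longrightarrow> c \<in> supp U"
  using M_U by (auto simp: supp_def cells_def)

lemma obd_decomposition:
  assumes "x \<in> supp (cells N (Suc (Suc k)))" "v \<in> V (Suc (Suc k))"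
  shows "obd ori (sd x + obd ori v + q) = sd (obd ori x) + obd ori q"
  using obd_subdiv_map[OF supp_cells_supp[OF assms(1)]] V_supp[of "Suc (Suc k)"] assms(2)
    obd_obd[OF cells_supp_U] by auto

lemma im_subdiv_Int_bd_V:
  assumes M0: "{} \<in> M" and v: "v \<in> V (Suc k)" and x: "x \<in> supp (cells N (Suc k))" and eq: "obd ori v = sd x"
  shows "v = 0"
proof -
  obtain z u where z: "z \<in> supp (cells N (Suc (Suc k)))" and u: "u \<in> supp (cells M (Suc (Suc (Suc k))))"
    and vzu: "v = sd z + obd ori u"
    using relative_cycle_bounds[OF M0 _ x eq] v V_supp by blast
  \<comment> \<open>Relative homology yields an arbitrary u. Decomposing it replaces the boundary of
    u by that of v1, which is in the next \<open>V\<close>, at the price of an element of the image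
    of \<open>sd\<close>; now v is orthogonal to both summands.\<close>
  obtain a v2 v1 where a: "a \<in> supp (cells N (Suc (Suc (Suc k))))" and v2: "v2 \<in> V (Suc (Suc (Suc k)))"
    and v1: "v1 \<in> V (Suc (Suc k))" and dec: "u = sd a + obd ori v2 + v1"
    by (rule decomposition[OF u])
  have "v = sd (z + obd ori a) + obd ori v1"
    using vzu obd_decomposition[OF a v2, of v1] by (simp add: dec)
  moreover have "z + obd ori a \<in> supp (cells N (Suc (Suc k)))"
    using z obd_cells[OF N.face_closed_K a] by (intro supp_intros)
  moreover have "chain_inner (sd x') v = 0" if "x' \<in> supp (cells N (Suc (Suc k)))" for x'
    using v that V_iff by blast
  moreover have "chain_inner (obd ori v1) v = 0"
    using v v1 V_iff by blast
  ultimately have "chain_inner v v = 0"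
    by (metis add.right_neutral linear_add linear_chain_inner_left)
  then show ?thesis
    by simp
qed

section \<open>The up-Laplacian and coefficients of subdivided chains\<close>

definition cobd :: "nat \<Rightarrow> 'a chain \<Rightarrow> 'a chain" where
  "cobd n c = (\<Sum>T\<in>cells M (Suc n). chain_inner c (obd ori (bas T)) *\<^sub>R bas T)"

lemma lookup_cobd:
  "Poly_Mapping.lookup (cobd n c) T = (if T \<in> cells M (Suc n) then chain_inner c (obd ori (bas T)) else 0)"
proof -
  have "Poly_Mapping.lookup (cobd n c) T =
      (\<Sum>T'\<in>cells M (Suc n). if T' = T then chain_inner c (obd ori (bas T)) else 0)"
    unfolding cobd_def lookup_sum by (intro sum.cong refl) (simp add: lookup_single)
  then show ?thesis
    using finite_cells by simp
qed

lemma cobd_supp: "cobd n c \<in> supp (cells M (Suc n))"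
  by (simp add: supp_iff lookup_cobd)

text \<open>The purpose of \<open>cobd\<close>: it is the adjoint of the boundary, indexed by the
  number of vertices of the simplices in its argument.\<close>

lemma chain_inner_cobd:
  assumes "v \<in> supp (cells M (Suc n))"
  shows "chain_inner (cobd n c) v = chain_inner c (obd ori v)"
proof -
  have "chain_inner c (obd ori v) = lin (\<lambda>T. chain_inner c (obd ori (bas T))) v"
    using linear_eq_lin[OF linear_compose[OF linear_obd[of ori] linear_chain_inner_right[of c]], of v]
    by (simp add: o_def)
  also have "\<dots> = lin (Poly_Mapping.lookup (cobd n c)) v"
    by (rule lin_cong_supp[OF assms]) (simp add: lookup_cobd)
  finally have "chain_inner c (obd ori v) = chain_inner v (cobd n c)"
    by (simp only: chain_inner_eq_lin)
  then show ?thesis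
    by (simp only: chain_inner_commute[of "cobd n c" v])
qed

text \<open>By adjointness and \<open>orth\<close>, \<open>cobd (Suc k) (sd x)\<close> is orthogonal
  to \<open>V (Suc k)\<close>, so it is a sum \<open>sd a + obd ori b\<close>. The boundary kills
  the second summand and commutes with \<open>sd\<close> on the first.\<close>

lemma laplacian_im_subdiv:
  assumes orth: "\<And>x v. x \<in> supp (cells N (Suc k)) \<Longrightarrow> v \<in> V (Suc k) \<Longrightarrow> chain_inner (sd x) (obd ori v) = 0"
    and x: "x \<in> supp (cells N (Suc k))"
  obtains y where "y \<in> supp (cells N (Suc k))" "obd ori (cobd (Suc k) (sd x)) = sd y"
proof -
  obtain a b q where a: "a \<in> supp (cells N (Suc (Suc k)))" and b: "b \<in> V (Suc (Suc k))"
    and q: "q \<in> V (Suc k)" and dec: "cobd (Suc k) (sd x) = sd a + obd ori b + q"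
    by (rule decomposition[OF cobd_supp])
  have "chain_inner (cobd (Suc k) (sd x)) q = 0"
    using chain_inner_cobd[of q "Suc k"] q V_supp[of "Suc k"] orth[OF x q] by auto
  moreover have "chain_inner (sd a) q = 0" "chain_inner (obd ori b) q = 0"
    using q a b V_iff by blast+
  ultimately have "chain_inner q q = 0"
    by (simp add: dec)
  then have "q = 0"
    by simp
  then have "obd ori (cobd (Suc k) (sd x)) = sd (obd ori a)"
    using obd_decomposition[OF a b, of q] by (simp add: dec)
  then show ?thesis
    using that obd_cells[OF N.face_closed_K a] by blast
qed

lemma unique_cell:
  assumes F: "F \<in> cells M n" and G: "G \<in> cells N n" "F \<subseteq> G"
  shows "carrier_cell F = G"
proof (rule N.eq_if_subset_length)
  have FM: "F \<in> M" and GN: "G \<in> N"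
    using F G by (auto simp: cells_def)
  show G_N: "G \<in> N"
    by (rule GN)
  show C: "carrier_cell F \<in> N" and sub: "carrier_cell F \<subseteq> G"
    using carrier_cell[OF FM] GN G(2) by auto
  have "aff_dim F \<le> aff_dim (carrier_cell F)" "aff_dim (carrier_cell F) \<le> aff_dim G"
    using carrier_cell(2)[OF FM] sub by (auto intro: aff_dim_subset)
  then show "length (ori (carrier_cell F)) = length (ori G)"
    using aff_dim_ori[OF M.KU[OF FM]] aff_dim_ori[OF N.KU[OF C]] aff_dim_ori[OF N.KU[OF GN]] F G(1)
    by (simp add: cells_def)
qed

lemma lookup_sd_bas:
  assumes "G \<in> cells N n"
  shows "Poly_Mapping.lookup (sd (bas G)) F =
    (if F \<in> cells M n \<and> F \<subseteq> G then sgn (vol (ori G) (ori F)) else 0)"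
proof -
  have G: "G \<in> N" "length (ori G) = n" "convex hull (set (ori G)) = G"
    using assms hull_ori N.KU by (auto simp: cells_def)
  show ?thesis
    unfolding subdiv_map_bas[OF G(1)] lookup_subd G(2,3) ..
qed

lemma lookup_sd_bas_unit:
  assumes "G \<in> cells N n" "F \<in> cells M n" "F \<subseteq> G"
  shows "\<bar>Poly_Mapping.lookup (sd (bas G)) F\<bar> = 1"
proof -
  have "vol (ori G) (ori F) \<noteq> 0"
    using assms N.KU M.KU by (intro vol_ori_nonzero) (auto simp: cells_def distinct_ori)
  then show ?thesis
    using assms by (simp add: lookup_sd_bas[OF assms(1)] abs_sgn_eq)
qed

text \<open>A cell of \<open>M\<close> lies in at most one cell of \<open>N\<close> of the same
  dimension, its carrier. So a coefficient of a subdivided chain is, up to sign, a single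
  coefficient of the original.\<close>

lemma lookup_sd:
  assumes y: "y \<in> supp (cells N n)"
  shows "Poly_Mapping.lookup (sd y) F = (if F \<in> cells M n \<and> carrier_cell F \<in> cells N n
    then Poly_Mapping.lookup y (carrier_cell F) * Poly_Mapping.lookup (sd (bas (carrier_cell F))) F else 0)"
proof -
  have "sd y = lin (\<lambda>G. sd (bas G)) y"
    by (rule linear_eq_lin[OF linear_subdiv_map])
  then have "Poly_Mapping.lookup (sd y) F = lin (\<lambda>G. Poly_Mapping.lookup (sd (bas G)) F) y"
    by (simp add: lookup_lin)
  also have "\<dots> = (\<Sum>G\<in>Poly_Mapping.keys y. Poly_Mapping.lookup y G * Poly_Mapping.lookup (sd (bas G)) F)"
    by (simp add: lin_def)
  also have "\<dots> = (\<Sum>G\<in>Poly_Mapping.keys y. if G = carrier_cell F then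
      (if F \<in> cells M n \<and> carrier_cell F \<in> cells N n
       then Poly_Mapping.lookup y (carrier_cell F) * Poly_Mapping.lookup (sd (bas (carrier_cell F))) F else 0) else 0)"
  proof (rule sum.cong[OF refl])
    fix G assume "G \<in> Poly_Mapping.keys y"
    then have G: "G \<in> cells N n"
      using y by (auto simp: supp_def)
    show "Poly_Mapping.lookup y G * Poly_Mapping.lookup (sd (bas G)) F = (if G = carrier_cell F then
      (if F \<in> cells M n \<and> carrier_cell F \<in> cells N n
       then Poly_Mapping.lookup y (carrier_cell F) * Poly_Mapping.lookup (sd (bas (carrier_cell F))) F else 0) else 0)"
    proof (cases "F \<in> cells M n \<and> F \<subseteq> G")
      case True
      then have "carrier_cell F = G"
        using unique_cell[OF _ G] by blast
      then show ?thesis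
        using True G by simp
    next
      case False
      then have "Poly_Mapping.lookup (sd (bas G)) F = 0"
        unfolding lookup_sd_bas[OF G] by (rule if_not_P)
      moreover have "\<not> (F \<in> cells M n \<and> G = carrier_cell F)"
        using False carrier_cell(2)[of F] by (auto simp: cells_def)
      ultimately show ?thesis
        by auto
    qed
  qed
  also have "\<dots> = (if F \<in> cells M n \<and> carrier_cell F \<in> cells N n
    then Poly_Mapping.lookup y (carrier_cell F) * Poly_Mapping.lookup (sd (bas (carrier_cell F))) F else 0)"
    by (auto simp: in_keys_iff)
  finally show ?thesis .
qed

text \<open>Without such cells the subdivision map would send G to 0, but it has a left
  inverse.\<close>

lemma top_cell_exists:
  assumes M0: "{} \<in> M" and G: "G \<in> cells N n"
  obtains F where "F \<in> cells M n" "F \<subseteq> G"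
proof -
  have "sd (bas G) \<noteq> 0"
  proof
    assume "sd (bas G) = 0"
    then have "retr (sd (bas G)) = 0"
      by simp
    moreover have "retr (sd (bas G)) = bas G"
      using retr_subdiv_map[OF M0, of "bas G" n] G by simp
    ultimately show False
      by (metis lookup_single_eq lookup_zero zero_neq_one)
  qed
  then obtain F where "Poly_Mapping.lookup (sd (bas G)) F \<noteq> 0"
    by (metis poly_mapping_eqI lookup_zero)
  then show ?thesis
    using that lookup_sd_bas[OF G, of F] by (auto split: if_splits)
qed

lemma lookup_obd_bas_nonzero:
  assumes "T \<in> U" "Poly_Mapping.lookup (obd ori (bas T)) F \<noteq> 0"
  shows "F \<in> U" "set (ori F) \<subseteq> set (ori T)" "Suc (length (ori F)) = length (ori T)"
  using obd_bas_supp[OF assms(1)] assms(2) by (auto simp: supp_iff)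

lemma lookup_obd_bas_unit:
  assumes T: "T \<in> U" and F: "F \<in> U" "set (ori F) \<subseteq> set (ori T)" "Suc (length (ori F)) = length (ori T)"
  shows "\<bar>Poly_Mapping.lookup (obd ori (bas T)) F\<bar> = 1"
proof -
  have "card (set (ori T) - set (ori F)) = 1"
    using length_ori[OF T] length_ori[OF F(1)] F(2,3) by (simp add: card_Diff_subset)
  then obtain a where "set (ori T) - set (ori F) = {a}"
    using card_1_singletonE by blast
  then have "set (ori T) = insert a (set (ori F))" "a \<notin> set (ori F)"
    using F(2) by blast+
  then obtain s where "s = 1 \<or> s = (-1::real)" "Poly_Mapping.lookup (obd ori (bas T)) F = s"
    using incidence[OF T F(1)] by metis
  then show ?thesis
    by auto
qed

lemma two_facets_span:
  assumes T: "T \<in> U" and F: "F \<in> U" "set (ori F) \<subseteq> set (ori T)" "Suc (length (ori F)) = length (ori T)"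
    and F': "F' \<in> U" "set (ori F') \<subseteq> set (ori T)" "Suc (length (ori F')) = length (ori T)" and "F \<noteq> F'"
  shows "set (ori T) = set (ori F) \<union> set (ori F')"
proof -
  have "set (ori F) \<noteq> set (ori F')"
    using \<open>F \<noteq> F'\<close> eq_if_set_ori_eq F(1) F'(1) by blast
  then have "\<not> set (ori F') \<subseteq> set (ori F)"
    using card_subset_eq[of "set (ori F)" "set (ori F')"] length_ori F F' by auto
  then have "card (set (ori F)) < card (set (ori F) \<union> set (ori F'))"
    by (intro psubset_card_mono) auto
  then have "card (set (ori T)) \<le> card (set (ori F) \<union> set (ori F'))"
    using length_ori[OF T] length_ori[OF F(1)] F(3) by simp
  then show ?thesis
    using F(2) F'(2) by (metis Un_least card_seteq finite_set)
qed

lemma subset_convex_if_ori: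
  assumes "T \<in> U" "set (ori T) \<subseteq> S" "convex S"
  shows "T \<subseteq> S"
  using hull_minimal[of "set (ori T)" S convex, OF assms(2,3)] hull_ori[OF assms(1)] by simp

lemma chain_inner_sd_obd:
  assumes "chain_inner (sd (bas G)) (obd ori (bas T)) \<noteq> 0" "G \<in> cells N n" "T \<in> U"
  obtains F where "F \<in> cells M n" "F \<subseteq> G" "Poly_Mapping.lookup (obd ori (bas T)) F \<noteq> 0"
proof -
  obtain F where F: "Poly_Mapping.lookup (sd (bas G)) F * Poly_Mapping.lookup (obd ori (bas T)) F \<noteq> 0"
    using assms(1) unfolding chain_inner_def by (meson sum.neutral)
  then have "F \<in> cells M n \<and> F \<subseteq> G"
    using lookup_sd_bas[OF assms(2), of F] by (auto split: if_splits)
  then show ?thesis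
    using that F by auto
qed

lemma lookup_laplacian:
  "Poly_Mapping.lookup (obd ori (cobd n c)) F =
    (\<Sum>T\<in>cells M (Suc n). chain_inner c (obd ori (bas T)) * Poly_Mapping.lookup (obd ori (bas T)) F)"
  unfolding cobd_def linear_sum[OF linear_obd] lookup_sum by simp

end

subsection \<open>Angles that are not right\<close>

context subdivided
begin

lemma coface_apex:
  assumes "T \<in> cells M (Suc n)" "T \<subseteq> S" "F \<in> cells M n" "set (ori F) \<subseteq> set (ori T)"
  obtains a where "a \<in> apexes S F" "T = convex hull (insert a (set (ori F)))"
proof -
  have T: "T \<in> M" and F: "F \<in> M"
    using assms by (auto simp: cells_def)
  have "card (set (ori T) - set (ori F)) = 1"
    using length_ori[OF M.KU[OF T]] length_ori[OF M.KU[OF F]] assms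
    by (simp add: card_Diff_subset cells_def)
  then obtain a where "set (ori T) - set (ori F) = {a}"
    using card_1_singletonE by blast
  then have "set (ori T) = insert a (set (ori F))" "a \<notin> set (ori F)"
    using assms(4) by blast+
  from apexI[OF T assms(2) this] that show ?thesis
    by blast
qed

lemma coface_exists:
  assumes S: "S \<in> cells N (Suc n)" and F: "F \<in> cells M n" "F \<subseteq> S" and n: "n > 0"
  obtains T where "T \<in> cells M (Suc n)" "T \<subseteq> S" "set (ori F) \<subseteq> set (ori T)"
proof -
  have SN: "S \<in> N" and FM: "F \<in> M" and len: "length (ori S) = Suc (length (ori F))"
    using S F by (auto simp: cells_def)
  have "F \<noteq> {}"
    using F(1) n set_ori_subset[OF M.KU[OF FM]] by (auto simp: cells_def)
  obtain v where v: "v \<in> set (ori S)" "vol (ori S) (v # ori F) \<noteq> 0"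
    using exists_vol_nonzero[OF N.KU[OF SN] M.KU[OF FM] F(2) len] .
  let ?c = "sgn (vol (ori S) (v # ori F))"
  have vS: "v \<in> S"
    using v(1) set_ori_subset[OF N.KU[OF SN]] by blast
  have "?c * vol (ori S) (v # ori F) > 0"
    using v(2) by (simp add: sgn_mult_self_eq mult.commute flip: abs_sgn)
  from apex_exists[OF SN FM F(2) \<open>F \<noteq> {}\<close> vS this] obtain a where a: "a \<in> apexes S F"
    by blast
  let ?T = "convex hull (insert a (set (ori F)))"
  have T: "?T \<in> M" "?T \<subseteq> S" "set (ori ?T) = insert a (set (ori F))" "a \<notin> set (ori F)"
    using a by (auto simp: apexes_def)
  moreover have "length (ori ?T) = Suc n"
    using length_ori[OF M.KU[OF T(1)]] length_ori[OF M.KU[OF FM]] T(3,4) F(1) by (simp add: cells_def)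
  ultimately show ?thesis
    using that[of ?T] by (auto simp: cells_def)
qed

text \<open>S lies on one side of its facet G: the signed volume over F is a constant times the
  coordinate opposite to G, which is nonnegative on S. Two apexes over F are thus on the same side
  and coincide.\<close>

lemma boundary_coface_unique:
  assumes S: "S \<in> cells N (Suc n)" and G: "G \<in> cells N n" "G \<subseteq> S"
    and F: "F \<in> cells M n" "F \<subseteq> G" and n: "n > 0"
    and T: "T \<in> cells M (Suc n)" "T \<subseteq> S" "set (ori F) \<subseteq> set (ori T)"
    and T': "T' \<in> cells M (Suc n)" "T' \<subseteq> S" "set (ori F) \<subseteq> set (ori T')"
  shows "T = T'"
proof -
  have SN: "S \<in> N" and GN: "G \<in> N" and FM: "F \<in> M" and len: "length (ori S) = Suc (length (ori F))"
    using S G F by (auto simp: cells_def)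
  have FU: "F \<in> U" and SU: "S \<in> U" and GU: "G \<in> U"
    using FM SN GN M.KU N.KU by auto
  have "F \<noteq> {}"
    using F(1) n set_ori_subset[OF FU] by (auto simp: cells_def)
  have sub: "set (ori G) \<subseteq> set (ori S)"
    by (rule N.subset_imp_set_ori_subset[OF SN GN G(2)])
  then have "card (set (ori S) - set (ori G)) = 1"
    using length_ori[OF SU] length_ori[OF GU] S G by (simp add: card_Diff_subset cells_def)
  then obtain s where s: "set (ori S) - set (ori G) = {s}"
    using card_1_singletonE by blast
  then have "s \<in> set (ori S)"
    by blast
  then obtain j where j: "j < length (ori S)" "s = ori S ! j"
    unfolding in_set_conv_nth by blast
  have del: "set (del j (ori S)) = set (ori G)"
    unfolding set_del[OF distinct_ori[OF SU] j(1)] using s j(2) sub by blast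
  have "set (ori F) \<subseteq> affine hull (set (del j (ori S)))"
    unfolding del using set_ori_subset[OF FU] F(2) subset_affine_hull_ori[OF GU] by blast
  note h = vol_Cons_facet[OF ori_independent[OF SU] distinct_ori[OF SU] j(1) this]
  obtain a where a: "a \<in> apexes S F" "T = convex hull (insert a (set (ori F)))"
    by (rule coface_apex[OF T(1,2) F(1) T(3)])
  obtain b where b: "b \<in> apexes S F" "T' = convex hull (insert b (set (ori F)))"
    by (rule coface_apex[OF T'(1,2) F(1) T'(3)])
  let ?b = "\<lambda>q. bary (set (ori S)) q (ori S ! j)" and ?v = "vol (del j (ori S)) (ori F)"
  have "vol (ori S) (a # ori F) * vol (ori S) (b # ori F) = ((-1) ^ j * (-1) ^ j) * (?b a * ?b b) * (?v * ?v)"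
    unfolding h by (simp only: mult_ac)
  also have "\<dots> = ?b a * ?b b * (?v * ?v)"
    by (simp flip: power_add mult_2)
  finally have prod: "vol (ori S) (a # ori F) * vol (ori S) (b # ori F) = ?b a * ?b b * (?v * ?v)" .
  have "?b a \<ge> 0" "?b b \<ge> 0"
    using mem_iff_bary[OF SU, of a] mem_iff_bary[OF SU, of b] apex_subset[OF a(1)] apex_subset[OF b(1)] j(1)
    by auto
  then have "?b a * ?b b * (?v * ?v) \<ge> 0"
    by (simp only: mult_nonneg_nonneg zero_le_square)
  then have "vol (ori S) (a # ori F) * vol (ori S) (b # ori F) > 0"
    unfolding prod[symmetric] using apex_nonzero[OF SN FM len a(1)] apex_nonzero[OF SN FM len b(1)]
    by (simp add: order.order_iff_strict)
  then have "a = b"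
    by (rule apex_same_side[OF SN FM \<open>F \<noteq> {}\<close> len a(1) b(1)])
  then show ?thesis
    using a(2) b(2) by simp
qed

text \<open>T has no second facet inside G, since two facets contain all vertices of T, which would
  put T into G against its dimension.\<close>

lemma chain_inner_sd_obd_facet:
  assumes T: "T \<in> cells M (Suc n)" and G: "G \<in> cells N n"
    and F: "F \<in> cells M n" "F \<subseteq> G" "set (ori F) \<subseteq> set (ori T)"
  shows "chain_inner (sd (bas G)) (obd ori (bas T)) =
    Poly_Mapping.lookup (sd (bas G)) F * Poly_Mapping.lookup (obd ori (bas T)) F"
proof -
  have TM: "T \<in> M" and FM: "F \<in> M" and GN: "G \<in> N"
    using T F G by (auto simp: cells_def)
  have TU: "T \<in> U" and FU: "F \<in> U" and GU: "G \<in> U"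
    using TM FM GN M.KU N.KU by auto
  have "chain_inner (sd (bas G)) (obd ori (bas T)) =
      (\<Sum>F'\<in>cells M n. Poly_Mapping.lookup (sd (bas G)) F' * Poly_Mapping.lookup (obd ori (bas T)) F')"
    using subdiv_map_cells[of "bas G" n] G by (intro chain_inner_superset finite_cells) (auto simp: supp_def)
  also have "\<dots> = (\<Sum>F'\<in>{F}. Poly_Mapping.lookup (sd (bas G)) F' * Poly_Mapping.lookup (obd ori (bas T)) F')"
  proof (rule sum.mono_neutral_right[OF finite_cells])
    show "\<forall>F'\<in>cells M n - {F}. Poly_Mapping.lookup (sd (bas G)) F' * Poly_Mapping.lookup (obd ori (bas T)) F' = 0"
    proof (rule ballI, rule ccontr)
      fix F' assume F': "F' \<in> cells M n - {F}"
        and nz: "Poly_Mapping.lookup (sd (bas G)) F' * Poly_Mapping.lookup (obd ori (bas T)) F' \<noteq> 0"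
      have "F' \<subseteq> G"
        using nz lookup_sd_bas[OF G, of F'] by (auto split: if_splits)
      have F'2: "F' \<in> U" "set (ori F') \<subseteq> set (ori T)" "Suc (length (ori F')) = length (ori T)"
        using lookup_obd_bas_nonzero[OF TU, of F'] nz by auto
      have "set (ori T) = set (ori F) \<union> set (ori F')"
        by (rule two_facets_span[OF TU FU F(3) _ F'2]) (use T F F' in \<open>auto simp: cells_def\<close>)
      then have "set (ori T) \<subseteq> G"
        using set_ori_subset[OF FU] set_ori_subset[OF F'2(1)] F(2) \<open>F' \<subseteq> G\<close> by blast
      then have "T \<subseteq> G"
        by (rule subset_convex_if_ori[OF TU _ convex_U[OF GU]])
      then have "aff_dim T \<le> aff_dim G"
        by (rule aff_dim_subset)
      then show False
        using aff_dim_ori[OF TU] aff_dim_ori[OF GU] T G by (simp add: cells_def)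
    qed
  qed (use F(1) in auto)
  finally show ?thesis
    by simp
qed

text \<open>The Laplacian of an unchanged face G of S is nonzero on a cell F that has a vertex u of
  \<open>M\<close> which is not a vertex of S. As the proper faces of S are unchanged, F lies in no
  cell of \<open>N\<close> of its own dimension, so the coefficient should vanish.\<close>

lemma laplacian_not_preserved_if_skeleton_unchanged:
  assumes L: "\<And>G. G \<in> cells N n \<Longrightarrow> \<exists>y\<in>supp (cells N n). obd ori (cobd n (sd (bas G))) = sd y"
    and n: "n > 0" and S: "S \<in> N" "S \<notin> M" "n < length (ori S)"
    and faces: "\<And>A. A \<subset> set (ori S) \<Longrightarrow> convex hull A \<in> M"
  shows False
proof -
  have SU: "S \<in> U"
    using S(1) by (rule N.KU)
  obtain A where A: "A \<subseteq> set (ori S)" "card A = n" "finite A"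
    using obtain_subset_with_card_n[of n "set (ori S)"] S(3) length_ori[OF SU] by auto
  then have "A \<noteq> set (ori S)"
    using S(3) length_ori[OF SU] by auto
  let ?G = "convex hull A"
  have GM: "?G \<in> M"
    using faces A(1) \<open>A \<noteq> set (ori S)\<close> by blast
  have GN: "?G \<in> N"
    by (rule N.hull_in_K[OF S(1) A(1)])
  have oG: "set (ori ?G) = A"
    by (rule set_ori_hull[OF SU A(1)])
  have lenG: "length (ori ?G) = n"
    using length_ori[OF M.KU[OF GM]] oG A(2) by simp
  have GS: "?G \<subseteq> S"
    using hull_mono[OF A(1), of convex] hull_ori[OF SU] by simp
  obtain g where g: "g \<in> A"
    using A(2) n by fastforce
  have "?G \<noteq> {}"
    using g by auto
  then obtain x where x: "x \<in> rel_interior ?G"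
    using rel_interior_nonempty[OF M.KU[OF GM]] by blast
  have "S \<noteq> {}"
    using GS \<open>?G \<noteq> {}\<close> by blast
  then obtain q where q: "q \<in> rel_interior S"
    using rel_interior_nonempty[OF SU] by blast
  then have qS: "q \<in> S"
    using rel_interior_subset by blast
  \<comment> \<open>A move from G towards the relative interior of S enters a simplex of
    \<open>M\<close> that contains G and, as is shown next, a relative interior point of S.\<close>
  obtain T e where T: "T \<in> M" "T \<subseteq> S" "?G \<subseteq> T" and e: "0 < e" "e \<le> 1" and y: "x + e *\<^sub>R (q - x) \<in> T"
    by (rule star_segment[OF S(1) GM GS x qS])
  have xS: "x \<in> S"
    using x GS rel_interior_subset by blast
  have yS: "x + e *\<^sub>R (q - x) \<in> rel_interior S"
  proof -
    have "bary (set (ori S)) (x + e *\<^sub>R (q - x)) v > 0" if v: "v \<in> set (ori S)" for v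
    proof -
      have "bary (set (ori S)) (x + e *\<^sub>R (q - x)) v = (1 - e) * bary (set (ori S)) x v + e * bary (set (ori S)) q v"
        using xS qS v by (intro bary_segment ori_independent SU) (auto simp: mem_iff_bary[OF SU])
      moreover have "(1 - e) * bary (set (ori S)) x v \<ge> 0" "e * bary (set (ori S)) q v > 0"
        using xS v e q by (auto simp: mem_iff_bary[OF SU] rel_interior_iff[OF SU])
      ultimately show ?thesis
        by linarith
    qed
    then show ?thesis
      using y T(2) by (auto simp: rel_interior_iff[OF SU] mem_iff_bary[OF SU])
  qed
  have TU: "T \<in> U"
    using T(1) by (rule M.KU)
  \<comment> \<open>Otherwise T would be a face of S that meets the relative interior of S, hence S
    itself, which is not in \<open>M\<close>.\<close>
  have "\<not> set (ori T) \<subseteq> set (ori S)"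
  proof
    assume "set (ori T) \<subseteq> set (ori S)"
    then have "T \<in> N"
      using N.hull_in_K[OF S(1)] hull_ori[OF TU] by metis
    then have "S \<subseteq> T"
      by (rule N.rel_interior_meets_imp_subset[OF S(1) _ yS y])
    then show False
      using T(1,2) S(2) by simp
  qed
  then obtain u where u: "u \<in> set (ori T)" "u \<notin> set (ori S)"
    by blast
  have uA: "u \<notin> A"
    using u(2) A(1) by blast
  have AT: "A \<subseteq> set (ori T)"
    using M.subset_imp_set_ori_subset[OF T(1) GM T(3)] oG by simp
  \<comment> \<open>F exchanges the vertex g of G for u; both are facets of
    \<open>?T\<close>.\<close>
  let ?T = "convex hull (insert u A)" and ?F = "convex hull (insert u (A - {g}))"
  have TM: "?T \<in> M" and FM: "?F \<in> M"
    using M.hull_in_K[OF T(1), of "insert u A"] M.hull_in_K[OF T(1), of "insert u (A - {g})"] u(1) AT by auto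
  have oT: "set (ori ?T) = insert u A" and oF: "set (ori ?F) = insert u (A - {g})"
    using set_ori_hull[OF TU, of "insert u A"] set_ori_hull[OF TU, of "insert u (A - {g})"] u(1) AT by auto
  have lenT: "length (ori ?T) = Suc n" and lenF: "length (ori ?F) = n"
    using length_ori[OF M.KU[OF TM]] length_ori[OF M.KU[OF FM]] oT oF A(2,3) uA g n by auto
  have Gc: "?G \<in> cells N n" "?G \<in> cells M n" and Fc: "?F \<in> cells M n" and Tc: "?T \<in> cells M (Suc n)"
    using GN GM FM TM lenG lenF lenT by (auto simp: cells_def)
  have sdG: "sd (bas ?G) = bas ?G"
    by (rule subdiv_map_common[OF GN GM])
  obtain y where y: "y \<in> supp (cells N n)" "obd ori (cobd n (sd (bas ?G))) = sd y"
    using L[OF Gc(1)] by blast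
  have "Poly_Mapping.lookup (sd y) ?F = (\<Sum>T'\<in>cells M (Suc n).
      Poly_Mapping.lookup (obd ori (bas T')) ?G * Poly_Mapping.lookup (obd ori (bas T')) ?F)"
    unfolding y(2)[symmetric] lookup_laplacian sdG by simp
  \<comment> \<open>Together G and F have all vertices of \<open>?T\<close>, so it is their only
    common coface and nothing can cancel.\<close>
  also have "\<dots> = (\<Sum>T'\<in>{?T}.
      Poly_Mapping.lookup (obd ori (bas T')) ?G * Poly_Mapping.lookup (obd ori (bas T')) ?F)"
  proof (rule sum.mono_neutral_right[OF finite_cells])
    show "\<forall>T'\<in>cells M (Suc n) - {?T}.
        Poly_Mapping.lookup (obd ori (bas T')) ?G * Poly_Mapping.lookup (obd ori (bas T')) ?F = 0"
    proof (rule ballI, rule ccontr)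
      fix T' assume T': "T' \<in> cells M (Suc n) - {?T}"
        and nz: "Poly_Mapping.lookup (obd ori (bas T')) ?G * Poly_Mapping.lookup (obd ori (bas T')) ?F \<noteq> 0"
      have T'U: "T' \<in> U"
        using T' M.KU by (auto simp: cells_def)
      have "insert u A \<subseteq> set (ori T')"
        using lookup_obd_bas_nonzero(2)[OF T'U, of ?G] lookup_obd_bas_nonzero(2)[OF T'U, of ?F] nz oG oF by auto
      moreover have "card (set (ori T')) = card (insert u A)"
        using T' length_ori[OF T'U] length_ori[OF M.KU[OF TM]] lenT oT by (simp add: cells_def)
      ultimately have "set (ori T') = insert u A"
        by (metis card_subset_eq finite_set)
      then have "T' = ?T"
        using hull_ori[OF T'U] by simp
      then show False
        using T' by blast
    qed
  qed (use Tc in auto)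
  finally have "\<bar>Poly_Mapping.lookup (sd y) ?F\<bar> =
      \<bar>Poly_Mapping.lookup (obd ori (bas ?T)) ?G\<bar> * \<bar>Poly_Mapping.lookup (obd ori (bas ?T)) ?F\<bar>"
    by (simp add: abs_mult)
  also have "\<bar>Poly_Mapping.lookup (obd ori (bas ?T)) ?G\<bar> = 1"
    by (rule lookup_obd_bas_unit[OF M.KU[OF TM] M.KU[OF GM]]) (use oT oG lenT lenG in auto)
  also have "\<bar>Poly_Mapping.lookup (obd ori (bas ?T)) ?F\<bar> = 1"
    by (rule lookup_obd_bas_unit[OF M.KU[OF TM] M.KU[OF FM]]) (use oT oF lenT lenF in auto)
  finally have "Poly_Mapping.lookup (sd y) ?F \<noteq> 0"
    by auto
  then have G': "carrier_cell ?F \<in> cells N n"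
    using lookup_sd[OF y(1), of ?F] by (auto split: if_splits)
  \<comment> \<open>By dimension, the carrier of F meets S in a proper face. This face is a simplex
    of \<open>M\<close>, so u would be one of its vertices and hence a vertex of S.\<close>
  let ?H = "S \<inter> carrier_cell ?F"
  have "?H face_of S"
    using N.Int_face[OF S(1)] G' by (auto simp: cells_def)
  then have HU: "?H \<in> U" and oH: "set (ori ?H) \<subseteq> set (ori S)"
    using face_iff[OF SU] by blast+
  have "set (ori ?H) \<noteq> set (ori S)"
  proof
    assume "set (ori ?H) = set (ori S)"
    then have "aff_dim S \<le> aff_dim (carrier_cell ?F)"
      using eq_if_set_ori_eq[OF HU SU] by (intro aff_dim_subset) auto
    then show False
      using aff_dim_ori[OF SU] aff_dim_ori[OF N.KU, of "carrier_cell ?F"] G' S(3) by (simp add: cells_def)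
  qed
  then have HM: "?H \<in> M"
    using faces[of "set (ori ?H)"] oH hull_ori[OF HU] by auto
  have uM: "{u} \<in> M"
    using M.hull_in_K[OF T(1), of "{u}"] u(1) by simp
  have "u \<in> S"
    using u(1) set_ori_subset[OF TU] T(2) by blast
  moreover have "u \<in> carrier_cell ?F"
    using carrier_cell(2)[OF FM] hull_inc[of u "insert u (A - {g})" convex] by auto
  ultimately have "set (ori {u}) \<subseteq> set (ori ?H)"
    by (intro M.subset_imp_set_ori_subset[OF HM uM]) auto
  moreover have "set (ori {u}) = {u}"
    using set_ori_hull[OF TU, of "{u}"] u(1) by simp
  ultimately show False
    using oH u(2) by blast
qed

lemma subdiv_map_restrict:
  assumes S: "S \<in> N" and c: "c \<in> supp {G \<in> N. G \<subseteq> S}"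
  shows "subdiv_map ori {T \<in> M. T \<subseteq> S} c = sd c"
proof -
  interpret R: subdivided U ori "{G \<in> N. G \<subseteq> S}" "{T \<in> M. T \<subseteq> S}"
    by (rule subdivided_restrict[OF S])
  have "subdiv_map ori {T \<in> M. T \<subseteq> S} (bas G) = sd (bas G)" if G: "G \<in> {G \<in> N. G \<subseteq> S}" for G
  proof (rule poly_mapping_eqI)
    fix F
    have "convex hull (set (ori G)) \<subseteq> S"
      using G hull_ori[OF N.KU[of G]] by simp
    then have "F \<in> cells {T \<in> M. T \<subseteq> S} (length (ori G)) \<and> F \<subseteq> convex hull (set (ori G)) \<longleftrightarrow>
        F \<in> cells M (length (ori G)) \<and> F \<subseteq> convex hull (set (ori G))"
      by (auto simp: cells_def)
    then show "Poly_Mapping.lookup (subdiv_map ori {T \<in> M. T \<subseteq> S} (bas G)) F = Poly_Mapping.lookup (sd (bas G)) F"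
      using R.subdiv_map_bas[OF G] subdiv_map_bas[of G] G R.lookup_subd[of "ori G" F] lookup_subd[of "ori G" F]
      by simp
  qed
  then show ?thesis
    using linear_eq_lin[OF R.linear_subdiv_map, of c] linear_eq_lin[OF linear_subdiv_map, of c]
      lin_cong_supp[OF c, of "\<lambda>G. subdiv_map ori {T \<in> M. T \<subseteq> S} (bas G)" "\<lambda>G. sd (bas G)"] by simp
qed

text \<open>Send a vertex s of S to the vertex of T opposite to the facet that lies in the facet
  opposite to s. This map f is bijective, so t = f s lies in every facet of S except possibly the
  one opposite to s; therefore t = s.\<close>

lemma eq_if_facets_in_facets:
  assumes S: "S \<in> U" and T: "T \<in> U" "T \<subseteq> S" "length (ori T) = length (ori S)"
    and facets: "\<And>s. s \<in> set (ori S) \<Longrightarrow>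
      \<exists>t\<in>set (ori T). set (ori T) - {t} \<subseteq> convex hull (set (ori S) - {s})"
  shows "T = S"
proof -
  let ?X = "set (ori S)" and ?Y = "set (ori T)"
  have V: "\<not> affine_dependent ?X"
    by (rule ori_independent[OF S])
  obtain f where f: "\<And>s. s \<in> ?X \<Longrightarrow> f s \<in> ?Y" "\<And>s. s \<in> ?X \<Longrightarrow> ?Y - {f s} \<subseteq> convex hull (?X - {s})"
    using facets by metis
  have zero: "bary ?X t s = 0" if "s \<in> ?X" "t \<in> ?Y" "t \<noteq> f s" for s t
    using f(2)[OF that(1)] that convex_hull_face_iff_bary[OF V Diff_subset, of t "{s}"] by auto
  \<comment> \<open>A facet of T inside two different facets of S would lie in a face of S of
    codimension two, which has too small a dimension.\<close>
  have "inj_on f ?X"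
  proof (rule inj_onI, rule ccontr)
    fix s r assume sr: "s \<in> ?X" "r \<in> ?X" "f s = f r" "s \<noteq> r"
    have "t \<in> convex hull (?X - {s, r})" if t: "t \<in> ?Y - {f s}" for t
    proof -
      have "t \<in> convex hull ?X"
        using t set_ori_subset[OF T(1)] T(2) hull_ori[OF S] by blast
      moreover have "\<forall>v\<in>?X - (?X - {s, r}). bary ?X t v = 0"
        using zero[of s t] zero[of r t] t sr by auto
      ultimately show ?thesis
        using convex_hull_face_iff_bary[OF V Diff_subset, of t "{s, r}"] by blast
    qed
    then have "aff_dim (?Y - {f s}) \<le> aff_dim (convex hull (?X - {s, r}))"
      by (intro aff_dim_subset) blast
    moreover have "\<not> affine_dependent (?Y - {f s})" "\<not> affine_dependent (?X - {s, r})"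
      using affine_independent_subset[OF ori_independent[OF T(1)]] affine_independent_subset[OF V] by auto
    ultimately have "card (?Y - {f s}) \<le> card (?X - {s, r})"
      using aff_dim_affine_independent[of "?Y - {f s}"] aff_dim_affine_independent[of "?X - {s, r}"]
      by (simp add: aff_dim_convex_hull)
    moreover have "card (?Y - {f s}) = card ?Y - 1" "card (?X - {s, r}) = card ?X - 2"
      using f(1)[OF sr(1)] sr by (simp_all add: card_Diff_subset)
    moreover have "card {s, r} \<le> card ?X"
      using sr by (intro card_mono) auto
    then have "card ?X \<ge> 2"
      using sr(4) by simp
    ultimately show False
      using length_ori[OF S] length_ori[OF T(1)] T(3) by simp
  qed
  then have "card (f ` ?X) = card ?Y"
    using length_ori[OF S] length_ori[OF T(1)] T(3) by (simp add: card_image)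
  then have surj: "f ` ?X = ?Y"
    using f(1) by (intro card_subset_eq) auto
  have "t \<in> ?X" if t: "t \<in> ?Y" for t
  proof -
    obtain s where s: "s \<in> ?X" "t = f s"
      using surj t by blast
    have tA: "t \<in> affine hull ?X"
      using t set_ori_subset[OF T(1)] T(2) subset_affine_hull_ori[OF S] by blast
    have z: "bary ?X t r = 0" if "r \<in> ?X - {s}" for r
      using zero[of r t] that t s \<open>inj_on f ?X\<close> by (auto simp: inj_on_def)
    have "sum (bary ?X t) ?X = sum (bary ?X t) {s}"
      using s(1) z by (intro sum.mono_neutral_right) auto
    moreover have "(\<Sum>v\<in>?X. bary ?X t v *\<^sub>R v) = (\<Sum>v\<in>{s}. bary ?X t v *\<^sub>R v)"
      using s(1) z by (intro sum.mono_neutral_right) auto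
    ultimately have "t = s"
      using sum_bary[OF finite_set tA] bary_combination[OF finite_set tA] by simp
    then show ?thesis
      using s(1) by simp
  qed
  then have "?Y = ?X"
    using length_ori[OF S] length_ori[OF T(1)] T(3) by (intro card_subset_eq) auto
  then show ?thesis
    using eq_if_set_ori_eq[OF T(1) S] by blast
qed

lemma laplacian_not_preserved_if_cell_subdivided:
  assumes L: "\<And>G. G \<in> cells N n \<Longrightarrow> \<exists>y\<in>supp (cells N n). obd ori (cobd n (sd (bas G))) = sd y"
    and n: "n > 0" and S: "S \<in> cells N (Suc n)" "S \<notin> M"
  shows False
proof -
  have SN: "S \<in> N" and lenS: "length (ori S) = Suc n"
    using S by (auto simp: cells_def)
  have SU: "S \<in> U"
    using SN by (rule N.KU)
  let ?N = "{T \<in> N. T \<subseteq> S}" and ?M = "{T \<in> M. T \<subseteq> S}"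
  interpret R: subdivided U ori ?N ?M
    by (rule subdivided_restrict[OF SN])
  let ?T = "{T \<in> cells M (Suc n). T \<subseteq> S}"
  have finT: "finite ?T"
    using finite_cells by simp
  have TU: "T \<in> U" if "T \<in> ?T" for T
    using that M.KU by (auto simp: cells_def)
  have "S \<noteq> {}"
    using set_ori_subset[OF SU] lenS by auto
  then have M0: "{} \<in> ?M"
    using empty_in_M[OF SN] by simp
  have facet: "\<exists>F. F \<in> cells M n \<and> F \<subseteq> G \<and> set (ori F) \<subseteq> set (ori T)"
    if G: "G \<in> cells N n" "G \<subseteq> S" and T: "T \<in> ?T" for G T
  proof -
    have GN: "G \<in> N" and lenG: "length (ori G) = n"
      using G by (auto simp: cells_def)
    \<comment> \<open>These are the coefficients of the coboundary of the subdivided G; c is the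
      part of it inside S.\<close>
    define w where "w T = chain_inner (sd (bas G)) (obd ori (bas T))" for T
    define c where "c = (\<Sum>T\<in>?T. w T *\<^sub>R bas T)"
    have lookup_c: "Poly_Mapping.lookup c T = (if T \<in> ?T then w T else 0)" for T
    proof -
      have "Poly_Mapping.lookup c T = (\<Sum>T'\<in>?T. if T' = T then w T else 0)"
        unfolding c_def lookup_sum by (intro sum.cong refl) (simp add: lookup_single)
      then show ?thesis
        using finT by simp
    qed
    have lookup_bd: "Poly_Mapping.lookup (obd ori c) F =
        (\<Sum>T\<in>?T. w T * Poly_Mapping.lookup (obd ori (bas T)) F)" for F
      unfolding c_def linear_sum[OF linear_obd] lookup_sum by simp
    have c_supp: "c \<in> supp (cells ?M (Suc n))"
      by (auto simp: supp_iff lookup_c cells_def)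
    obtain y where y: "y \<in> supp (cells N n)" "obd ori (cobd n (sd (bas G))) = sd y"
      using L[OF G(1)] by blast
    let ?G = "cells ?N n"
    have finG: "finite ?G"
      by (rule finite_subset[OF _ R.N.finite_K]) (auto simp: cells_def)
    \<comment> \<open>Within S the chain z agrees with y, except at G, where a cell has just one
      coface in S and the coefficient becomes 1.\<close>
    define z where "z = (\<Sum>G'\<in>?G. (if G' = G then 1 else Poly_Mapping.lookup y G') *\<^sub>R bas G')"
    have lookup_z: "Poly_Mapping.lookup z G' =
        (if G' \<in> ?G then (if G' = G then 1 else Poly_Mapping.lookup y G') else 0)" for G'
    proof -
      have "Poly_Mapping.lookup z G' =
          (\<Sum>G''\<in>?G. if G'' = G' then (if G' = G then 1 else Poly_Mapping.lookup y G') else 0)"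
        unfolding z_def lookup_sum by (intro sum.cong refl) (simp add: lookup_single)
      then show ?thesis
        using finG by simp
    qed
    have z_supp: "z \<in> supp ?G" and z_supp': "z \<in> supp (cells N n)"
      by (auto simp: supp_iff lookup_z cells_def)
    have GG: "G \<in> ?G"
      using G by (auto simp: cells_def)
    have eq: "obd ori c = sd z"
    proof (rule poly_mapping_eqI)
      fix F
      show "Poly_Mapping.lookup (obd ori c) F = Poly_Mapping.lookup (sd z) F"
      proof (cases "F \<in> cells M n \<and> F \<subseteq> S")
        case False
        then have "F \<notin> cells ?M n"
          by (auto simp: cells_def)
        moreover have "obd ori c \<in> supp (cells ?M n)"
          by (rule obd_cells[OF R.M.face_closed_K c_supp])
        moreover have "sd z \<in> supp (cells ?M n)"
          using R.subdiv_map_cells[OF z_supp] subdiv_map_restrict[OF SN, of z] supp_cells_supp[OF z_supp] by simp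
        ultimately show ?thesis
          unfolding supp_iff by presburger
      next
        case True
        then have F: "F \<in> cells M n" "F \<subseteq> S"
          by auto
        have FM: "F \<in> M" and lenF: "length (ori F) = n"
          using F by (auto simp: cells_def)
        show ?thesis
        proof (cases "F \<subseteq> G")
          case FG: True
          obtain T0 where T0: "T0 \<in> cells M (Suc n)" "T0 \<subseteq> S" "set (ori F) \<subseteq> set (ori T0)"
            by (rule coface_exists[OF S(1) F n])
          have T0U: "T0 \<in> U"
            using T0(1) M.KU by (auto simp: cells_def)
          \<comment> \<open>T0 is the only coface in S, because S lies on one side of G. Its
            incidence number with F enters twice and squares to 1.\<close>
          have "Poly_Mapping.lookup (obd ori c) F = (\<Sum>T\<in>{T0}. w T * Poly_Mapping.lookup (obd ori (bas T)) F)"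
            unfolding lookup_bd
          proof (rule sum.mono_neutral_right[OF finT])
            show "\<forall>T\<in>?T - {T0}. w T * Poly_Mapping.lookup (obd ori (bas T)) F = 0"
            proof (rule ballI, rule ccontr)
              fix T assume T: "T \<in> ?T - {T0}" and nz: "w T * Poly_Mapping.lookup (obd ori (bas T)) F \<noteq> 0"
              then have "set (ori F) \<subseteq> set (ori T)"
                using lookup_obd_bas_nonzero(2)[OF TU, of T F] by auto
              then have "T = T0"
                using boundary_coface_unique[OF S(1) G F(1) FG n _ _ _ T0] T by blast
              then show False
                using T by blast
            qed
          qed (use T0 in auto)
          also have "\<dots> = Poly_Mapping.lookup (sd (bas G)) F *
              (\<bar>Poly_Mapping.lookup (obd ori (bas T0)) F\<bar> * \<bar>Poly_Mapping.lookup (obd ori (bas T0)) F\<bar>)"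
            unfolding w_def using chain_inner_sd_obd_facet[OF T0(1) G(1) F(1) FG T0(3)] by simp
          also have "\<dots> = Poly_Mapping.lookup (sd (bas G)) F"
            using lookup_obd_bas_unit[OF T0U M.KU[OF FM] T0(3)] T0(1) lenF by (simp add: cells_def)
          also have "\<dots> = Poly_Mapping.lookup (sd z) F"
            using lookup_sd[OF z_supp', of F] unique_cell[OF F(1) G(1) FG] F(1) G(1) lookup_z[of G] GG by simp
          finally show ?thesis .
        next
          case FG: False
          \<comment> \<open>A simplex contributing at F also has a facet F' in G. The vertices of F
            and F' are all its vertices, so it lies in S, and the cut-off loses nothing
            here.\<close>
          have "Poly_Mapping.lookup (obd ori c) F =
              (\<Sum>T\<in>cells M (Suc n). w T * Poly_Mapping.lookup (obd ori (bas T)) F)"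
            unfolding lookup_bd
          proof (rule sum.mono_neutral_left[OF finite_cells])
            show "\<forall>T\<in>cells M (Suc n) - ?T. w T * Poly_Mapping.lookup (obd ori (bas T)) F = 0"
            proof (rule ballI, rule ccontr)
              fix T assume T: "T \<in> cells M (Suc n) - ?T" and nz: "w T * Poly_Mapping.lookup (obd ori (bas T)) F \<noteq> 0"
              have TU: "T \<in> U"
                using T M.KU by (auto simp: cells_def)
              obtain F' where F': "F' \<in> cells M n" "F' \<subseteq> G" "Poly_Mapping.lookup (obd ori (bas T)) F' \<noteq> 0"
                using chain_inner_sd_obd[OF _ G(1) TU] nz by (auto simp: w_def)
              have "set (ori T) = set (ori F) \<union> set (ori F')"
              proof (rule two_facets_span[OF TU])
                show "F \<noteq> F'"
                  using F'(2) FG by blast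
              qed (use lookup_obd_bas_nonzero[OF TU, of F] lookup_obd_bas_nonzero[OF TU, of F'] nz F'(3) in auto)
              then have "set (ori T) \<subseteq> S"
                using set_ori_subset[OF M.KU[OF FM]] set_ori_subset[OF M.KU, of F'] F(2) F'(1,2) G(2)
                by (auto simp: cells_def)
              then have "T \<subseteq> S"
                by (rule subset_convex_if_ori[OF TU _ convex_U[OF SU]])
              then show False
                using T by blast
            qed
          qed auto
          also have "\<dots> = Poly_Mapping.lookup (sd y) F"
            unfolding y(2)[symmetric] lookup_laplacian w_def ..
          also have "\<dots> = Poly_Mapping.lookup (sd z) F"
          proof (cases "carrier_cell F \<in> cells N n")
            case C: True
            have "carrier_cell F \<subseteq> S"
              by (rule carrier_cell(3)[OF FM SN F(2)])
            then have "carrier_cell F \<in> ?G"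
              using C by (auto simp: cells_def)
            moreover have "carrier_cell F \<noteq> G"
              using carrier_cell(2)[OF FM] FG by blast
            ultimately show ?thesis
              using lookup_sd[OF z_supp', of F] lookup_sd[OF y(1), of F] lookup_z[of "carrier_cell F"] by simp
          next
            case False
            then show ?thesis
              using lookup_sd[OF z_supp', of F] lookup_sd[OF y(1), of F] by simp
          qed
          finally show ?thesis .
        qed
      qed
    qed
    \<comment> \<open>Inside S, c is a relative cycle in the top dimension: no simplices above it
      are available, and S is the only simplex of \<open>N\<close> to subdivide. So c is a multiple
      of the subdivided S.\<close>
    have "obd ori c = subdiv_map ori ?M z"
      using eq subdiv_map_restrict[OF SN supp_cells_supp[OF z_supp]] by simp
    then obtain x u where x: "x \<in> supp (cells ?N (Suc n))" and u: "u \<in> supp (cells ?M (Suc (Suc n)))"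
      and cxu: "c = subdiv_map ori ?M x + obd ori u"
      using R.relative_cycle_bounds[OF M0 c_supp z_supp] by blast
    have "cells ?M (Suc (Suc n)) = {}"
    proof (rule ccontr)
      assume "cells ?M (Suc (Suc n)) \<noteq> {}"
      then obtain T where T: "T \<in> M" "T \<subseteq> S" "length (ori T) = Suc (Suc n)"
        by (auto simp: cells_def)
      then show False
        using aff_dim_subset[OF T(2)] aff_dim_ori[OF M.KU[OF T(1)]] aff_dim_ori[OF SU] lenS by simp
    qed
    then have "u = 0"
      using u by (auto simp: supp_def)
    have "cells ?N (Suc n) \<subseteq> {S}"
      using N.eq_if_subset_length[OF SN] lenS by (auto simp: cells_def)
    then have "x \<in> supp {S}"
      using x supp_mono by blast
    then obtain a where a: "x = a *\<^sub>R bas S"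
      by (rule supp_singletonE)
    have c_eq: "c = a *\<^sub>R sd (bas S)"
      using cxu \<open>u = 0\<close> subdiv_map_restrict[OF SN supp_cells_supp[OF x]] by (simp add: a)
    \<comment> \<open>The multiple is not 0, because c has coefficient 1 or -1 on the coface of a
      cell of G.\<close>
    obtain F0 where F0: "F0 \<in> cells M n" "F0 \<subseteq> G"
      using top_cell_exists[OF _ G(1)] M0 by blast
    have F0S: "F0 \<subseteq> S"
      using F0(2) G(2) by blast
    obtain T0 where T0: "T0 \<in> cells M (Suc n)" "T0 \<subseteq> S" "set (ori F0) \<subseteq> set (ori T0)"
      by (rule coface_exists[OF S(1) F0(1) F0S n])
    have "\<bar>w T0\<bar> = 1"
      unfolding w_def chain_inner_sd_obd_facet[OF T0(1) G(1) F0 T0(3)]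
      using lookup_sd_bas_unit[OF G(1) F0] lookup_obd_bas_unit[of T0 F0] T0 F0(1) M.KU
      by (simp add: abs_mult cells_def)
    then have "Poly_Mapping.lookup c T0 \<noteq> 0"
      using T0 lookup_c[of T0] by auto
    then have "a \<noteq> 0"
      using c_eq by auto
    \<comment> \<open>The subdivided S is nonzero on every top cell T of S, hence so is c; a nonzero
      weight of T means that T has a facet in G.\<close>
    have "Poly_Mapping.lookup c T \<noteq> 0"
      using \<open>a \<noteq> 0\<close> lookup_sd_bas_unit[OF S(1), of T] T by (auto simp: c_eq)
    then have "chain_inner (sd (bas G)) (obd ori (bas T)) \<noteq> 0"
      using lookup_c[of T] T by (simp add: w_def)
    then obtain F where "F \<in> cells M n" "F \<subseteq> G" "Poly_Mapping.lookup (obd ori (bas T)) F \<noteq> 0"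
      by (rule chain_inner_sd_obd[OF _ G(1) TU[OF T]])
    then show ?thesis
      using lookup_obd_bas_nonzero(2)[OF TU[OF T]] by blast
  qed
  obtain T where T: "T \<in> ?T"
    using top_cell_exists[OF _ S(1)] M0 by blast
  have "T = S"
  proof (rule eq_if_facets_in_facets[OF SU TU[OF T]])
    show "T \<subseteq> S" "length (ori T) = length (ori S)"
      using T lenS by (auto simp: cells_def)
    fix s assume s: "s \<in> set (ori S)"
    let ?G = "convex hull (set (ori S) - {s})"
    have oG: "set (ori ?G) = set (ori S) - {s}"
      by (rule set_ori_hull[OF SU]) auto
    have GN: "?G \<in> N"
      by (rule N.hull_in_K[OF SN]) auto
    have "length (ori ?G) = n"
      using length_ori[OF N.KU[OF GN]] oG length_ori[OF SU] lenS s by simp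
    moreover have "?G \<subseteq> S"
      using hull_mono[of "set (ori S) - {s}" "set (ori S)" convex] hull_ori[OF SU] by auto
    ultimately obtain F where F: "F \<in> cells M n" "F \<subseteq> ?G" "set (ori F) \<subseteq> set (ori T)"
      using facet[of ?G T] T GN by (auto simp: cells_def)
    have FM: "F \<in> M"
      using F(1) by (simp add: cells_def)
    obtain t where "t \<in> apexes S F" "T = convex hull (insert t (set (ori F)))"
      using coface_apex[of T n S F] T F by blast
    then have "set (ori T) = insert t (set (ori F))"
      by (auto simp: apexes_def)
    then show "\<exists>t\<in>set (ori T). set (ori T) - {t} \<subseteq> convex hull (set (ori S) - {s})"
      using set_ori_subset[OF M.KU[OF FM]] F(2) by (intro bexI[of _ t]) auto
  qed
  then show False
    using T S(2) by (auto simp: cells_def)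
qed

theorem const_C_bounds:
  assumes S: "S \<in> N" "S \<notin> M" "Suc (Suc k) \<le> length (ori S)"
  shows "const_C ori N M k \<in> {0<..<1}"
proof -
  let ?n = "Suc k"
  \<comment> \<open>A simplex of \<open>N\<close> of least dimension among those of dimension at
    least k + 1 that are missing from \<open>M\<close>.\<close>
  obtain S' where S': "S' \<in> N" "S' \<notin> M" "Suc ?n \<le> length (ori S')"
    and min: "\<And>T. T \<in> N \<Longrightarrow> T \<notin> M \<Longrightarrow> Suc ?n \<le> length (ori T) \<Longrightarrow> length (ori S') \<le> length (ori T)"
    using ex_has_least_nat[of "\<lambda>S. S \<in> N \<and> S \<notin> M \<and> Suc ?n \<le> length (ori S)" S "\<lambda>S. length (ori S)"] S
    by blast
  have SU: "S' \<in> U"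
    using S'(1) by (rule N.KU)
  have "S \<noteq> {}"
    using set_ori_subset[OF N.KU[OF S(1)]] S(3) by auto
  then have M0: "{} \<in> M"
    by (rule empty_in_M[OF S(1)])
  have "\<exists>x\<in>supp (cells N ?n). \<exists>v\<in>V ?n. chain_inner (sd x) (obd ori v) \<noteq> 0"
  proof (rule ccontr)
    assume "\<not> ?thesis"
    then have orth: "chain_inner (sd x) (obd ori v) = 0" if "x \<in> supp (cells N ?n)" "v \<in> V ?n" for x v
      using that by blast
    have L: "\<exists>y\<in>supp (cells N ?n). obd ori (cobd ?n (sd (bas G))) = sd y" if "G \<in> cells N ?n" for G
      using laplacian_im_subdiv[of k "bas G"] orth that by (metis bas_in_supp)
    show False
    proof (cases "length (ori S') = Suc ?n")
      case True
      then show False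
        using laplacian_not_preserved_if_cell_subdivided[OF L, of S'] S' by (simp add: cells_def)
    next
      case False
      \<comment> \<open>Facets of S' still have at least k + 2 vertices, so they are in
        \<open>M\<close> by minimality, and every proper face lies in a facet.\<close>
      have faces: "convex hull A \<in> M" if A: "A \<subset> set (ori S')" for A
      proof -
        obtain v where v: "v \<in> set (ori S')" "v \<notin> A"
          using A by blast
        let ?B = "convex hull (set (ori S') - {v})"
        have oB: "set (ori ?B) = set (ori S') - {v}"
          by (rule set_ori_hull[OF SU]) auto
        have BN: "?B \<in> N"
          by (rule N.hull_in_K[OF S'(1)]) auto
        have lenB: "length (ori ?B) = length (ori S') - 1"
          using length_ori[OF N.KU[OF BN]] oB length_ori[OF SU] v(1) by simp
        have "?B \<in> M"
        proof (rule ccontr)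
          assume "?B \<notin> M"
          then have "length (ori S') \<le> length (ori ?B)"
            using BN lenB False S'(3) by (intro min) auto
          then show False
            using lenB S'(3) by linarith
        qed
        then show ?thesis
          using M.hull_in_K[of ?B A] oB A v(2) by auto
      qed
      show False
        using laplacian_not_preserved_if_skeleton_unchanged[OF L _ S'(1,2) _ faces] S'(3) by simp
    qed
  qed
  then obtain x v where xv: "x \<in> supp (cells N ?n)" "v \<in> V ?n" "chain_inner (sd x) (obd ori v) \<noteq> 0"
    by blast
  show ?thesis
    unfolding const_C_def im_subdiv_eq chain_bd_V
  proof (rule max_cos_bounds[OF finite_cells[of ?n]])
    show "subspace (sd ` supp (cells N ?n))" "subspace (obd ori ` V ?n)"
      by (intro linear_subspace_image linear_subdiv_map linear_obd subspace_supp subspace_V)+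
    show "sd ` supp (cells N ?n) \<subseteq> supp (cells M ?n)"
      using subdiv_map_cells by blast
    show "obd ori ` V ?n \<subseteq> supp (cells M ?n)"
      using obd_cells[OF M.face_closed_K] V_supp[of ?n] by blast
    show "sd ` supp (cells N ?n) \<inter> obd ori ` V ?n \<subseteq> {0}"
    proof
      fix c assume "c \<in> sd ` supp (cells N ?n) \<inter> obd ori ` V ?n"
      then obtain x v where "x \<in> supp (cells N ?n)" "v \<in> V ?n" "c = sd x" "c = obd ori v"
        by blast
      then have "v = 0"
        using im_subdiv_Int_bd_V[OF M0, of v k x] by simp
      then show "c \<in> {0}"
        using \<open>c = obd ori v\<close> by simp
    qed
  qed (use xv in auto)
qed

end

section \<open>From an orientation choice to the locale, and the theorem\<close>

lemma subdivided_if_subdivision: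
  assumes "subdivision N M" "orientation_choice (N \<union> M) ori"
  shows "subdivided (N \<union> M) ori N M"
proof
  have complex: "simplicial_complex N" "simplicial_complex M"
    using assms(1) by (auto simp: subdivision_def)
  have complex_props: "(\<exists>n. n simplex S) \<and> (\<forall>F. F face_of S \<longrightarrow> F \<in> K)"
    if "simplicial_complex K" "S \<in> K" for S and K :: "'a set set"
    using that by (auto simp: simplicial_complex_def)
  have props: "(\<exists>n. n simplex S) \<and> (\<forall>F. F face_of S \<longrightarrow> F \<in> N \<union> M)" if "S \<in> N \<union> M" for S
    using that complex_props[OF complex(1), of S] complex_props[OF complex(2), of S] by auto
  have ori: "distinct (ori S) \<and> set (ori S) = {v. v extreme_point_of S}" if "S \<in> N \<union> M" for S
    using assms(2) that unfolding orientation_choice_def by blast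
  have vertices: "\<not> affine_dependent (set (ori S)) \<and> convex hull (set (ori S)) = S" if S: "S \<in> N \<union> M" for S
  proof -
    obtain C where C: "\<not> affine_dependent C" "S = convex hull C"
      using props[OF S] unfolding simplex_def by blast
    have "v extreme_point_of S \<longleftrightarrow> v \<in> C" for v
      unfolding C(2) by (rule extreme_point_of_convex_hull_affine_independent[OF C(1)])
    then have "set (ori S) = C"
      using ori[OF S] by blast
    then show ?thesis
      using C by simp
  qed
  fix S assume S: "S \<in> N \<union> M"
  show "\<not> affine_dependent (set (ori S))" "convex hull (set (ori S)) = S" "distinct (ori S)"
    using vertices[OF S] ori[OF S] by auto
  show "convex hull A \<in> N \<union> M" if "A \<subseteq> set (ori S)" for A
  proof -
    have "convex hull A face_of convex hull (set (ori S))"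
      using face_of_convex_hull_affine_independent[OF conjunct1[OF vertices[OF S]]] that by blast
    then have "convex hull A face_of S"
      using vertices[OF S] by simp
    then show ?thesis
      using props[OF S] by blast
  qed
qed (use assms in auto)

theorem theorem4p13:
  fixes N M :: "'a::euclidean_space set set"
    and ori :: "'a set \<Rightarrow> 'a list"
  assumes "subdivision N M"
    and "orientation_choice (N \<union> M) ori"
  shows "(\<forall>k. card (simplices_of M (Suc k)) \<noteq> card (simplices_of N (Suc k)) \<longrightarrow>
              const_C ori N M k \<in> {0<..<1}) \<and>
         (pure_complex N \<and> M \<noteq> N \<longrightarrow>
            (\<forall>k. int k < complex_dim N \<longrightarrow> const_C ori N M k \<in> {0<..<1}))"
proof -
  interpret subdivided "N \<union> M" ori N M
    by (rule subdivided_if_subdivision[OF assms])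
  \<comment> \<open>T and S are both in \<open>M\<close>, so T is a face of S and belongs to
    \<open>N\<close> like S.\<close>
  have common: "T \<in> N" if "T \<in> M" "T \<subseteq> S" "S \<in> N" "S \<in> M" for S T
    using M.Int_face[OF that(4,1)] N.face_in_K[OF that(3)] that(2) by (simp add: inf.absorb2)
  have part1: "const_C ori N M k \<in> {0<..<1}"
    if card: "card (simplices_of M (Suc k)) \<noteq> card (simplices_of N (Suc k))" for k
  proof -
    \<comment> \<open>If every simplex of \<open>N\<close> of dimension at least k + 1 were in
      \<open>M\<close>, the two complexes would have the same (k + 1)-simplices.\<close>
    have "\<exists>S. S \<in> N \<and> S \<notin> M \<and> Suc (Suc k) \<le> length (ori S)"
    proof (rule ccontr)
      assume "\<not> ?thesis"
      then have *: "S \<in> M" if "S \<in> N" "Suc (Suc k) \<le> length (ori S)" for S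
        using that by blast
      have "simplices_of M (Suc k) = simplices_of N (Suc k)"
        unfolding simplices_of_eq_cells[OF M_U] simplices_of_eq_cells[OF N_U]
      proof (intro equalityI subsetI)
        fix T assume "T \<in> cells M (Suc (Suc k))"
        then have T: "T \<in> M" "length (ori T) = Suc (Suc k)"
          by (auto simp: cells_def)
        obtain S where S: "S \<in> N" "T \<subseteq> S"
          using contained[OF T(1)] by blast
        have "Suc (Suc k) \<le> length (ori S)"
          using aff_dim_subset[OF S(2)] aff_dim_ori[OF M.KU[OF T(1)]] aff_dim_ori[OF N.KU[OF S(1)]] T(2) by simp
        then show "T \<in> cells N (Suc (Suc k))"
          using common[OF T(1) S(2,1)] *[OF S(1)] T(2) by (simp add: cells_def)
      qed (use * in \<open>auto simp: cells_def\<close>)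
      then show False
        using card by simp
    qed
    then show ?thesis
      using const_C_bounds by blast
  qed
  have part2: "const_C ori N M k \<in> {0<..<1}"
    if pure: "pure_complex N" and "M \<noteq> N" and k: "int k < complex_dim N" for k
  proof -
    have "\<not> N \<subseteq> M"
    proof
      assume "N \<subseteq> M"
      moreover have "M \<subseteq> N"
        using contained common \<open>N \<subseteq> M\<close> by blast
      ultimately show False
        using \<open>M \<noteq> N\<close> by blast
    qed
    then obtain R where R: "R \<in> N" "R \<notin> M"
      by blast
    \<comment> \<open>Purity gives a maximal simplex above R the full dimension, and it is missing
      from \<open>M\<close> because its face R is.\<close>
    let ?A = "{S \<in> N. R \<subseteq> S}"
    have "finite ?A" "?A \<noteq> {}"
      using N.finite_K R(1) by auto
    then obtain S where S: "S \<in> ?A" "\<forall>T\<in>?A. S \<subseteq> T \<longrightarrow> S = T"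
      using finite_has_maximal[of ?A] by blast
    then have SN: "S \<in> N" and "R \<subseteq> S" and max: "\<forall>T\<in>N. S \<subseteq> T \<longrightarrow> T = S"
      by auto
    then have "aff_dim S = complex_dim N"
      using pure unfolding pure_complex_def by blast
    then have "Suc (Suc k) \<le> length (ori S)"
      using k aff_dim_ori[OF N.KU[OF SN]] by linarith
    moreover have "S \<notin> M"
    proof
      assume "S \<in> M"
      have "R face_of S"
        using N.Int_face[OF SN R(1)] \<open>R \<subseteq> S\<close> by (simp add: inf.absorb2)
      then show False
        using M.face_in_K[OF \<open>S \<in> M\<close>] R(2) by blast
    qed
    ultimately show ?thesis
      using const_C_bounds[OF SN] by blast
  qed
  show ?thesis
    using part1 part2 by blast
qed

end
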